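(* Let $R$ be an F-finite ring and $M$ a finitely generated $R$-module. There exists a constant $C>0$ such that for all $P\in\operatorname{Spec}(R)$, all $q=p^e$, and all ideals $I,J$ of $R$ such that $IR_P\subseteq JR_P$ is a $PR_P$-primary pair of ideals, $$\lambda\left(\frac{J^{[q]}M_P}{I^{[q]}M_P}\right)\leq C\,q^{\dim(M_P)}\,\lambda\left(\frac{JR_P}{IR_P}\right).$$
   Context: All rings are commutative, Noetherian, with identity, and of prime characteristic $p$; $q=p^e$ with $e\ge0$; $\lambda$ denotes length (over $R_P$). $I^{[q]}$ is the ideal generated by the $q$th powers of elements of $I$. A ring is F-finite if it is a finite module over itself via the Frobenius endomorphism $r\mapsto r^p$. For a local ring $(S,\mathfrak m)$, an $\mathfrak m$-primary pair of ideals is a containment $I\subseteq J$ of ideals of $S$ with $I$ being $\mathfrak m$-primary ($J$ is then $\mathfrak m$-primary or equal to $S$). If $M_P=0$ the inequality is regarded as trivially true (both sides are $0$). *)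

theory Defs
  imports "HOL-Algebra.Algebra" "HOL-Library.Extended_Real"
begin

section \<open>Modules\<close>

text \<open>
  The record type of modules extends that of rings; the fields \<open>mult\<close> and \<open>one\<close> play no role for
  a module and are left unspecified in the quotient and fraction modules below.
\<close>

definition self_module :: "('a, 'r) ring_scheme \<Rightarrow> ('a, 'a) module" where
  "self_module R =
    \<lparr>carrier = carrier R, monoid.mult = monoid.mult R, monoid.one = monoid.one R,
     ring.zero = ring.zero R, ring.add = ring.add R,
     smult = monoid.mult R\<rparr>"

definition submodule_span ::
    "('a, 'r) ring_scheme \<Rightarrow> ('a, 'm, 'k) module_scheme \<Rightarrow> 'm set \<Rightarrow> 'm set" where
  "submodule_span R M A = \<Inter>{N. submodule N R M \<and> A \<subseteq> N}"

definition fin_gen_module ::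
    "('a, 'r) ring_scheme \<Rightarrow> ('a, 'm, 'k) module_scheme \<Rightarrow> bool" where
  "fin_gen_module R M \<longleftrightarrow>
    (\<exists>A. finite A \<and> A \<subseteq> carrier M \<and> submodule_span R M A = carrier M)"

definition ideal_times_module ::
    "('a, 'r) ring_scheme \<Rightarrow> 'a set \<Rightarrow> ('a, 'm, 'k) module_scheme \<Rightarrow> 'm set" where
  "ideal_times_module R I M =
    submodule_span R M {a \<odot>\<^bsub>M\<^esub> x |a x. a \<in> I \<and> x \<in> carrier M}"

text \<open>The module \<open>N / K\<close> for submodules \<open>K \<subseteq> N\<close> of \<open>M\<close>.\<close>

definition quot_module ::
    "('a, 'm, 'k) module_scheme \<Rightarrow> 'm set \<Rightarrow> 'm set \<Rightarrow> ('a, 'm set) module" where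
  "quot_module M N K =
    \<lparr>carrier = a_rcosets\<^bsub>M\<lparr>carrier := N\<rparr>\<^esub> K,
     monoid.mult = (\<lambda>_ _. undefined), monoid.one = undefined,
     ring.zero = K, ring.add = set_add M,
     smult = (\<lambda>r A. \<Union>x\<in>A. K +>\<^bsub>M\<^esub> (r \<odot>\<^bsub>M\<^esub> x))\<rparr>"

definition module_length ::
    "('a, 'r) ring_scheme \<Rightarrow> ('a, 'm, 'k) module_scheme \<Rightarrow> enat" where
  "module_length R M =
    Sup {enat n |n. \<exists>N. (\<forall>i\<le>n. submodule (N i) R M) \<and> (\<forall>i<n. N i \<subset> N (Suc i))}"


section \<open>Dimension\<close>

text \<open>Since the supremum of the empty set is \<open>0\<close>, the zero ring and the zero module get dimension \<open>0\<close>.\<close>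

definition krull_dim :: "('a, 'r) ring_scheme \<Rightarrow> enat" where
  "krull_dim R =
    Sup {enat n |n. \<exists>Q. (\<forall>i\<le>n. primeideal (Q i) R) \<and> (\<forall>i<n. Q i \<subset> Q (Suc i))}"

definition annihilator ::
    "('a, 'r) ring_scheme \<Rightarrow> ('a, 'm, 'k) module_scheme \<Rightarrow> 'a set" where
  "annihilator R M = {r \<in> carrier R. \<forall>x \<in> carrier M. r \<odot>\<^bsub>M\<^esub> x = \<zero>\<^bsub>M\<^esub>}"

definition module_dim ::
    "('a, 'r) ring_scheme \<Rightarrow> ('a, 'm, 'k) module_scheme \<Rightarrow> enat" where
  "module_dim R M = krull_dim (R Quot annihilator R M)"


section \<open>Localization\<close>

definition fraction_rel ::
    "('a, 'r) ring_scheme \<Rightarrow> ('a, 'm, 'k) module_scheme \<Rightarrow> 'a set \<Rightarrow> (('m \<times> 'a) \<times> ('m \<times> 'a)) set"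
  where
  "fraction_rel R M S =
    {((m, s), (n, t)) |m s n t. m \<in> carrier M \<and> s \<in> S \<and> n \<in> carrier M \<and> t \<in> S \<and>
       (\<exists>u\<in>S. u \<odot>\<^bsub>M\<^esub> (t \<odot>\<^bsub>M\<^esub> m) = u \<odot>\<^bsub>M\<^esub> (s \<odot>\<^bsub>M\<^esub> n))}"

definition frac_class ::
    "('a, 'r) ring_scheme \<Rightarrow> ('a, 'm, 'k) module_scheme \<Rightarrow> 'a set \<Rightarrow> 'm \<Rightarrow> 'a \<Rightarrow> ('m \<times> 'a) set"
  where
  "frac_class R M S m s = fraction_rel R M S `` {(m, s)}"

text \<open>
  The operations on classes are given as unions over representatives; all members of each union
  coincide when \<open>S\<close> is multiplicatively closed.
\<close>

definition fraction_module ::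
    "('a, 'r) ring_scheme \<Rightarrow> ('a, 'm, 'k) module_scheme \<Rightarrow> 'a set
      \<Rightarrow> (('a \<times> 'a) set, ('m \<times> 'a) set) module" where
  "fraction_module R M S =
    \<lparr>carrier = (carrier M \<times> S) // fraction_rel R M S,
     monoid.mult = (\<lambda>_ _. undefined), monoid.one = undefined,
     ring.zero = frac_class R M S \<zero>\<^bsub>M\<^esub> \<one>\<^bsub>R\<^esub>,
     ring.add = (\<lambda>A B. \<Union>(m, s)\<in>A. \<Union>(n, t)\<in>B.
        frac_class R M S (t \<odot>\<^bsub>M\<^esub> m \<oplus>\<^bsub>M\<^esub> s \<odot>\<^bsub>M\<^esub> n) (s \<otimes>\<^bsub>R\<^esub> t)),
     smult = (\<lambda>A B. \<Union>(r, s)\<in>A. \<Union>(n, t)\<in>B. frac_class R M S (r \<odot>\<^bsub>M\<^esub> n) (s \<otimes>\<^bsub>R\<^esub> t))\<rparr>"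

definition fraction_ring :: "('a, 'r) ring_scheme \<Rightarrow> 'a set \<Rightarrow> ('a \<times> 'a) set ring" where
  "fraction_ring R S =
    (let F = fraction_module R (self_module R) S in
     \<lparr>carrier = carrier F, monoid.mult = smult F, monoid.one = frac_class R (self_module R) S \<one>\<^bsub>R\<^esub> \<one>\<^bsub>R\<^esub>,
      ring.zero = ring.zero F, ring.add = ring.add F\<rparr>)"

abbreviation loc_ring :: "('a, 'r) ring_scheme \<Rightarrow> 'a set \<Rightarrow> ('a \<times> 'a) set ring" where
  "loc_ring R P \<equiv> fraction_ring R (carrier R - P)"

abbreviation loc_module ::
    "('a, 'r) ring_scheme \<Rightarrow> ('a, 'm, 'k) module_scheme \<Rightarrow> 'a set
      \<Rightarrow> (('a \<times> 'a) set, ('m \<times> 'a) set) module" where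
  "loc_module R M P \<equiv> fraction_module R M (carrier R - P)"

text \<open>The extended ideal \<open>I R\<^sub>P\<close>.\<close>

definition loc_ideal :: "('a, 'r) ring_scheme \<Rightarrow> 'a set \<Rightarrow> 'a set \<Rightarrow> ('a \<times> 'a) set set" where
  "loc_ideal R I P =
    Idl\<^bsub>loc_ring R P\<^esub> ((\<lambda>r. frac_class R (self_module R) (carrier R - P) r \<one>\<^bsub>R\<^esub>) ` I)"


section \<open>Primary ideals\<close>

definition ideal_radical :: "('a, 'r) ring_scheme \<Rightarrow> 'a set \<Rightarrow> 'a set" where
  "ideal_radical R I = {r \<in> carrier R. \<exists>n::nat. r [^]\<^bsub>R\<^esub> n \<in> I}"

definition primary_ideal :: "'a set \<Rightarrow> ('a, 'r) ring_scheme \<Rightarrow> bool" where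
  "primary_ideal I R \<longleftrightarrow> ideal I R \<and> I \<noteq> carrier R \<and>
    (\<forall>a \<in> carrier R. \<forall>b \<in> carrier R.
       a \<otimes>\<^bsub>R\<^esub> b \<in> I \<longrightarrow> a \<in> I \<or> b \<in> ideal_radical R I)"

definition primary_pair :: "('a, 'r) ring_scheme \<Rightarrow> 'a set \<Rightarrow> 'a set \<Rightarrow> 'a set \<Rightarrow> bool" where
  "primary_pair S \<mm> I J \<longleftrightarrow>
    ideal I S \<and> ideal J S \<and> I \<subseteq> J \<and> primary_ideal I S \<and> ideal_radical S I = \<mm>"


section \<open>Positive characteristic\<close>

definition ring_char :: "('a, 'r) ring_scheme \<Rightarrow> nat" where
  "ring_char R =
    (if \<exists>n>0. add_pow R (n::nat) \<one>\<^bsub>R\<^esub> = \<zero>\<^bsub>R\<^esub>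
     then LEAST n. n > 0 \<and> add_pow R n \<one>\<^bsub>R\<^esub> = \<zero>\<^bsub>R\<^esub> else 0)"

text \<open>\<open>R\<close> as a module over itself via \<open>r \<mapsto> r\<^sup>p\<close>.\<close>

definition frobenius_module :: "nat \<Rightarrow> ('a, 'r) ring_scheme \<Rightarrow> ('a, 'a) module" where
  "frobenius_module p R =
    (self_module R)\<lparr>smult := (\<lambda>r x. (r [^]\<^bsub>R\<^esub> p) \<otimes>\<^bsub>R\<^esub> x)\<rparr>"

definition F_finite :: "('a, 'r) ring_scheme \<Rightarrow> bool" where
  "F_finite R \<longleftrightarrow> fin_gen_module R (frobenius_module (ring_char R) R)"

definition frobenius_power :: "('a, 'r) ring_scheme \<Rightarrow> 'a set \<Rightarrow> nat \<Rightarrow> 'a set" where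
  "frobenius_power R I q = Idl\<^bsub>R\<^esub> ((\<lambda>x. x [^]\<^bsub>R\<^esub> q) ` I)"

end

theory Submission
  imports Defs
begin

text \<open>
  Refining \<open>I R\<^sub>P \<subseteq> J R\<^sub>P\<close> to a filtration with factors \<open>k(P)\<close> reduces the claim to
  \<open>\<lambda>(M\<^sub>P / P\<^bsup>[q]\<^esup> M\<^sub>P) \<le> C q\<^bsup>dim M\<^sub>P\<^esup>\<close>, and a prime filtration of \<open>M\<close> reduces this to
  \<open>M = R/Q\<close> with \<open>Q\<close> prime, where the exponent is the height \<open>h\<close> of \<open>P/Q\<close>.
  Let \<open>F\<close> be \<open>R\<close> viewed as a module over itself through the Frobenius map and
  \<open>r(P) = [k(P) : k(P)\<^sup>p]\<close>. Then \<open>r(Q)\<close> is the number of times \<open>R/Q\<close> occurs in a prime filtration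
  of the quotient \<open>F/Q\<close>, so with
  \<open>f\<^sub>Q(q) = \<lambda>(R\<^sub>P / (Q + P\<^bsup>[q]\<^esup>))\<close> one gets
  \<open>r(P) f\<^sub>Q(p q) \<le> r(Q) f\<^sub>Q(q) + \<Sum> f\<^bsub>Q'\<^esub>(q)\<close>, the sum ranging over finitely many primes
  \<open>Q' \<supset> Q\<close> that do not depend on \<open>P\<close>. Noetherian induction on \<open>Q\<close> yields the bound as soon as
  \<open>r(Q) = p\<^sup>h r(P)\<close>. For adjacent primes \<open>Q \<subset> P\<close> this is the additivity of the Herbrand quotient
  of some \<open>x \<in> P - Q\<close> on \<open>F\<close>; the general case follows along a saturated chain, which exists because
  \<open>r\<close> is bounded and strictly decreasing. The latter also bounds the Krull dimension, without the
  principal ideal theorem.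
\<close>

section \<open>Localised length\<close>

text \<open>Uniformity in \<open>P\<close> decides the form of the argument. Lengths over
  \<open>R_P\<close> are measured by submodules of \<open>M\<close> itself, so that one prime
  filtration, chosen over \<open>R\<close> before any \<open>P\<close> is named, serves all
  localisations; the constants come from finitely many such lists. \<open>F\<close> turns Frobenius
  powers into a recursion for two reasons. An element of \<open>P^[q]\<close> acts on
  \<open>F\<close> as its \<open>p\<close>-th power, so it maps \<open>F\<close> into
  \<open>P^[pq]\<close>. And an ideal of finite colength at \<open>P\<close>, read as a submodule of
  \<open>F\<close>, has \<open>r(P)\<close> times the colength that it has in \<open>R\<close>,
  because each factor \<open>k(P)\<close> becomes a factor \<open>F/P\<close>. The main term of the
  recursion grows by \<open>r(Q)/r(P) = p^h\<close>. Primes \<open>Q'\<close> strictly above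
  \<open>Q\<close> have a strictly smaller exponent, so they add an error of order
  \<open>q^(h-1)\<close>, and these errors still sum to a multiple of \<open>q^h\<close>. The
  exponent is always read off from the quotient of two ranks; the dimension of \<open>M_P\<close>
  enters only as a bound on the lengths of prime chains.\<close>

definition sat ::
    "('a, 'r) ring_scheme \<Rightarrow> ('a, 'm, 'k) module_scheme \<Rightarrow> 'a set \<Rightarrow> 'm set \<Rightarrow> 'm set" where
  "sat R M S N = {x \<in> carrier M. \<exists>s\<in>S. s \<odot>\<^bsub>M\<^esub> x \<in> N}"

text \<open>\<open>sat\<close> contracts the localised submodule back to \<open>M\<close>, so the
  last premise of \<open>step\<close> says that \<open>C\<close> does not become part of
  \<open>B\<close> after inverting \<open>S\<close>. The slack allowed in \<open>base\<close> lets
  both ends of a chain move outwards without changing the count.\<close>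

inductive lchain ::
    "('a, 'r) ring_scheme \<Rightarrow> ('a, 'm, 'k) module_scheme \<Rightarrow> 'a set \<Rightarrow> 'm set \<Rightarrow> 'm set \<Rightarrow> nat \<Rightarrow> bool"
  for R M S where
  base: "submodule A R M \<Longrightarrow> submodule B R M \<Longrightarrow> A \<subseteq> B \<Longrightarrow> lchain R M S A B 0"
| step: "lchain R M S A B n \<Longrightarrow> submodule C R M \<Longrightarrow> B \<subseteq> C \<Longrightarrow> \<not> C \<subseteq> sat R M S B \<Longrightarrow>
           lchain R M S A C (Suc n)"

text \<open>
  A chain between \<open>A\<close> and \<open>B\<close> is counted by the steps that stay proper after inverting \<open>S\<close>, so the
  following is the length of \<open>S\<inverse>(B / A)\<close> over \<open>S\<inverse>R\<close>, expressed without leaving \<open>M\<close>.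
\<close>

definition len ::
    "('a, 'r) ring_scheme \<Rightarrow> ('a, 'm, 'k) module_scheme \<Rightarrow> 'a set \<Rightarrow> 'm set \<Rightarrow> 'm set \<Rightarrow> enat" where
  "len R M S A B = Sup {enat n |n. lchain R M S A B n}"

definition lin_maps ::
    "('a, 'r) ring_scheme \<Rightarrow> ('a, 'm, 'k) module_scheme \<Rightarrow> ('a, 'n, 'l) module_scheme \<Rightarrow> ('m \<Rightarrow> 'n) set"
  where
  "lin_maps R M N = {f. f \<in> carrier M \<rightarrow> carrier N \<and>
     (\<forall>x\<in>carrier M. \<forall>y\<in>carrier M. f (x \<oplus>\<^bsub>M\<^esub> y) = f x \<oplus>\<^bsub>N\<^esub> f y) \<and>
     (\<forall>r\<in>carrier R. \<forall>x\<in>carrier M. f (r \<odot>\<^bsub>M\<^esub> x) = r \<odot>\<^bsub>N\<^esub> f x)}"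

lemma set_add_iff: "x \<in> A <+>\<^bsub>M\<^esub> B \<longleftrightarrow> (\<exists>a\<in>A. \<exists>b\<in>B. x = a \<oplus>\<^bsub>M\<^esub> b)"
  by (auto simp: set_add_def')

lemma len_leI: "(\<And>n. lchain R M S A B n \<Longrightarrow> enat n \<le> k) \<Longrightarrow> len R M S A B \<le> k"
  unfolding len_def by (rule Sup_least) auto

lemma lchain_le_len: "lchain R M S A B n \<Longrightarrow> enat n \<le> len R M S A B"
  unfolding len_def by (rule Sup_upper) auto

lemma len_mono_chains:
  assumes "\<And>n. lchain R M S A B n \<Longrightarrow> lchain R' M' S' A' B' n"
  shows "len R M S A B \<le> len R' M' S' A' B'"
  by (rule len_leI) (blast intro: lchain_le_len assms)

lemma lchain_submoduleD:
  assumes "lchain R M S A B n"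
  shows "submodule A R M" "submodule B R M" "A \<subseteq> B"
  using assms by (induction) auto

lemma lchain_mono_right:
  assumes "lchain R M S A B n" "submodule C R M" "B \<subseteq> C"
  shows "lchain R M S A C n"
  using assms
proof (induction arbitrary: C)
  case (base A B)
  then show ?case by (auto intro: lchain.base)
next
  case (step A B n C D)
  show ?case
    by (rule lchain.step[OF step.hyps(1) step.prems(1)]) (use step in auto)
qed

lemma lchain_mono_left:
  assumes "lchain R M S A B n" "submodule A' R M" "A' \<subseteq> A"
  shows "lchain R M S A' B n"
  using assms
proof (induction)
  case (base A B)
  then show ?case by (auto intro: lchain.base)
next
  case (step A B n C)
  then show ?case by (auto intro: lchain.step)
qed

lemma lchain_trans:
  assumes "lchain R M S A B n" "lchain R M S B C m"
  shows "lchain R M S A C (n + m)"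
  using assms(2,1)
proof (induction)
  case (base A' B')
  then show ?case by (auto intro: lchain_mono_right)
next
  case (step A' B' k C')
  then show ?case by (auto intro: lchain.step)
qed

lemma lchain_downward:
  assumes "lchain R M S A B n" "m \<le> n"
  shows "lchain R M S A B m"
  using assms
proof (induction arbitrary: m)
  case (base A B)
  then show ?case by (auto intro: lchain.base)
next
  case (step A B n C)
  show ?case
  proof (cases "m = Suc n")
    case True
    with step show ?thesis by (auto intro: lchain.step)
  next
    case False
    with step have "lchain R M S A B m" by auto
    with step show ?thesis by (auto intro: lchain_mono_right)
  qed
qed

text \<open>Chain lengths are closed downwards, so a missing \<open>n\<close> would bound them all
  by \<open>n - 1\<close>. An inequality for the supremum thus yields an actual chain, even when the
  length is infinite.\<close>

lemma lchain_of_len: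
  assumes "submodule A R M" "submodule B R M" "A \<subseteq> B" "enat n \<le> len R M S A B"
  shows "lchain R M S A B n"
proof (rule ccontr)
  assume no: "\<not> lchain R M S A B n"
  have b: "lchain R M S A B 0" using assms by (auto intro: lchain.base)
  then have n0: "n \<noteq> 0" using no by metis
  have "len R M S A B \<le> enat (n - 1)"
  proof (rule len_leI)
    fix m assume "lchain R M S A B m"
    then have "m < n" using no lchain_downward not_less by blast
    then show "enat m \<le> enat (n - 1)" by auto
  qed
  with assms(4) have "enat n \<le> enat (n - 1)" by (rule order_trans)
  with n0 show False by simp
qed

text \<open>Besides complements of primes, \<open>S = {\<one>}\<close> is used throughout: it gives
  the theory without localisation, in which the filtrations common to all primes are built.\<close>

locale smod = module R M for R (structure) and M (structure) and S +
  assumes S_sub: "S \<subseteq> carrier R" and one_S: "\<one> \<in> S"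
    and mult_S: "\<And>s t. s \<in> S \<Longrightarrow> t \<in> S \<Longrightarrow> s \<otimes> t \<in> S"
begin

lemma S_car [simp]: "s \<in> S \<Longrightarrow> s \<in> carrier R" using S_sub by auto

lemma sub_car: "submodule A R M \<Longrightarrow> x \<in> A \<Longrightarrow> x \<in> carrier M"
  using submoduleE(1) by auto
lemma sub_zero: "submodule A R M \<Longrightarrow> \<zero>\<^bsub>M\<^esub> \<in> A"
  using submoduleE(2,3,5)[of A] sub_car[of A] by (metis all_not_in_conv M.r_neg)
lemma sub_add: "submodule A R M \<Longrightarrow> x \<in> A \<Longrightarrow> y \<in> A \<Longrightarrow> x \<oplus>\<^bsub>M\<^esub> y \<in> A"
  using submoduleE(5) by auto
lemma sub_neg: "submodule A R M \<Longrightarrow> x \<in> A \<Longrightarrow> \<ominus>\<^bsub>M\<^esub> x \<in> A"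
  using submoduleE(3) by auto
lemma sub_minus: "submodule A R M \<Longrightarrow> x \<in> A \<Longrightarrow> y \<in> A \<Longrightarrow> x \<ominus>\<^bsub>M\<^esub> y \<in> A"
  using sub_add sub_neg by (auto simp: a_minus_def)
lemma sub_smult: "submodule A R M \<Longrightarrow> r \<in> carrier R \<Longrightarrow> x \<in> A \<Longrightarrow> r \<odot>\<^bsub>M\<^esub> x \<in> A"
  using submoduleE(4) by auto

lemma sub_cancel: "submodule A R M \<Longrightarrow> x \<in> A \<Longrightarrow> x \<oplus>\<^bsub>M\<^esub> y \<in> A \<Longrightarrow> y \<in> carrier M \<Longrightarrow> y \<in> A"
proof -
  assume A: "submodule A R M" "x \<in> A" "x \<oplus>\<^bsub>M\<^esub> y \<in> A" "y \<in> carrier M"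
  then have "\<ominus>\<^bsub>M\<^esub> x \<oplus>\<^bsub>M\<^esub> (x \<oplus>\<^bsub>M\<^esub> y) \<in> A" by (auto intro: sub_add sub_neg)
  then show "y \<in> A" using A sub_car by (simp add: M.r_neg2 M.r_neg1)
qed

lemma submodI:
  assumes "H \<subseteq> carrier M" "\<zero>\<^bsub>M\<^esub> \<in> H"
    and "\<And>a b. a \<in> H \<Longrightarrow> b \<in> H \<Longrightarrow> a \<oplus>\<^bsub>M\<^esub> b \<in> H"
    and sm: "\<And>r x. r \<in> carrier R \<Longrightarrow> x \<in> H \<Longrightarrow> r \<odot>\<^bsub>M\<^esub> x \<in> H"
  shows "submodule H R M"
proof (rule submoduleI)
  fix a assume a: "a \<in> H"
  then have "\<ominus>\<^bsub>M\<^esub> a = (\<ominus> \<one>) \<odot>\<^bsub>M\<^esub> a"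
    using assms(1) by (auto simp: smult_l_minus)
  then show "\<ominus>\<^bsub>M\<^esub> a \<in> H" using sm a by simp
qed (use assms in auto)

lemma sub_Int: "submodule A R M \<Longrightarrow> submodule B R M \<Longrightarrow> submodule (A \<inter> B) R M"
  by (rule submodI) (auto intro: sub_car sub_zero sub_add sub_smult)

lemma sub_sum:
  assumes "submodule A R M" "submodule B R M" shows "submodule (A <+>\<^bsub>M\<^esub> B) R M"
proof (rule submodI)
  show "A <+>\<^bsub>M\<^esub> B \<subseteq> carrier M" using assms sub_car unfolding set_add_iff subset_iff by (metis M.add.m_closed)
  show "\<zero>\<^bsub>M\<^esub> \<in> A <+>\<^bsub>M\<^esub> B" using sub_zero[OF assms(1)] sub_zero[OF assms(2)]
    by (force simp: set_add_iff)
  fix x y assume "x \<in> A <+>\<^bsub>M\<^esub> B" "y \<in> A <+>\<^bsub>M\<^esub> B"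
  then obtain a b a' b' where *: "a \<in> A" "b \<in> B" "a' \<in> A" "b' \<in> B" "x = a \<oplus>\<^bsub>M\<^esub> b" "y = a' \<oplus>\<^bsub>M\<^esub> b'"
    by (auto simp: set_add_iff)
  moreover from * have "a \<in> carrier M" "b \<in> carrier M" "a' \<in> carrier M" "b' \<in> carrier M"
    using assms sub_car by auto
  then have "(a \<oplus>\<^bsub>M\<^esub> b) \<oplus>\<^bsub>M\<^esub> (a' \<oplus>\<^bsub>M\<^esub> b') = (a \<oplus>\<^bsub>M\<^esub> a') \<oplus>\<^bsub>M\<^esub> (b \<oplus>\<^bsub>M\<^esub> b')"
    by (simp add: M.a_ac)
  ultimately have "x \<oplus>\<^bsub>M\<^esub> y = (a \<oplus>\<^bsub>M\<^esub> a') \<oplus>\<^bsub>M\<^esub> (b \<oplus>\<^bsub>M\<^esub> b')" by simp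
  moreover have "a \<oplus>\<^bsub>M\<^esub> a' \<in> A" "b \<oplus>\<^bsub>M\<^esub> b' \<in> B" using * assms sub_add by blast+
  ultimately show "x \<oplus>\<^bsub>M\<^esub> y \<in> A <+>\<^bsub>M\<^esub> B" unfolding set_add_iff by blast
next
  fix r x assume r: "r \<in> carrier R" and "x \<in> A <+>\<^bsub>M\<^esub> B"
  then obtain a b where *: "a \<in> A" "b \<in> B" "x = a \<oplus>\<^bsub>M\<^esub> b"
    by (auto simp: set_add_iff)
  then have "r \<odot>\<^bsub>M\<^esub> x = r \<odot>\<^bsub>M\<^esub> a \<oplus>\<^bsub>M\<^esub> r \<odot>\<^bsub>M\<^esub> b" using assms sub_car r smult_r_distr by auto
  moreover have "r \<odot>\<^bsub>M\<^esub> a \<in> A" "r \<odot>\<^bsub>M\<^esub> b \<in> B" using * r assms sub_smult by blast+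
  ultimately show "r \<odot>\<^bsub>M\<^esub> x \<in> A <+>\<^bsub>M\<^esub> B" unfolding set_add_iff by blast
qed

lemma sum_upper1: "submodule A R M \<Longrightarrow> submodule B R M \<Longrightarrow> A \<subseteq> A <+>\<^bsub>M\<^esub> B"
proof
  fix x assume A: "submodule A R M" "submodule B R M" "x \<in> A"
  then have "x = x \<oplus>\<^bsub>M\<^esub> \<zero>\<^bsub>M\<^esub>" using sub_car by simp
  then show "x \<in> A <+>\<^bsub>M\<^esub> B" using A sub_zero by (auto simp: set_add_iff)
qed

lemma sum_comm: "submodule A R M \<Longrightarrow> submodule B R M \<Longrightarrow> A <+>\<^bsub>M\<^esub> B = B <+>\<^bsub>M\<^esub> A"
  by (auto simp: set_add_iff) (metis M.a_comm sub_car)+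

lemma sum_upper2: "submodule A R M \<Longrightarrow> submodule B R M \<Longrightarrow> B \<subseteq> A <+>\<^bsub>M\<^esub> B"
  using sum_upper1 sum_comm by metis

lemma sum_least: "submodule C R M \<Longrightarrow> A \<subseteq> C \<Longrightarrow> B \<subseteq> C \<Longrightarrow> A <+>\<^bsub>M\<^esub> B \<subseteq> C"
  unfolding set_add_iff subset_iff by (metis sub_add)

lemma sum_absorb: "submodule A R M \<Longrightarrow> submodule B R M \<Longrightarrow> A \<subseteq> B \<Longrightarrow> A <+>\<^bsub>M\<^esub> B = B"
  by (intro equalityI sum_least sum_upper2) auto

lemma sum_mono: "A \<subseteq> A' \<Longrightarrow> B \<subseteq> B' \<Longrightarrow> A <+>\<^bsub>M\<^esub> B \<subseteq> A' <+>\<^bsub>M\<^esub> B'"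
  unfolding set_add_iff subset_iff by blast

lemma sat_increasing: "submodule A R M \<Longrightarrow> A \<subseteq> sat R M S A"
  using one_S by (force simp: sat_def sub_car)

lemma sat_mono: "A \<subseteq> B \<Longrightarrow> sat R M S A \<subseteq> sat R M S B"
  by (auto simp: sat_def)

lemma sat_sat: "submodule A R M \<Longrightarrow> sat R M S (sat R M S A) = sat R M S A"
proof
  assume A: "submodule A R M"
  show "sat R M S A \<subseteq> sat R M S (sat R M S A)" by (rule sat_mono[OF sat_increasing[OF A]])
  show "sat R M S (sat R M S A) \<subseteq> sat R M S A"
  proof
    fix x assume "x \<in> sat R M S (sat R M S A)"
    then obtain s t where "x \<in> carrier M" "s \<in> S" "t \<in> S" "t \<odot>\<^bsub>M\<^esub> (s \<odot>\<^bsub>M\<^esub> x) \<in> A" by (auto simp: sat_def)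
    then have "(t \<otimes> s) \<odot>\<^bsub>M\<^esub> x \<in> A" "t \<otimes> s \<in> S" "x \<in> carrier M" by (auto simp: smult_assoc1 mult_S)
    then show "x \<in> sat R M S A" by (auto simp: sat_def)
  qed
qed

lemma sat_submodule: assumes A: "submodule A R M" shows "submodule (sat R M S A) R M"
proof (rule submodI)
  show "sat R M S A \<subseteq> carrier M" by (auto simp: sat_def)
  show "\<zero>\<^bsub>M\<^esub> \<in> sat R M S A" using sat_increasing[OF A] sub_zero[OF A] by auto
  fix x y assume "x \<in> sat R M S A" "y \<in> sat R M S A"
  then obtain s t where *: "x \<in> carrier M" "y \<in> carrier M" "s \<in> S" "t \<in> S" "s \<odot>\<^bsub>M\<^esub> x \<in> A" "t \<odot>\<^bsub>M\<^esub> y \<in> A"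
    by (auto simp: sat_def)
  have "(s \<otimes> t) \<odot>\<^bsub>M\<^esub> (x \<oplus>\<^bsub>M\<^esub> y) = t \<odot>\<^bsub>M\<^esub> (s \<odot>\<^bsub>M\<^esub> x) \<oplus>\<^bsub>M\<^esub> s \<odot>\<^bsub>M\<^esub> (t \<odot>\<^bsub>M\<^esub> y)"
    using * by (simp add: smult_r_distr smult_assoc1[symmetric] R.m_comm)
  also have "\<dots> \<in> A" using * A by (auto intro!: sub_add sub_smult)
  finally show "x \<oplus>\<^bsub>M\<^esub> y \<in> sat R M S A" using * mult_S by (auto simp: sat_def)
next
  fix r x assume r: "r \<in> carrier R" and "x \<in> sat R M S A"
  then obtain s where *: "x \<in> carrier M" "s \<in> S" "s \<odot>\<^bsub>M\<^esub> x \<in> A" by (auto simp: sat_def)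
  have "s \<odot>\<^bsub>M\<^esub> (r \<odot>\<^bsub>M\<^esub> x) = r \<odot>\<^bsub>M\<^esub> (s \<odot>\<^bsub>M\<^esub> x)"
    using * r by (simp add: smult_assoc1[symmetric] R.m_comm)
  also have "\<dots> \<in> A" using * A r by (auto intro!: sub_smult)
  finally show "r \<odot>\<^bsub>M\<^esub> x \<in> sat R M S A" using * r by (auto simp: sat_def)
qed

text \<open>By the modular law, a step that becomes trivial both after intersecting with
  \<open>B\<close> and after adding \<open>B\<close> was trivial already. Hence every step survives
  on at least one side; it may survive on both, which is why only \<open>n \<le> n1 + n2\<close> is
  claimed.\<close>

lemma lchain_split:
  assumes "lchain R M S A C n" "submodule B R M" "A \<subseteq> B"
  shows "\<exists>n1 n2. n \<le> n1 + n2 \<and> lchain R M S A (C \<inter> B) n1 \<and> lchain R M S B (C <+>\<^bsub>M\<^esub> B) n2"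
  using assms
proof (induction)
  case (base A C)
  have "lchain R M S A (C \<inter> B) 0" using base by (intro lchain.base sub_Int) auto
  moreover have "lchain R M S B (C <+>\<^bsub>M\<^esub> B) 0"
    using base by (intro lchain.base sub_sum sum_upper2) auto
  ultimately show ?case by blast
next
  case (step A N n N')
  then obtain n1 n2 where n: "n \<le> n1 + n2" and c1: "lchain R M S A (N \<inter> B) n1"
    and c2: "lchain R M S B (N <+>\<^bsub>M\<^esub> B) n2" by auto
  have N: "submodule N R M" using step.hyps(1) by (auto dest: lchain_submoduleD)
  note subs = N step.hyps(2) step.prems(1)
  have i: "submodule (N' \<inter> B) R M" "N \<inter> B \<subseteq> N' \<inter> B" and s: "submodule (N' <+>\<^bsub>M\<^esub> B) R M" "N <+>\<^bsub>M\<^esub> B \<subseteq> N' <+>\<^bsub>M\<^esub> B"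
    using subs step.hyps(3) by (auto intro: sub_Int sub_sum) (use sum_mono in blast)
  show ?case
  proof (cases "N' \<inter> B \<subseteq> sat R M S (N \<inter> B)")
    case False
    then have "lchain R M S A (N' \<inter> B) (Suc n1)" using c1 i by (auto intro: lchain.step)
    moreover have "lchain R M S B (N' <+>\<^bsub>M\<^esub> B) n2" using c2 s by (rule lchain_mono_right)
    ultimately show ?thesis using n by (intro exI[of _ "Suc n1"] exI[of _ n2]) auto
  next
    case True
    have "\<not> N' <+>\<^bsub>M\<^esub> B \<subseteq> sat R M S (N <+>\<^bsub>M\<^esub> B)"
    proof
      assume le: "N' <+>\<^bsub>M\<^esub> B \<subseteq> sat R M S (N <+>\<^bsub>M\<^esub> B)"
      have "N' \<subseteq> sat R M S N"
      proof
        fix x assume x: "x \<in> N'"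
        then have "x \<in> sat R M S (N <+>\<^bsub>M\<^esub> B)" using le sum_upper1[OF step.hyps(2) step.prems(1)] by auto
        then obtain s a b where s: "s \<in> S" "a \<in> N" "b \<in> B" "s \<odot>\<^bsub>M\<^esub> x = a \<oplus>\<^bsub>M\<^esub> b"
          by (auto simp: sat_def set_add_iff)
        have car: "x \<in> carrier M" "a \<in> carrier M" "b \<in> carrier M" using s x subs sub_car by auto
        \<comment> \<open>Since \<open>a + b = s x\<close> lies in \<open>N'\<close>, so does
          \<open>b\<close>; the trivial step on intersections then moves a multiple of
          \<open>b\<close> into \<open>N\<close>, and \<open>x\<close> follows.\<close>
        have "a \<oplus>\<^bsub>M\<^esub> b \<in> N'" using s(1,4) x subs by (metis sub_smult S_car)
        then have "b \<in> N'" using sub_cancel[OF step.hyps(2), of a b] s step.hyps(3) car by auto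
        then have "b \<in> sat R M S (N \<inter> B)" using True s by auto
        then obtain t where t: "t \<in> S" "t \<odot>\<^bsub>M\<^esub> b \<in> N" by (auto simp: sat_def)
        have "(t \<otimes> s) \<odot>\<^bsub>M\<^esub> x = t \<odot>\<^bsub>M\<^esub> a \<oplus>\<^bsub>M\<^esub> t \<odot>\<^bsub>M\<^esub> b"
          using s t car by (simp add: smult_assoc1 smult_r_distr)
        also have "\<dots> \<in> N" using t s N by (auto intro!: sub_add sub_smult)
        finally show "x \<in> sat R M S N" using t s car mult_S by (auto simp: sat_def)
      qed
      with step.hyps(4) show False by simp
    qed
    then have "lchain R M S B (N' <+>\<^bsub>M\<^esub> B) (Suc n2)" using c2 s by (auto intro: lchain.step)
    moreover have "lchain R M S A (N' \<inter> B) n1" using c1 i by (rule lchain_mono_right)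
    ultimately show ?thesis using n by (intro exI[of _ n1] exI[of _ "Suc n2"]) auto
  qed
qed

lemma len_add:
  assumes "submodule A R M" "submodule B R M" "submodule C R M" "A \<subseteq> B" "B \<subseteq> C"
  shows "len R M S A C = len R M S A B + len R M S B C"
proof (rule antisym)
  show "len R M S A C \<le> len R M S A B + len R M S B C"
  proof (rule len_leI)
    fix n assume "lchain R M S A C n"
    from lchain_split[OF this assms(2,4)] obtain n1 n2 where *: "n \<le> n1 + n2"
      "lchain R M S A (C \<inter> B) n1" "lchain R M S B (C <+>\<^bsub>M\<^esub> B) n2" by blast
    moreover have "C \<inter> B = B" using assms by auto
    moreover have "C <+>\<^bsub>M\<^esub> B = C" using assms sum_absorb sum_comm by metis
    ultimately have "enat n1 \<le> len R M S A B" "enat n2 \<le> len R M S B C" using lchain_le_len by metis+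
    then have "enat n1 + enat n2 \<le> len R M S A B + len R M S B C" by (rule add_mono)
    then show "enat n \<le> len R M S A B + len R M S B C" using *(1) by (metis enat_ord_simps(1) order_trans plus_enat_simps(1))
  qed
next
  show "len R M S A B + len R M S B C \<le> len R M S A C"
  proof (rule ccontr)
    assume "\<not> ?thesis"
    then have lt: "len R M S A C < len R M S A B + len R M S B C" by simp
    then obtain k where k: "len R M S A C = enat k" by (cases "len R M S A C") auto
    \<comment> \<open>Either summand may be infinite, so finite parts of both are selected whose
      total exceeds the supposed length \<open>k\<close> by exactly one.\<close>
    have "\<exists>n m. enat n \<le> len R M S A B \<and> enat m \<le> len R M S B C \<and> n + m = Suc k"
    proof (cases "len R M S A B")
      case (enat a)
      show ?thesis
      proof (cases "a \<le> Suc k")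
        case True
        then have "enat (Suc k - a) \<le> len R M S B C"
          using lt k enat by (cases "len R M S B C") auto
        with True enat show ?thesis by (intro exI[of _ a] exI[of _ "Suc k - a"]) auto
      next
        case False
        with enat show ?thesis by (intro exI[of _ "Suc k"] exI[of _ 0]) (auto simp: zero_enat_def[symmetric])
      qed
    next
      case infinity
      then show ?thesis by (intro exI[of _ "Suc k"] exI[of _ 0]) (auto simp: zero_enat_def[symmetric])
    qed
    then obtain n m where nm: "enat n \<le> len R M S A B" "enat m \<le> len R M S B C" "n + m = Suc k" by blast
    then have "lchain R M S A C (n + m)"
      using lchain_of_len assms by (blast intro: lchain_trans)
    then have "enat (n + m) \<le> enat k" using k lchain_le_len by metis
    with nm show False by simp
  qed
qed

lemma len_eq_0:
  assumes "submodule A R M" "B \<subseteq> sat R M S A"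
  shows "len R M S A B = 0"
proof -
  have "lchain R M S A B n \<Longrightarrow> n = 0" for n
  proof (erule lchain.cases, simp, goal_cases)
    case (1 A' B' n' C')
    then have "A \<subseteq> B'" using lchain_submoduleD by blast
    then have "sat R M S A \<subseteq> sat R M S B'" by (rule sat_mono)
    with 1 assms show ?case by auto
  qed
  then have "len R M S A B \<le> 0" by (intro len_leI) (auto simp: zero_enat_def)
  then show ?thesis by simp
qed

lemma len_pos:
  assumes "submodule A R M" "submodule B R M" "A \<subseteq> B" "\<not> B \<subseteq> sat R M S A"
  shows "1 \<le> len R M S A B"
  using lchain_le_len[OF lchain.step[OF lchain.base[OF assms(1,1)] assms(2-4)]]
  by (simp add: one_enat_def)

lemma len_mono:
  assumes "submodule A R M" "submodule B R M" "submodule A' R M" "submodule B' R M"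
    "A' \<subseteq> A" "A \<subseteq> B" "B \<subseteq> B'"
  shows "len R M S A B \<le> len R M S A' B'"
  by (rule len_mono_chains) (rule lchain_mono_right[OF lchain_mono_left[OF _ assms(3,5)] assms(4,7)])

end

section \<open>Linear maps and localised length\<close>

locale smod_hom = M: smod R M S + N: smod R N S for R (structure) and M (structure) and N (structure) and S +
  fixes f
  assumes lin: "f \<in> lin_maps R M N"
begin

lemma f_car [simp, intro]: "x \<in> carrier M \<Longrightarrow> f x \<in> carrier N"
  using lin unfolding lin_maps_def by (simp add: Pi_iff)
lemma f_add: "x \<in> carrier M \<Longrightarrow> y \<in> carrier M \<Longrightarrow> f (x \<oplus>\<^bsub>M\<^esub> y) = f x \<oplus>\<^bsub>N\<^esub> f y"
  using lin unfolding lin_maps_def by blast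
lemma f_smult: "r \<in> carrier R \<Longrightarrow> x \<in> carrier M \<Longrightarrow> f (r \<odot>\<^bsub>M\<^esub> x) = r \<odot>\<^bsub>N\<^esub> f x"
  using lin unfolding lin_maps_def by blast

lemma f_zero: "f \<zero>\<^bsub>M\<^esub> = \<zero>\<^bsub>N\<^esub>"
  using f_smult[of "\<zero>" "\<zero>\<^bsub>M\<^esub>"] by simp
lemma f_neg: "x \<in> carrier M \<Longrightarrow> f (\<ominus>\<^bsub>M\<^esub> x) = \<ominus>\<^bsub>N\<^esub> f x"
  using f_smult[of "\<ominus> \<one>" x] by (simp add: M.smult_l_minus N.smult_l_minus)
lemma f_minus: "x \<in> carrier M \<Longrightarrow> y \<in> carrier M \<Longrightarrow> f (x \<ominus>\<^bsub>M\<^esub> y) = f x \<ominus>\<^bsub>N\<^esub> f y"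
  by (simp add: a_minus_def f_add f_neg)

lemma image_submodule: assumes "submodule B R M" shows "submodule (f ` B) R N"
proof (rule N.submodI)
  show "f ` B \<subseteq> carrier N" using M.sub_car[OF assms] by auto
  show "\<zero>\<^bsub>N\<^esub> \<in> f ` B" using f_zero M.sub_zero[OF assms] by (metis imageI)
  fix x y assume "x \<in> f ` B" "y \<in> f ` B"
  then show "x \<oplus>\<^bsub>N\<^esub> y \<in> f ` B" using M.sub_car[OF assms] M.sub_add[OF assms]
    by (auto simp: f_add[symmetric])
next
  fix r x assume "r \<in> carrier R" "x \<in> f ` B"
  then show "r \<odot>\<^bsub>N\<^esub> x \<in> f ` B" using M.sub_car[OF assms] M.sub_smult[OF assms]
    by (auto simp: f_smult[symmetric])
qed

lemma preimage_submodule: assumes "submodule B R M" "submodule K R N"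
  shows "submodule {x \<in> B. f x \<in> K} R M"
  by (rule M.submodI)
     (use assms in \<open>auto simp: f_zero f_add f_smult M.sub_car intro: M.sub_zero N.sub_zero
       M.sub_add N.sub_add M.sub_smult N.sub_smult\<close>)

lemma lchain_pullback:
  assumes "submodule A R M" "submodule B R M" "A \<subseteq> B" "f ` A \<subseteq> K"
    and "lchain R N S K N' n" "N' \<subseteq> K <+>\<^bsub>N\<^esub> f ` B"
  shows "lchain R M S A {x \<in> B. f x \<in> N'} n"
  using assms(5,6,1-4)
proof (induction)
  case (base K N')
  then show ?case using preimage_submodule by (intro lchain.base) blast+
next
  case (step K N1 n N2)
  have N1: "submodule N1 R N" "K \<subseteq> N1" using step.hyps lchain_submoduleD by metis+
  have "lchain R M S A {x \<in> B. f x \<in> N1} n" using step by auto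
  then show ?case
  proof (rule lchain.step)
    show "submodule {x \<in> B. f x \<in> N2} R M" using preimage_submodule step by auto
    show "{x \<in> B. f x \<in> N1} \<subseteq> {x \<in> B. f x \<in> N2}" using step by auto
    show "\<not> {x \<in> B. f x \<in> N2} \<subseteq> sat R M S {x \<in> B. f x \<in> N1}"
    proof
      assume le: "{x \<in> B. f x \<in> N2} \<subseteq> sat R M S {x \<in> B. f x \<in> N1}"
      have "N2 \<subseteq> sat R N S N1"
      proof
        fix x assume x: "x \<in> N2"
        with step obtain k b where kb: "k \<in> K" "b \<in> B" "x = k \<oplus>\<^bsub>N\<^esub> f b"
          unfolding set_add_iff subset_iff by blast
        have car: "b \<in> carrier M" "k \<in> carrier N" using kb N1 step M.sub_car N.sub_car by auto
        have "f b \<in> N2" using N.sub_cancel[of N2 k "f b"] kb x N1 step car by auto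
        then have "b \<in> sat R M S {x \<in> B. f x \<in> N1}" using kb le by auto
        then obtain s where s: "s \<in> S" "f (s \<odot>\<^bsub>M\<^esub> b) \<in> N1" by (auto simp: sat_def)
        have "s \<odot>\<^bsub>N\<^esub> x = s \<odot>\<^bsub>N\<^esub> k \<oplus>\<^bsub>N\<^esub> f (s \<odot>\<^bsub>M\<^esub> b)"
          using kb s car by (simp add: N.smult_r_distr f_smult)
        also have "\<dots> \<in> N1" using kb s N1 by (auto intro!: N.sub_add N.sub_smult)
        finally show "x \<in> sat R N S N1" using s kb car by (auto simp: sat_def)
      qed
      with step.hyps show False by simp
    qed
  qed
qed

text \<open>\<open>f\<close> induces a surjection of \<open>B / A\<close> onto
  \<open>(K + f(B)) / K\<close>, along which chains pull back.\<close>

lemma len_image_le: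
  assumes "submodule A R M" "submodule B R M" "A \<subseteq> B" "f ` A \<subseteq> K"
  shows "len R N S K (K <+>\<^bsub>N\<^esub> f ` B) \<le> len R M S A B"
proof (rule len_mono_chains)
  fix n assume "lchain R N S K (K <+>\<^bsub>N\<^esub> f ` B) n"
  from lchain_pullback[OF assms this] have "lchain R M S A {x \<in> B. f x \<in> K <+>\<^bsub>N\<^esub> f ` B} n" by simp
  then show "lchain R M S A B n" by (rule lchain_mono_right) (use assms in auto)
qed

lemma lchain_pushforward:
  assumes "lchain R M S A N' n" "N' \<subseteq> B" "submodule B R M" "submodule K R N"
    "\<And>b. b \<in> B \<Longrightarrow> f b \<in> K \<Longrightarrow> b \<in> A"
  shows "lchain R N S K (K <+>\<^bsub>N\<^esub> f ` N') n"
  using assms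
proof (induction)
  case (base A N')
  then show ?case by (intro lchain.base N.sub_sum N.sum_upper1 image_submodule)
next
  case (step A N1 n N2)
  have N1: "submodule N1 R M" "A \<subseteq> N1" using step.hyps lchain_submoduleD by metis+
  have "lchain R N S K (K <+>\<^bsub>N\<^esub> f ` N1) n" using step by auto
  then show ?case
  proof (rule lchain.step)
    show "submodule (K <+>\<^bsub>N\<^esub> f ` N2) R N" using step by (intro N.sub_sum image_submodule)
    show "K <+>\<^bsub>N\<^esub> f ` N1 \<subseteq> K <+>\<^bsub>N\<^esub> f ` N2" using step by (intro N.sum_mono) auto
    show "\<not> K <+>\<^bsub>N\<^esub> f ` N2 \<subseteq> sat R N S (K <+>\<^bsub>N\<^esub> f ` N1)"
    proof
      assume le: "K <+>\<^bsub>N\<^esub> f ` N2 \<subseteq> sat R N S (K <+>\<^bsub>N\<^esub> f ` N1)"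
      have "N2 \<subseteq> sat R M S N1"
      proof
        fix x assume x: "x \<in> N2"
        then have "f x \<in> sat R N S (K <+>\<^bsub>N\<^esub> f ` N1)"
          using le N.sum_upper2[of K "f ` N2"] step image_submodule by blast
        then obtain s k b where s: "s \<in> S" "k \<in> K" "b \<in> N1" "s \<odot>\<^bsub>N\<^esub> f x = k \<oplus>\<^bsub>N\<^esub> f b"
          by (auto simp: sat_def set_add_iff)
        have car: "x \<in> carrier M" "b \<in> carrier M" "k \<in> carrier N"
          using s x N1 step M.sub_car N.sub_car by auto
        \<comment> \<open>The difference \<open>s x - b\<close> is mapped into \<open>K\<close>, so
          the kernel condition puts it into \<open>A\<close>: the relation found in the image
          already holds in \<open>M\<close>.\<close>
        have "f (s \<odot>\<^bsub>M\<^esub> x \<ominus>\<^bsub>M\<^esub> b) = k \<oplus>\<^bsub>N\<^esub> f b \<ominus>\<^bsub>N\<^esub> f b"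
          using s car by (simp add: f_minus f_smult)
        also have "\<dots> = k" using car by (simp add: a_minus_def N.a_assoc N.r_neg)
        finally have "f (s \<odot>\<^bsub>M\<^esub> x \<ominus>\<^bsub>M\<^esub> b) \<in> K" using s by simp
        moreover have "s \<odot>\<^bsub>M\<^esub> x \<ominus>\<^bsub>M\<^esub> b \<in> B" using s x step N1
          by (intro M.sub_minus M.sub_smult) auto
        ultimately have "s \<odot>\<^bsub>M\<^esub> x \<ominus>\<^bsub>M\<^esub> b \<in> N1" using step N1 by auto
        then have "s \<odot>\<^bsub>M\<^esub> x \<ominus>\<^bsub>M\<^esub> b \<oplus>\<^bsub>M\<^esub> b \<in> N1" using s N1 by (intro M.sub_add)
        then have "s \<odot>\<^bsub>M\<^esub> x \<in> N1" using s car by (simp add: a_minus_def M.a_assoc M.l_neg)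
        then show "x \<in> sat R M S N1" using s car by (auto simp: sat_def)
      qed
      with step.hyps show False by simp
    qed
  qed
qed

text \<open>The last hypothesis makes the surjection
  \<open>B / A \<rightarrow> (K + f(B)) / K\<close> injective. Every isomorphism between
  subquotients below is used in this form.\<close>

lemma len_image_eq:
  assumes "submodule A R M" "submodule B R M" "A \<subseteq> B" "f ` A \<subseteq> K" "submodule K R N"
    "\<And>b. b \<in> B \<Longrightarrow> f b \<in> K \<Longrightarrow> b \<in> A"
  shows "len R N S K (K <+>\<^bsub>N\<^esub> f ` B) = len R M S A B"
  by (rule antisym[OF len_image_le[OF assms(1-4)] len_mono_chains])
     (blast intro: lchain_pushforward assms(2,5,6))

end

section \<open>Prime filtrations\<close>

lemma self_module_simps [simp]:
  "carrier (self_module R) = carrier R" "ring.add (self_module R) = ring.add R"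
  "ring.zero (self_module R) = ring.zero R" "smult (self_module R) = monoid.mult R"
  by (simp_all add: self_module_def)

lemma set_add_self_module [simp]: "A <+>\<^bsub>self_module R\<^esub> B = A <+>\<^bsub>R\<^esub> B"
  by (auto simp: set_add_iff)

lemma abelian_groupI_same_add:
  assumes "abelian_group G" "carrier H = carrier G" "ring.add H = ring.add G" "ring.zero H = ring.zero G"
  shows "abelian_group H"
proof -
  interpret G: abelian_group G by fact
  show ?thesis
    by (rule abelian_groupI)
       (use assms(2-4) in \<open>auto simp: G.a_ac intro: G.l_neg G.a_inv_closed bexI[of _ "\<ominus>\<^bsub>G\<^esub> _"]\<close>)
qed

lemma (in cring) module_self_module: "module R (self_module R)"
proof (rule moduleI)
  show "abelian_group (self_module R)"
    by (rule abelian_groupI_same_add[OF is_abelian_group]) auto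
qed (auto simp: l_distr r_distr m_assoc is_cring)

definition colon ::
    "('a, 'r) ring_scheme \<Rightarrow> ('a, 'm, 'k) module_scheme \<Rightarrow> 'm set \<Rightarrow> 'm \<Rightarrow> 'a set" where
  "colon R M N y = {r \<in> carrier R. r \<odot>\<^bsub>M\<^esub> y \<in> N}"

definition cyclic ::
    "('a, 'r) ring_scheme \<Rightarrow> ('a, 'm, 'k) module_scheme \<Rightarrow> 'm \<Rightarrow> 'm set" where
  "cyclic R M y = (\<lambda>r. r \<odot>\<^bsub>M\<^esub> y) ` carrier R"

text \<open>The list records the primes \<open>Q\<close> of the factors \<open>R/Q\<close>, last step first.\<close>

inductive pfilt ::
    "('a, 'r) ring_scheme \<Rightarrow> ('a, 'm, 'k) module_scheme \<Rightarrow> 'm set \<Rightarrow> 'm set \<Rightarrow> 'a set list \<Rightarrow> bool"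
  for R M where
  Nil: "submodule A R M \<Longrightarrow> pfilt R M A A []"
| Cons: "pfilt R M A B Qs \<Longrightarrow> y \<in> carrier M \<Longrightarrow> primeideal (colon R M B y) R \<Longrightarrow>
    pfilt R M A (B <+>\<^bsub>M\<^esub> cyclic R M y) (colon R M B y # Qs)"

lemma pfilt_trans:
  "pfilt R M B C Qs' \<Longrightarrow> pfilt R M A B Qs \<Longrightarrow> pfilt R M A C (Qs' @ Qs)"
proof (induction rule: pfilt.induct)
  case (Cons A' B' Qs'' y)
  then show ?case using pfilt.Cons[of R M A B' "Qs'' @ Qs" y] by simp
qed auto

text \<open>Larger ideals come first in this relation. It therefore serves both for Noetherian
  induction and, through its minimal elements, for choosing maximal members of a family of
  ideals.\<close>

lemma ideal_wf:
  assumes "noetherian_ring R"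
  shows "wf {(I, J). ideal I R \<and> ideal J R \<and> J \<subset> I}"
proof (unfold wf_iff_no_infinite_down_chain, rule notI)
  interpret noetherian_ring R by fact
  assume "\<exists>f. \<forall>i. (f (Suc i), f i) \<in> {(I, J). ideal I R \<and> ideal J R \<and> J \<subset> I}"
  then obtain f where f': "\<forall>i. (f (Suc i), f i) \<in> {(I, J). ideal I R \<and> ideal J R \<and> J \<subset> I}"
    by (elim exE)
  have f: "ideal (f i) R" "f i \<subset> f (Suc i)" for i using spec[OF f', of i] by auto
  have mono: "i \<le> j \<Longrightarrow> f i \<subseteq> f j" for i j
    by (rule lift_Suc_mono_le[of f]) (use f(2) in auto)
  have "subset.chain {I. ideal I R} (range f)"
    unfolding subset_chain_def
  proof (intro conjI ballI)
    show "range f \<subseteq> {I. ideal I R}" using f(1) by auto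
    fix x y assume "x \<in> range f" "y \<in> range f"
    then obtain i j where "x = f i" "y = f j" by auto
    then show "x \<subseteq> y \<or> y \<subseteq> x" using mono[of i j] mono[of j i] nle_le by metis
  qed
  then have "\<Union> (range f) \<in> range f" by (intro ideal_chain_is_trivial) auto
  then obtain n where "\<Union> (range f) = f n" by auto
  then have "f (Suc n) \<subseteq> f n" by auto
  with f(2)[of n] show False by auto
qed

context smod
begin

lemma smod_self: "smod R (self_module R) S"
  using module_self_module by (simp add: smod_def smod_axioms_def S_sub one_S mult_S)

lemma ideal_iff_submodule: "submodule I R (self_module R) \<longleftrightarrow> ideal I R"
proof
  interpret self: smod R "self_module R" S by (rule smod_self)
  assume I: "submodule I R (self_module R)"
  have "a_inv (self_module R) = a_inv R" by (auto simp: a_inv_def m_inv_def fun_eq_iff)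
  moreover have r: "x \<in> I \<Longrightarrow> r \<in> carrier R \<Longrightarrow> x \<otimes> r \<in> I" for x r
    using self.sub_smult[OF I, of r x] self.sub_car[OF I, of x] by (simp add: R.m_comm)
  ultimately show "ideal I R"
    using I self.sub_car[OF I] self.sub_zero[OF I] self.sub_add[OF I] self.sub_neg[OF I] self.sub_smult[OF I]
    by (intro idealI R.ring_axioms R.add.subgroupI) (auto simp: a_inv_def[symmetric] intro: r)
next
  interpret self: smod R "self_module R" S by (rule smod_self)
  assume "ideal I R"
  then interpret I: ideal I R .
  show "submodule I R (self_module R)"
    by (rule self.submodI) (auto simp: I.I_l_closed)
qed

lemma sum_right_comm:
  assumes "submodule A R M" "submodule B R M" "submodule C R M"
  shows "(A <+>\<^bsub>M\<^esub> B) <+>\<^bsub>M\<^esub> C = (A <+>\<^bsub>M\<^esub> C) <+>\<^bsub>M\<^esub> B"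
proof -
  have le: "(A <+>\<^bsub>M\<^esub> B) <+>\<^bsub>M\<^esub> C \<subseteq> (A <+>\<^bsub>M\<^esub> C) <+>\<^bsub>M\<^esub> B"
    if *: "submodule A R M" "submodule B R M" "submodule C R M" for A B C
  proof -
    have AC: "submodule (A <+>\<^bsub>M\<^esub> C) R M" using * by (intro sub_sum)
    note up = sum_upper1[OF AC *(2)] sum_upper2[OF AC *(2)] sum_upper1[OF *(1,3)] sum_upper2[OF *(1,3)]
    have "submodule ((A <+>\<^bsub>M\<^esub> C) <+>\<^bsub>M\<^esub> B) R M" using AC * by (intro sub_sum)
    then show ?thesis using up by (intro sum_least) auto
  qed
  show ?thesis using le[OF assms] le[OF assms(1,3,2)] by simp
qed

lemma mult_lin: "y \<in> carrier M \<Longrightarrow> (\<lambda>r. r \<odot>\<^bsub>M\<^esub> y) \<in> lin_maps R (self_module R) M"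
  by (auto simp: lin_maps_def smult_l_distr smult_assoc1)

lemma smod_hom_mult: "y \<in> carrier M \<Longrightarrow> smod_hom R (self_module R) M S (\<lambda>r. r \<odot>\<^bsub>M\<^esub> y)"
  by (simp add: smod_hom_def smod_hom_axioms_def smod_self mult_lin smod_axioms)

lemma colon_ideal: "submodule B R M \<Longrightarrow> y \<in> carrier M \<Longrightarrow> ideal (colon R M B y) R"
proof -
  assume *: "submodule B R M" "y \<in> carrier M"
  interpret smod_hom R "self_module R" M S "\<lambda>r. r \<odot>\<^bsub>M\<^esub> y" by (rule smod_hom_mult) fact
  show ?thesis
    using preimage_submodule[OF M.carrier_is_submodule *(1)]
    by (simp add: ideal_iff_submodule colon_def)
qed

lemma cyclic_submodule: "y \<in> carrier M \<Longrightarrow> submodule (cyclic R M y) R M"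
proof -
  assume *: "y \<in> carrier M"
  interpret smod_hom R "self_module R" M S "\<lambda>r. r \<odot>\<^bsub>M\<^esub> y" by (rule smod_hom_mult) fact
  show ?thesis using image_submodule[OF M.carrier_is_submodule] by (simp add: cyclic_def)
qed

lemma cyclic_self: "y \<in> carrier M \<Longrightarrow> y \<in> cyclic R M y"
  unfolding cyclic_def by (rule image_eqI[of _ _ \<one>]) auto

lemma cyclic_least: "submodule B R M \<Longrightarrow> y \<in> B \<Longrightarrow> cyclic R M y \<subseteq> B"
  by (auto simp: cyclic_def intro: sub_smult)

lemma adjoin_submodule:
  "submodule B R M \<Longrightarrow> y \<in> carrier M \<Longrightarrow> submodule (B <+>\<^bsub>M\<^esub> cyclic R M y) R M"
  by (intro sub_sum cyclic_submodule)

lemma mem_adjoin: "x \<in> B <+>\<^bsub>M\<^esub> cyclic R M y \<longleftrightarrow> (\<exists>b\<in>B. \<exists>r\<in>carrier R. x = b \<oplus>\<^bsub>M\<^esub> r \<odot>\<^bsub>M\<^esub> y)"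
  unfolding set_add_iff cyclic_def by blast

lemma pfilt_submodule:
  assumes "pfilt R M A B Qs" shows "submodule A R M" "submodule B R M" "A \<subseteq> B"
  using assms
proof (induction)
  case (Cons A B Qs y)
  { case 2 show ?case using Cons by (intro adjoin_submodule) }
  { case 3 show ?case
      using Cons sum_upper1[of B "cyclic R M y"] cyclic_submodule by blast }
qed auto

lemma pfilt_prime: "pfilt R M A B Qs \<Longrightarrow> Q \<in> set Qs \<Longrightarrow> primeideal Q R"
  by (induction rule: pfilt.induct) auto

text \<open>Each prime of the list is the annihilator of an element of some \<open>M / B\<close>
  with \<open>A \<subseteq> B\<close>, while \<open>I\<close> annihilates all of
  \<open>M / A\<close>.\<close>

lemma pfilt_contains:
  assumes "pfilt R M A B Qs" "Q \<in> set Qs" "I \<subseteq> carrier R"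
    and "\<And>a x. a \<in> I \<Longrightarrow> x \<in> carrier M \<Longrightarrow> a \<odot>\<^bsub>M\<^esub> x \<in> A"
  shows "I \<subseteq> Q"
  using assms
proof (induction)
  case (Cons A B Qs y)
  then show ?case using pfilt_submodule(3)[OF Cons.hyps(1)] unfolding colon_def by auto
qed auto

text \<open>The map \<open>r \<mapsto> r y\<close> identifies \<open>R / (B : y)\<close> with
  \<open>(B + R y) / B\<close>.\<close>

lemma len_adjoin:
  assumes "submodule B R M" "y \<in> carrier M"
  shows "len R M S B (B <+>\<^bsub>M\<^esub> cyclic R M y) = len R (self_module R) S (colon R M B y) (carrier R)"
proof -
  interpret f: smod_hom R "self_module R" M S "\<lambda>r. r \<odot>\<^bsub>M\<^esub> y" by (rule smod_hom_mult) fact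
  show ?thesis unfolding cyclic_def
    by (rule f.len_image_eq)
       (use assms f.M.carrier_is_submodule in \<open>auto simp: ideal_iff_submodule colon_ideal, auto simp: colon_def\<close>)
qed

lemma pfilt_len:
  assumes "pfilt R M A B Qs"
  shows "len R M S A B = (\<Sum>Q\<leftarrow>Qs. len R (self_module R) S Q (carrier R))"
  using assms
proof (induction)
  case (Nil A)
  then show ?case using len_eq_0[OF Nil sat_increasing[OF Nil]] by simp
next
  case (Cons A B Qs y)
  note sub = pfilt_submodule[OF Cons.hyps(1)]
  have "len R M S A (B <+>\<^bsub>M\<^esub> cyclic R M y) = len R M S A B + len R M S B (B <+>\<^bsub>M\<^esub> cyclic R M y)"
    using sub Cons.hyps(2) by (intro len_add adjoin_submodule sum_upper1 cyclic_submodule)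
  then show ?case using Cons sub by (simp add: len_adjoin add.commute)
qed

text \<open>Reduction modulo \<open>K\<close> is only right exact: a factor \<open>R/Q\<close> of
  the filtration turns into a quotient of \<open>R / (Q + \<qq>)\<close>, whence an inequality. The
  typical case is \<open>K = \<qq> M\<close>, where it bounds the length of
  \<open>M / \<qq> M\<close> by data of the primes in the list.\<close>

lemma pfilt_len_sum_le:
  assumes "pfilt R M A B Qs" "submodule K R M" "ideal \<qq> R"
    and "\<And>a x. a \<in> \<qq> \<Longrightarrow> x \<in> carrier M \<Longrightarrow> a \<odot>\<^bsub>M\<^esub> x \<in> K"
  shows "len R M S (A <+>\<^bsub>M\<^esub> K) (B <+>\<^bsub>M\<^esub> K)
    \<le> (\<Sum>Q\<leftarrow>Qs. len R (self_module R) S (Q <+>\<^bsub>R\<^esub> \<qq>) (carrier R))"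
  using assms
proof (induction)
  case (Nil A)
  then show ?case using len_eq_0[OF _ sat_increasing] sub_sum by simp
next
  case (Cons A B Qs y)
  note sub = pfilt_submodule[OF Cons.hyps(1)]
  interpret f: smod_hom R "self_module R" M S "\<lambda>r. r \<odot>\<^bsub>M\<^esub> y" by (rule smod_hom_mult) fact
  let ?C = "B <+>\<^bsub>M\<^esub> cyclic R M y" and ?Q = "colon R M B y"
  have C: "submodule ?C R M" using sub Cons.hyps(2) by (intro adjoin_submodule)
  have BC: "B \<subseteq> ?C" using sub Cons.hyps(2) by (intro sum_upper1 cyclic_submodule)
  have Q: "ideal ?Q R" using sub Cons.hyps(2) by (intro colon_ideal)
  have Qq: "submodule (?Q <+>\<^bsub>R\<^esub> \<qq>) R (self_module R)"
    using f.M.sub_sum[of ?Q \<qq>] Q Cons.prems by (simp add: ideal_iff_submodule)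
  have sum: "(B <+>\<^bsub>M\<^esub> K) <+>\<^bsub>M\<^esub> (\<lambda>r. r \<odot>\<^bsub>M\<^esub> y) ` carrier R = ?C <+>\<^bsub>M\<^esub> K"
    using sum_right_comm[OF sub(2) Cons.prems(1) cyclic_submodule[OF Cons.hyps(2)]]
    by (simp add: cyclic_def)
  have "len R M S (B <+>\<^bsub>M\<^esub> K) ((B <+>\<^bsub>M\<^esub> K) <+>\<^bsub>M\<^esub> (\<lambda>r. r \<odot>\<^bsub>M\<^esub> y) ` carrier R)
      \<le> len R (self_module R) S (?Q <+>\<^bsub>R\<^esub> \<qq>) (carrier R)"
  proof (rule f.len_image_le[OF Qq])
    show "submodule (carrier R) R (self_module R)" using f.M.carrier_is_submodule by simp
    show "?Q <+>\<^bsub>R\<^esub> \<qq> \<subseteq> carrier R" using Qq f.M.sub_car by auto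
    show "(\<lambda>r. r \<odot>\<^bsub>M\<^esub> y) ` (?Q <+>\<^bsub>R\<^esub> \<qq>) \<subseteq> B <+>\<^bsub>M\<^esub> K"
    proof clarify
      fix r assume "r \<in> ?Q <+>\<^bsub>R\<^esub> \<qq>"
      then obtain a b where ab: "a \<in> ?Q" "b \<in> \<qq>" "r = a \<oplus> b" unfolding set_add_iff by blast
      moreover have "a \<in> carrier R" "b \<in> carrier R"
        using ab ideal.Icarr[OF Q] ideal.Icarr[OF Cons.prems(2)] by auto
      ultimately have "r \<odot>\<^bsub>M\<^esub> y = a \<odot>\<^bsub>M\<^esub> y \<oplus>\<^bsub>M\<^esub> b \<odot>\<^bsub>M\<^esub> y" using Cons.hyps by (simp add: smult_l_distr)
      moreover have "a \<odot>\<^bsub>M\<^esub> y \<in> B" "b \<odot>\<^bsub>M\<^esub> y \<in> K" using ab Cons by (auto simp: colon_def)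
      ultimately show "r \<odot>\<^bsub>M\<^esub> y \<in> B <+>\<^bsub>M\<^esub> K" unfolding set_add_iff by blast
    qed
  qed
  note add_mono[OF Cons.IH[OF Cons.prems] this]
  moreover have "len R M S (A <+>\<^bsub>M\<^esub> K) (?C <+>\<^bsub>M\<^esub> K)
      = len R M S (A <+>\<^bsub>M\<^esub> K) (B <+>\<^bsub>M\<^esub> K) + len R M S (B <+>\<^bsub>M\<^esub> K) (?C <+>\<^bsub>M\<^esub> K)"
    using len_add[OF sub_sum sub_sum sub_sum sum_mono sum_mono, OF sub(1) Cons.prems(1) sub(2)
        Cons.prems(1) C Cons.prems(1) sub(3) subset_refl BC subset_refl] .
  ultimately show ?case unfolding sum list.map sum_list.Cons by (metis add.commute)
qed

lemma len_ideal_meets_S: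
  assumes "ideal I R" "I \<inter> S \<noteq> {}"
  shows "len R (self_module R) S I (carrier R) = 0"
proof -
  interpret self: smod R "self_module R" S by (rule smod_self)
  obtain s where s: "s \<in> I" "s \<in> S" using assms by auto
  have "carrier R \<subseteq> sat R (self_module R) S I"
    using s ideal.I_r_closed[OF assms(1)] by (auto simp: sat_def)
  then show ?thesis using assms by (intro self.len_eq_0) (auto simp: ideal_iff_submodule)
qed

lemma sat_prime:
  assumes "primeideal P R" "P \<inter> S = {}" "y \<in> carrier R" "s \<in> S" "s \<otimes> y \<in> P"
  shows "y \<in> P"
  using primeideal.I_prime[OF assms(1), of s y] assms by auto

text \<open>This is the simplicity of \<open>k(P)\<close>: an ideal that is not inside
  \<open>P\<close> meets \<open>S\<close>, so its saturation is everything, and no second proper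
  step is left.\<close>

lemma len_prime:
  assumes P: "primeideal P R" and S: "S = carrier R - P"
  shows "len R (self_module R) S P (carrier R) = 1"
proof (rule antisym)
  interpret self: smod R "self_module R" S by (rule smod_self)
  interpret P: primeideal P R by fact
  have P': "submodule P R (self_module R)" by (simp add: ideal_iff_submodule P.is_ideal)
  have "\<one> \<notin> sat R (self_module R) S P" using S by (auto simp: sat_def)
  then have "\<not> carrier R \<subseteq> sat R (self_module R) S P" by auto
  then show "1 \<le> len R (self_module R) S P (carrier R)"
    using self.carrier_is_submodule P.a_subset P' by (intro self.len_pos) auto
  have big: "C \<subseteq> sat R (self_module R) S B"
    if cb: "submodule C R (self_module R)" "submodule B R (self_module R)" "\<not> B \<subseteq> P" for B C
  proof
    fix x assume "x \<in> C"
    then have x: "x \<in> carrier R" using self.sub_car[OF cb(1)] by auto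
    obtain s where "s \<in> B" "s \<in> S" using cb(3) self.sub_car[OF cb(2)] S by auto
    then show "x \<in> sat R (self_module R) S B"
      using x self.sub_smult[OF cb(2), of x s] by (auto simp: sat_def R.m_comm intro!: bexI[of _ s])
  qed
  show "len R (self_module R) S P (carrier R) \<le> 1"
  proof (rule len_leI)
    fix n assume "lchain R (self_module R) S P (carrier R) n"
    then show "enat n \<le> 1"
    proof cases
      case base then show ?thesis by (simp add: one_enat_def)
    next
      case (step B m)
      have "B \<subseteq> P" using big[of "carrier R" B] step lchain_submoduleD[OF step(2)] by blast
      from step(2) have "m = 0"
      proof cases
        case (step B' k)
        have "submodule B' R (self_module R)" "P \<subseteq> B'" using lchain_submoduleD[OF step(2)] by auto
        then have "P \<subseteq> sat R (self_module R) S B'" using self.sat_increasing by blast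
        with \<open>B \<subseteq> P\<close> step show ?thesis by auto
      qed
      with step show ?thesis by (simp add: one_enat_def)
    qed
  qed
qed

text \<open>Localising at \<open>P\<close> kills the factors \<open>R/Q\<close> with
  \<open>Q\<close> not inside \<open>P\<close> and turns \<open>R/P\<close> into the residue field.
  The last hypothesis excludes all other factors, so the length is finite and is a multiplicity in
  the list.\<close>

lemma pfilt_len_count:
  assumes "pfilt R M A B Qs" and P: "primeideal P R" and S: "S = carrier R - P"
    and "\<And>Q. Q \<in> set Qs \<Longrightarrow> Q \<subseteq> P \<Longrightarrow> Q = P"
  shows "len R M S A B = enat (count_list Qs P)"
proof -
  have "(\<Sum>Q\<leftarrow>Qs. len R (self_module R) S Q (carrier R)) = enat (count_list Qs P)"
    if "\<And>Q. Q \<in> set Qs \<Longrightarrow> primeideal Q R" using that assms(4)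
  proof (induction Qs)
    case (Cons Q Qs)
    have "len R (self_module R) S Q (carrier R) = (if Q = P then 1 else 0)"
    proof (cases "Q = P")
      case True then show ?thesis using len_prime[OF P S] by simp
    next
      case False
      then have "\<not> Q \<subseteq> P" using Cons by auto
      then have "Q \<inter> S \<noteq> {}" using S ideal.Icarr[OF primeideal.axioms(1), of Q R] Cons by auto
      then show ?thesis using False len_ideal_meets_S[of Q] Cons by (auto intro: primeideal.axioms)
    qed
    then show ?case using Cons by (auto simp: one_enat_def zero_enat_def)
  qed (simp add: zero_enat_def)
  then show ?thesis using pfilt_len[OF assms(1)] pfilt_prime[OF assms(1)] by simp
qed

text \<open>The associated prime argument inside the cyclic module \<open>(N + R y) / N\<close>: a
  maximal colon ideal of a multiple \<open>z y\<close> outside \<open>N\<close> is prime. Adjoining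
  \<open>z y\<close> enlarges \<open>(N : y)\<close> by \<open>z\<close>, so Noetherian induction on
  this colon ideal finishes.\<close>

lemma pfilt_adjoin_exists:
  assumes "noetherian_ring R" "submodule N R M" "y \<in> carrier M"
  shows "\<exists>Qs. pfilt R M N (N <+>\<^bsub>M\<^esub> cyclic R M y) Qs"
  using assms(2)
proof (induction "colon R M N y" arbitrary: N rule: wf_induct_rule[OF ideal_wf[OF assms(1)]])
  case (1 N)
  show ?case
  proof (cases "y \<in> N")
    case True
    then have "N <+>\<^bsub>M\<^esub> cyclic R M y = N"
      using 1 assms(3) sum_comm sum_absorb cyclic_least cyclic_submodule by metis
    with 1 show ?thesis using pfilt.Nil by metis
  next
    case False
    define G where "G = {colon R M N (z \<odot>\<^bsub>M\<^esub> y) |z. z \<in> carrier R \<and> z \<odot>\<^bsub>M\<^esub> y \<notin> N}"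
    have "colon R M N (\<one> \<odot>\<^bsub>M\<^esub> y) \<in> G" using False assms(3) unfolding G_def by force
    then obtain Q where Q: "Q \<in> G"
      and max: "\<And>J. (J, Q) \<in> {(I, J). ideal I R \<and> ideal J R \<and> J \<subset> I} \<Longrightarrow> J \<notin> G"
      by (erule wfE_min[OF ideal_wf[OF assms(1)]])
    from Q obtain z where z: "z \<in> carrier R" "z \<odot>\<^bsub>M\<^esub> y \<notin> N" and Qz: "Q = colon R M N (z \<odot>\<^bsub>M\<^esub> y)"
      by (auto simp: G_def)
    let ?y = "z \<odot>\<^bsub>M\<^esub> y"
    have y: "?y \<in> carrier M" using z assms(3) by simp
    have Qi: "ideal Q R" unfolding Qz using 1 y by (intro colon_ideal)
    have prime: "primeideal Q R"
    proof (rule primeidealI[OF Qi R.is_cring])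
      show "carrier R \<noteq> Q"
      proof
        assume "carrier R = Q"
        then have "\<one> \<in> Q" by auto
        then show False using z y by (simp add: Qz colon_def)
      qed
      fix a b assume ab: "a \<in> carrier R" "b \<in> carrier R" "a \<otimes> b \<in> Q"
      show "a \<in> Q \<or> b \<in> Q"
      proof (rule disjCI)
        assume "b \<notin> Q"
        then have b: "(b \<otimes> z) \<odot>\<^bsub>M\<^esub> y \<notin> N" "b \<otimes> z \<in> carrier R"
          using ab z assms(3) by (auto simp: Qz colon_def smult_assoc1)
        \<comment> \<open>Since \<open>b z y\<close> is still outside \<open>N\<close>, its colon
          ideal competes with \<open>Q\<close> for maximality; it contains \<open>Q\<close> and
          \<open>a\<close>.\<close>
        let ?J = "colon R M N ((b \<otimes> z) \<odot>\<^bsub>M\<^esub> y)"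
        have J: "ideal ?J R" using 1 b assms(3) by (intro colon_ideal) auto
        have "?J \<in> G" using b by (auto simp: G_def)
        then have "\<not> Q \<subset> ?J" using max[of ?J] J Qi by auto
        moreover have "Q \<subseteq> ?J"
        proof
          fix r assume "r \<in> Q"
          then have r: "r \<in> carrier R" "r \<odot>\<^bsub>M\<^esub> ?y \<in> N" by (auto simp: Qz colon_def)
          have "r \<odot>\<^bsub>M\<^esub> ((b \<otimes> z) \<odot>\<^bsub>M\<^esub> y) = b \<odot>\<^bsub>M\<^esub> (r \<odot>\<^bsub>M\<^esub> ?y)"
            using r ab z assms(3) by (simp add: smult_assoc1[symmetric] R.m_ac)
          also have "\<dots> \<in> N" using r ab 1 by (auto intro: sub_smult)
          finally show "r \<in> ?J" using r by (simp add: colon_def)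
        qed
        moreover have "a \<in> ?J" using ab z assms(3) by (simp add: Qz colon_def smult_assoc1)
        ultimately show "a \<in> Q" by auto
      qed
    qed
    let ?N = "N <+>\<^bsub>M\<^esub> cyclic R M ?y"
    have N: "submodule ?N R M" using 1 y by (intro adjoin_submodule)
    have NN: "N \<subseteq> ?N" "?y \<in> ?N"
      using sum_upper1[of N "cyclic R M ?y"] sum_upper2[of N "cyclic R M ?y"] cyclic_self[OF y]
        1 cyclic_submodule[OF y] by auto
    have step: "pfilt R M N ?N [Q]"
      unfolding Qz using pfilt.Cons[OF pfilt.Nil y] prime 1 Qz by auto
    have "z \<in> colon R M ?N y" "z \<notin> colon R M N y" using z NN by (auto simp: colon_def)
    moreover have "colon R M N y \<subseteq> colon R M ?N y" using NN by (auto simp: colon_def)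
    ultimately have "(colon R M ?N y, colon R M N y) \<in> {(I, J). ideal I R \<and> ideal J R \<and> J \<subset> I}"
      using colon_ideal 1 N assms(3) by blast
    then obtain Qs where Qs: "pfilt R M ?N (?N <+>\<^bsub>M\<^esub> cyclic R M y) Qs" using 1 N by blast
    have "?y \<in> cyclic R M y" using z by (auto simp: cyclic_def)
    then have "cyclic R M ?y \<subseteq> cyclic R M y" using cyclic_submodule assms(3) by (intro cyclic_least) auto
    then have "?N \<subseteq> N <+>\<^bsub>M\<^esub> cyclic R M y" by (intro sum_mono) auto
    moreover have "submodule (N <+>\<^bsub>M\<^esub> cyclic R M y) R M" using 1 assms(3) by (intro adjoin_submodule)
    moreover have "cyclic R M y \<subseteq> N <+>\<^bsub>M\<^esub> cyclic R M y" using 1 assms(3) by (intro sum_upper2 cyclic_submodule)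
    ultimately have "?N <+>\<^bsub>M\<^esub> cyclic R M y \<subseteq> N <+>\<^bsub>M\<^esub> cyclic R M y"
      using sum_least by blast
    moreover have "N <+>\<^bsub>M\<^esub> cyclic R M y \<subseteq> ?N <+>\<^bsub>M\<^esub> cyclic R M y" using NN by (intro sum_mono) auto
    ultimately have "pfilt R M ?N (N <+>\<^bsub>M\<^esub> cyclic R M y) Qs" using Qs by simp
    then show ?thesis using pfilt_trans[OF _ step] by blast
  qed
qed

text \<open>That \<open>N\<close> and \<open>G\<close> generate \<open>B\<close> is stated by
  minimality, because the two uses come with different notions of span:
  \<open>submodule_span\<close> for modules and \<open>Idl\<close> for ideals.\<close>

lemma pfilt_exists:
  assumes "noetherian_ring R" "submodule N R M" "submodule B R M" "N \<subseteq> B"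
    and "finite G" "G \<subseteq> B" "\<And>C. submodule C R M \<Longrightarrow> N \<subseteq> C \<Longrightarrow> G \<subseteq> C \<Longrightarrow> B \<subseteq> C"
  shows "\<exists>Qs. pfilt R M N B Qs"
proof -
  have "\<exists>Qs C. pfilt R M N C Qs \<and> G \<subseteq> C \<and> C \<subseteq> B"
    using assms(5,6)
  proof (induction G)
    case empty
    then show ?case using pfilt.Nil[OF assms(2)] assms(4) by blast
  next
    case (insert y G)
    then obtain Qs C where C: "pfilt R M N C Qs" "G \<subseteq> C" "C \<subseteq> B" by blast
    note sub = pfilt_submodule[OF C(1)]
    have y: "y \<in> carrier M" using insert.prems sub_car[OF assms(3)] by auto
    obtain Qs' where "pfilt R M C (C <+>\<^bsub>M\<^esub> cyclic R M y) Qs'"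
      using pfilt_adjoin_exists[OF assms(1) sub(2) y] by blast
    then have "pfilt R M N (C <+>\<^bsub>M\<^esub> cyclic R M y) (Qs' @ Qs)" using C pfilt_trans by blast
    moreover have "insert y G \<subseteq> C <+>\<^bsub>M\<^esub> cyclic R M y"
      using C(2) sum_upper1[OF sub(2) cyclic_submodule[OF y]] sum_upper2[OF sub(2) cyclic_submodule[OF y]]
        cyclic_self[OF y] by auto
    moreover have "C <+>\<^bsub>M\<^esub> cyclic R M y \<subseteq> B"
      using C insert.prems assms(3) by (intro sum_least cyclic_least) auto
    ultimately show ?case by blast
  qed
  then obtain Qs C where C: "pfilt R M N C Qs" "G \<subseteq> C" "C \<subseteq> B" by blast
  with assms(7)[of C] pfilt_submodule[OF C(1)] show ?thesis by auto
qed

lemma pfilt_fin_gen_exists: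
  assumes "noetherian_ring R" "fin_gen_module R M" "submodule N R M"
  shows "\<exists>Qs. pfilt R M N (carrier M) Qs"
proof -
  obtain G where G: "finite G" "G \<subseteq> carrier M" "submodule_span R M G = carrier M"
    using assms(2) by (auto simp: fin_gen_module_def)
  show ?thesis
  proof (rule pfilt_exists[OF assms(1,3) carrier_is_submodule _ G(1,2)])
    show "N \<subseteq> carrier M" using sub_car[OF assms(3)] by auto
    fix C assume "submodule C R M" "G \<subseteq> C"
    then show "carrier M \<subseteq> C" unfolding G(3)[symmetric] submodule_span_def by blast
  qed
qed

lemma pfilt_ideal_exists:
  assumes "noetherian_ring R" "ideal I R" "ideal J R" "I \<subseteq> J"
  shows "\<exists>Qs. pfilt R (self_module R) I J Qs"
proof -
  interpret self: smod R "self_module R" S by (rule smod_self)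
  obtain G where G: "finite G" "G \<subseteq> carrier R" "J = Idl G"
    using noetherian_ring.finetely_gen[OF assms(1,3)] by auto
  show ?thesis
  proof (rule self.pfilt_exists[OF assms(1) _ _ assms(4) G(1)])
    show "G \<subseteq> J" using G R.genideal_self by simp
    fix C assume "submodule C R (self_module R)" "G \<subseteq> C"
    then show "J \<subseteq> C" using G R.genideal_minimal by (simp add: ideal_iff_submodule)
  qed (use assms in \<open>simp_all add: ideal_iff_submodule\<close>)
qed


end

section \<open>Multiplicities in dimension one\<close>

text \<open>Either \<open>I\<close> is not contained in \<open>P\<close>, or \<open>P\<close> is
  minimal over \<open>I\<close>. Over a Noetherian ring these are the ideals for which
  \<open>R/I\<close> localised at \<open>P\<close> has finite length.\<close>

definition isolated_at :: "('a, 'r) ring_scheme \<Rightarrow> 'a set \<Rightarrow> 'a set \<Rightarrow> bool" where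
  "isolated_at R P I \<longleftrightarrow> (\<forall>Q. primeideal Q R \<longrightarrow> I \<subseteq> Q \<longrightarrow> Q \<subseteq> P \<longrightarrow> Q = P)"

context smod
begin

lemma smod_hom_scale: "x \<in> carrier R \<Longrightarrow> smod_hom R M M S (\<lambda>m. x \<odot>\<^bsub>M\<^esub> m)"
  by (simp add: smod_hom_def smod_hom_axioms_def smod_axioms lin_maps_def smult_r_distr
      smult_assoc1[symmetric] R.m_comm)

lemma smod_hom_id: "smod_hom R M M S (\<lambda>m. m)"
  by (simp add: smod_hom_def smod_hom_axioms_def smod_axioms lin_maps_def)

lemma pfilt_isolated:
  assumes "pfilt R (self_module R) I J Qs" "ideal I R" "isolated_at R P I"
    and "Q \<in> set Qs" "Q \<subseteq> P"
  shows "Q = P"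
proof -
  interpret self: smod R "self_module R" S by (rule smod_self)
  have "I \<subseteq> Q"
    by (rule self.pfilt_contains[OF assms(1,4)])
       (use assms(2) in \<open>auto intro: ideal.I_r_closed ideal.Icarr\<close>)
  then show ?thesis using assms self.pfilt_prime by (auto simp: isolated_at_def)
qed

lemma len_isolated_finite:
  assumes "noetherian_ring R" "primeideal P R" "S = carrier R - P" "ideal I R" "isolated_at R P I"
  obtains n where "len R (self_module R) S I (carrier R) = enat n"
proof -
  interpret self: smod R "self_module R" S by (rule smod_self)
  obtain Qs where "pfilt R (self_module R) I (carrier R) Qs"
    using pfilt_ideal_exists[OF assms(1,4) R.oneideal] ideal.Icarr[OF assms(4)] by auto
  then show ?thesis using self.pfilt_len_count[OF _ assms(2,3)] pfilt_isolated[OF _ assms(4,5)] that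
    by metis
qed

text \<open>
  The Herbrand quotient \<open>\<lambda>(N/xN) - \<lambda>(0 :\<^sub>N x)\<close> is additive, vanishes on modules of finite length, and
  the second term is absent for \<open>N = B/A\<close>; so only the factors \<open>R/Q\<close> contribute.
\<close>

lemma len_scale_quotient:
  assumes P: "primeideal P R" "S = carrier R - P" and Q: "primeideal Q R"
    and x: "x \<in> carrier R" "x \<notin> Q"
    and dim1: "\<And>Q'. Q' \<in> set Qs \<Longrightarrow> Q' = Q \<or> (Q' \<subseteq> P \<longrightarrow> Q' = P)"
    and inj: "\<And>m. m \<in> carrier M \<Longrightarrow> x \<odot>\<^bsub>M\<^esub> m \<in> A \<Longrightarrow> m \<in> A"
    and l: "len R (self_module R) S (Q <+>\<^bsub>R\<^esub> cyclic R (self_module R) x) (carrier R) = enat l"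
    and filt: "pfilt R M A B Qs"
  shows "len R M S (A <+>\<^bsub>M\<^esub> (\<lambda>m. x \<odot>\<^bsub>M\<^esub> m) ` B) B = enat (count_list Qs Q * l)"
  using filt inj dim1
proof (induction)
  case (Nil A)
  interpret \<mu>: smod_hom R M M S "\<lambda>m. x \<odot>\<^bsub>M\<^esub> m" by (rule smod_hom_scale) fact
  have "A <+>\<^bsub>M\<^esub> (\<lambda>m. x \<odot>\<^bsub>M\<^esub> m) ` A = A"
    using Nil x sum_absorb[OF \<mu>.image_submodule[OF Nil(1)] Nil(1)]
      sum_comm[OF \<mu>.image_submodule[OF Nil(1)] Nil(1)] sub_smult[OF Nil(1)] by auto
  then show ?case using len_eq_0[OF Nil(1) sat_increasing[OF Nil(1)]] by (simp add: zero_enat_def)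
next
  case (Cons A B Qs y)
  interpret self: smod R "self_module R" S by (rule smod_self)
  interpret \<mu>: smod_hom R M M S "\<lambda>m. x \<odot>\<^bsub>M\<^esub> m" by (rule smod_hom_scale) fact
  interpret \<iota>: smod_hom R M M S "\<lambda>m. m" by (rule smod_hom_id)
  interpret \<phi>: smod_hom R "self_module R" M S "\<lambda>r. r \<odot>\<^bsub>M\<^esub> y" by (rule smod_hom_mult) fact
  let ?x = "\<lambda>N. (\<lambda>m. x \<odot>\<^bsub>M\<^esub> m) ` N"
  define C where "C = B <+>\<^bsub>M\<^esub> cyclic R M y"
  define Q' where "Q' = colon R M B y"
  note A = pfilt_submodule(1)[OF Cons.hyps(1)] and B = pfilt_submodule(2)[OF Cons.hyps(1)]
    and AB = pfilt_submodule(3)[OF Cons.hyps(1)]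
  have C: "submodule C R M" unfolding C_def using B Cons.hyps(2) by (rule adjoin_submodule)
  have BC: "B \<subseteq> C" unfolding C_def by (rule sum_upper1[OF B cyclic_submodule[OF Cons.hyps(2)]])
  have xB: "submodule (?x B) R M" and xC: "submodule (?x C) R M"
    using B C \<mu>.image_submodule by auto
  have xBB: "?x B \<subseteq> B" and xCC: "?x C \<subseteq> C" using B C x sub_smult by auto
  have AxB: "submodule (A <+>\<^bsub>M\<^esub> ?x B) R M" and AxC: "submodule (A <+>\<^bsub>M\<^esub> ?x C) R M"
    and BxC: "submodule (B <+>\<^bsub>M\<^esub> ?x C) R M"
    using A B xB xC by (auto intro!: sub_sum)
  have le1: "A <+>\<^bsub>M\<^esub> ?x B \<subseteq> B" using sum_least[OF B AB xBB] .
  have le2: "A <+>\<^bsub>M\<^esub> ?x C \<subseteq> C" using sum_least[OF C _ xCC] AB BC by auto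
  have le3: "A <+>\<^bsub>M\<^esub> ?x B \<subseteq> A <+>\<^bsub>M\<^esub> ?x C" using BC by (intro sum_mono) auto
  have le4: "A <+>\<^bsub>M\<^esub> ?x C \<subseteq> B <+>\<^bsub>M\<^esub> ?x C" using AB by (intro sum_mono) auto
  have le5: "B <+>\<^bsub>M\<^esub> ?x C \<subseteq> C" using sum_least[OF C BC xCC] .
  have car: "B \<subseteq> carrier M" "C \<subseteq> carrier M" "A \<subseteq> carrier M" using A B C sub_car by auto
  have IH: "len R M S (A <+>\<^bsub>M\<^esub> ?x B) B = enat (count_list Qs Q * l)"
    by (rule Cons.IH[OF Cons.prems(1)]) (use Cons.prems(2) in auto)
  show ?case
  proof (cases "Q' = Q")
    case False
    then have ne: "Q' \<subseteq> P \<longrightarrow> Q' = P" using Cons.prems(2)[of Q'] by (simp add: Q'_def)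
    have "\<exists>\<epsilon>. len R M S B C = enat \<epsilon>"
      using pfilt_len_count[OF pfilt.Cons[OF pfilt.Nil[OF B] Cons.hyps(2,3)] P] ne
      unfolding C_def Q'_def by auto
    then obtain \<epsilon> where \<epsilon>: "len R M S B C = enat \<epsilon>" by blast
    have "(A <+>\<^bsub>M\<^esub> ?x B) <+>\<^bsub>M\<^esub> ?x C = A <+>\<^bsub>M\<^esub> ?x C"
    proof
      have "?x B \<subseteq> ?x C" using BC by auto
      moreover have "A \<subseteq> A <+>\<^bsub>M\<^esub> ?x C" "?x C \<subseteq> A <+>\<^bsub>M\<^esub> ?x C"
        using sum_upper1[OF A xC] sum_upper2[OF A xC] by auto
      ultimately show "(A <+>\<^bsub>M\<^esub> ?x B) <+>\<^bsub>M\<^esub> ?x C \<subseteq> A <+>\<^bsub>M\<^esub> ?x C"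
        using sum_least[OF AxC] le3 by blast
      show "A <+>\<^bsub>M\<^esub> ?x C \<subseteq> (A <+>\<^bsub>M\<^esub> ?x B) <+>\<^bsub>M\<^esub> ?x C"
        using sum_upper1[OF A xB] by (intro sum_mono) auto
    qed
    \<comment> \<open>Multiplication by \<open>x\<close> is injective modulo \<open>A\<close>, so it
      maps \<open>C/B\<close> isomorphically onto \<open>(A + xC) / (A + xB)\<close>.\<close>
    moreover have "len R M S (A <+>\<^bsub>M\<^esub> ?x B) ((A <+>\<^bsub>M\<^esub> ?x B) <+>\<^bsub>M\<^esub> ?x C) = len R M S B C"
    proof (rule \<mu>.len_image_eq[OF B C BC _ AxB])
      show "?x B \<subseteq> A <+>\<^bsub>M\<^esub> ?x B" using sum_upper2[OF A xB] .
      fix c assume c: "c \<in> C" "x \<odot>\<^bsub>M\<^esub> c \<in> A <+>\<^bsub>M\<^esub> ?x B"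
      then obtain a b where ab: "a \<in> A" "b \<in> B" "x \<odot>\<^bsub>M\<^esub> c = a \<oplus>\<^bsub>M\<^esub> x \<odot>\<^bsub>M\<^esub> b"
        unfolding set_add_iff by blast
      have m: "a \<in> carrier M" "b \<in> carrier M" "c \<in> carrier M" using ab c car by auto
      have "x \<odot>\<^bsub>M\<^esub> (c \<ominus>\<^bsub>M\<^esub> b) = (a \<oplus>\<^bsub>M\<^esub> x \<odot>\<^bsub>M\<^esub> b) \<ominus>\<^bsub>M\<^esub> x \<odot>\<^bsub>M\<^esub> b"
        using m x ab by (simp add: a_minus_def smult_r_distr smult_r_minus)
      also have "\<dots> = a" using m x by (simp add: a_minus_def M.a_assoc M.r_neg)
      finally have "x \<odot>\<^bsub>M\<^esub> (c \<ominus>\<^bsub>M\<^esub> b) \<in> A" using ab by simp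
      then have "c \<ominus>\<^bsub>M\<^esub> b \<in> A" using Cons.prems(1)[of "c \<ominus>\<^bsub>M\<^esub> b"] m by simp
      then have "(c \<ominus>\<^bsub>M\<^esub> b) \<oplus>\<^bsub>M\<^esub> b \<in> B" using ab AB by (intro sub_add[OF B]) auto
      then show "c \<in> B" using m by (simp add: a_minus_def M.a_assoc M.l_neg)
    qed
    ultimately have eq: "len R M S (A <+>\<^bsub>M\<^esub> ?x B) (A <+>\<^bsub>M\<^esub> ?x C) = enat \<epsilon>" using \<epsilon> by simp
    \<comment> \<open>The quotient \<open>C / (A + xB)\<close> is cut once at \<open>B\<close> and
      once at \<open>A + xC\<close>; the finite length of the factor \<open>C/B\<close> occurs on
      both sides and cancels.\<close>
    have "enat (count_list Qs Q * l) + enat \<epsilon> = enat \<epsilon> + len R M S (A <+>\<^bsub>M\<^esub> ?x C) C"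
      using len_add[OF AxB B C le1 BC] len_add[OF AxB AxC C le3 le2] IH eq \<epsilon> by simp
    then have "len R M S (A <+>\<^bsub>M\<^esub> ?x C) C = enat (count_list Qs Q * l)"
      by (cases "len R M S (A <+>\<^bsub>M\<^esub> ?x C) C") auto
    then show ?thesis using False by (simp add: C_def Q'_def)
  next
    case True
    \<comment> \<open>Since \<open>x\<close> is a nonzerodivisor modulo \<open>Q\<close>, an element
      \<open>x c\<close> lies in \<open>B\<close> only if \<open>c\<close> does. Hence
      \<open>B\<close> meets \<open>A + xC\<close> exactly in \<open>A + xB\<close>, and the old
      contribution is unchanged.\<close>
    have "len R M S (A <+>\<^bsub>M\<^esub> ?x C) ((A <+>\<^bsub>M\<^esub> ?x C) <+>\<^bsub>M\<^esub> (\<lambda>m. m) ` B)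
        = len R M S (A <+>\<^bsub>M\<^esub> ?x B) B"
    proof (rule \<iota>.len_image_eq[OF AxB B le1 _ AxC])
      show "(\<lambda>m. m) ` (A <+>\<^bsub>M\<^esub> ?x B) \<subseteq> A <+>\<^bsub>M\<^esub> ?x C" using le3 by auto
      fix b assume b: "b \<in> B" "b \<in> A <+>\<^bsub>M\<^esub> ?x C"
      then obtain a c where ac: "a \<in> A" "c \<in> C" "b = a \<oplus>\<^bsub>M\<^esub> x \<odot>\<^bsub>M\<^esub> c"
        unfolding set_add_iff by blast
      obtain b' r where br: "b' \<in> B" "r \<in> carrier R" "c = b' \<oplus>\<^bsub>M\<^esub> r \<odot>\<^bsub>M\<^esub> y"
        using ac(2) unfolding C_def mem_adjoin by blast
      have m: "a \<in> carrier M" "b' \<in> carrier M" "c \<in> carrier M" "y \<in> carrier M"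
        using ac br car Cons.hyps by auto
      have "x \<odot>\<^bsub>M\<^esub> c \<in> B" using sub_cancel[OF B, of a "x \<odot>\<^bsub>M\<^esub> c"] ac b AB m x by auto
      moreover have "x \<odot>\<^bsub>M\<^esub> c = x \<odot>\<^bsub>M\<^esub> b' \<oplus>\<^bsub>M\<^esub> (x \<otimes> r) \<odot>\<^bsub>M\<^esub> y"
        using br m x by (simp add: smult_r_distr smult_assoc1)
      ultimately have "(x \<otimes> r) \<odot>\<^bsub>M\<^esub> y \<in> B"
        using sub_cancel[OF B, of "x \<odot>\<^bsub>M\<^esub> b'"] sub_smult[OF B x(1) br(1)] br m x by auto
      then have "x \<otimes> r \<in> Q" using True br x by (auto simp: Q'_def colon_def)
      then have "r \<in> Q" using primeideal.I_prime[OF Q x(1) br(2)] x by auto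
      then have "c \<in> B" using True br by (auto simp: Q'_def colon_def intro: sub_add[OF B])
      then show "b \<in> A <+>\<^bsub>M\<^esub> ?x B" using ac unfolding set_add_iff by blast
    qed
    moreover have "(A <+>\<^bsub>M\<^esub> ?x C) <+>\<^bsub>M\<^esub> B = B <+>\<^bsub>M\<^esub> ?x C"
      using sum_right_comm[OF A xC B] sum_absorb[OF A B AB] by simp
    ultimately have e1: "len R M S (A <+>\<^bsub>M\<^esub> ?x C) (B <+>\<^bsub>M\<^esub> ?x C) = enat (count_list Qs Q * l)"
      using IH by simp
    let ?I = "Q <+>\<^bsub>R\<^esub> cyclic R (self_module R) x"
    have I: "submodule ?I R (self_module R)"
      using self.sub_sum[of Q "cyclic R (self_module R) x"] self.cyclic_submodule[of x] x Q
      by (simp add: ideal_iff_submodule primeideal.axioms)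
    have "(B <+>\<^bsub>M\<^esub> ?x C) <+>\<^bsub>M\<^esub> cyclic R M y = C"
    proof -
      have "(B <+>\<^bsub>M\<^esub> ?x C) <+>\<^bsub>M\<^esub> cyclic R M y = C <+>\<^bsub>M\<^esub> ?x C"
        unfolding C_def[symmetric] sum_right_comm[OF B xC cyclic_submodule[OF Cons.hyps(2)]] ..
      then show ?thesis using sum_absorb[OF xC C xCC] sum_comm[OF xC C] by simp
    qed
    \<comment> \<open>What remains is \<open>C / (B + xC)\<close>, the cokernel of \<open>x\<close>
      on the new factor \<open>R/Q\<close>; it accounts for the additional \<open>l\<close>.\<close>
    moreover have "len R M S (B <+>\<^bsub>M\<^esub> ?x C) ((B <+>\<^bsub>M\<^esub> ?x C) <+>\<^bsub>M\<^esub> (\<lambda>r. r \<odot>\<^bsub>M\<^esub> y) ` carrier R)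
      = len R (self_module R) S ?I (carrier R)"
    proof (rule \<phi>.len_image_eq[OF I _ _ _ BxC])
      show "submodule (carrier R) R (self_module R)" using self.carrier_is_submodule by simp
      show "?I \<subseteq> carrier R" using self.sub_car[OF I] by auto
      have yC: "y \<in> C" unfolding C_def
        using sum_upper2[OF B cyclic_submodule[OF Cons.hyps(2)]] cyclic_self[OF Cons.hyps(2)] by auto
      show "(\<lambda>r. r \<odot>\<^bsub>M\<^esub> y) ` ?I \<subseteq> B <+>\<^bsub>M\<^esub> ?x C"
      proof clarify
        fix r assume "r \<in> ?I"
        then obtain a b where ab: "a \<in> Q" "b \<in> carrier R" "r = a \<oplus> b \<otimes> x"
          unfolding set_add_iff cyclic_def by auto
        have a: "a \<in> carrier R" "a \<odot>\<^bsub>M\<^esub> y \<in> B" using ab True by (auto simp: Q'_def colon_def)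
        have "r \<odot>\<^bsub>M\<^esub> y = a \<odot>\<^bsub>M\<^esub> y \<oplus>\<^bsub>M\<^esub> x \<odot>\<^bsub>M\<^esub> (b \<odot>\<^bsub>M\<^esub> y)"
          using a ab x Cons.hyps(2) by (simp add: smult_l_distr smult_assoc1[symmetric] R.m_comm)
        moreover have "b \<odot>\<^bsub>M\<^esub> y \<in> C" using yC ab by (intro sub_smult[OF C])
        ultimately show "r \<odot>\<^bsub>M\<^esub> y \<in> B <+>\<^bsub>M\<^esub> ?x C" using a unfolding set_add_iff by blast
      qed
      fix r assume r: "r \<in> carrier R" "r \<odot>\<^bsub>M\<^esub> y \<in> B <+>\<^bsub>M\<^esub> ?x C"
      then obtain b c where bc: "b \<in> B" "c \<in> C" "r \<odot>\<^bsub>M\<^esub> y = b \<oplus>\<^bsub>M\<^esub> x \<odot>\<^bsub>M\<^esub> c"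
        unfolding set_add_iff by blast
      obtain b' r' where br: "b' \<in> B" "r' \<in> carrier R" "c = b' \<oplus>\<^bsub>M\<^esub> r' \<odot>\<^bsub>M\<^esub> y"
        using bc(2) unfolding C_def mem_adjoin by blast
      have m: "b \<in> carrier M" "b' \<in> carrier M" "c \<in> carrier M" "y \<in> carrier M"
        using bc br car Cons.hyps by auto
      have e: "r \<odot>\<^bsub>M\<^esub> y = (b \<oplus>\<^bsub>M\<^esub> x \<odot>\<^bsub>M\<^esub> b') \<oplus>\<^bsub>M\<^esub> (x \<otimes> r') \<odot>\<^bsub>M\<^esub> y"
        using bc br m x by (simp add: smult_r_distr smult_assoc1 M.a_assoc)
      have "(r \<ominus> x \<otimes> r') \<odot>\<^bsub>M\<^esub> y = r \<odot>\<^bsub>M\<^esub> y \<ominus>\<^bsub>M\<^esub> (x \<otimes> r') \<odot>\<^bsub>M\<^esub> y"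
        using r br x m by (simp add: a_minus_def smult_l_distr smult_l_minus)
      also have "\<dots> = b \<oplus>\<^bsub>M\<^esub> x \<odot>\<^bsub>M\<^esub> b'"
        unfolding e using br x m by (simp add: a_minus_def M.a_assoc M.r_neg)
      also have "\<dots> \<in> B" using bc br x by (auto intro!: sub_add[OF B] sub_smult[OF B])
      finally have q: "r \<ominus> x \<otimes> r' \<in> Q"
        unfolding True[symmetric] Q'_def colon_def using r br x by simp
      have "r = (r \<ominus> x \<otimes> r') \<oplus> r' \<otimes> x"
        using r br x by (simp add: a_minus_def R.a_assoc R.l_neg R.m_comm)
      then show "r \<in> ?I" using q br unfolding set_add_iff cyclic_def by auto
    qed
    ultimately have e2: "len R M S (B <+>\<^bsub>M\<^esub> ?x C) C = enat l" using l by (simp add: cyclic_def)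
    have "len R M S (A <+>\<^bsub>M\<^esub> ?x C) C = enat (count_list Qs Q * l) + enat l"
      using len_add[OF AxC BxC C le4 le5] e1 e2 by simp
    then show ?thesis using True by (simp add: C_def Q'_def)
  qed
qed

text \<open>As \<open>x^n\<close> is a nonzerodivisor modulo the prime \<open>Q\<close>,
  multiplication by it identifies \<open>R / (Q + (x))\<close> with
  \<open>(Q + (x^n)) / (Q + (x^(n+1)))\<close>; each further power contributes the same
  length.\<close>

lemma len_power_quotient:
  assumes Q: "primeideal Q R" and x: "x \<in> carrier R" "x \<notin> Q"
  shows "len R (self_module R) S (Q <+>\<^bsub>R\<^esub> cyclic R (self_module R) (x [^] n)) (carrier R)
    = of_nat n * len R (self_module R) S (Q <+>\<^bsub>R\<^esub> cyclic R (self_module R) x) (carrier R)"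
proof (induction n)
  case 0
  interpret self: smod R "self_module R" S by (rule smod_self)
  have Q': "submodule Q R (self_module R)" using Q by (simp add: ideal_iff_submodule primeideal.axioms)
  have "cyclic R (self_module R) (\<one>) = carrier R" by (force simp: cyclic_def)
  moreover have "Q <+>\<^bsub>R\<^esub> carrier R = carrier R"
    using self.sum_absorb[OF Q' self.carrier_is_submodule] self.sub_car[OF Q'] by auto
  ultimately show ?case
    using self.len_eq_0[OF self.carrier_is_submodule self.sat_increasing[OF self.carrier_is_submodule]]
    by simp
next
  case (Suc n)
  interpret self: smod R "self_module R" S by (rule smod_self)
  let ?y = "x [^] n"
  have y: "?y \<in> carrier R" using x by simp
  interpret \<mu>: smod_hom R "self_module R" "self_module R" S "\<lambda>m. m \<otimes> ?y"
    using self.smod_hom_mult[of ?y] y by simp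
  have Q': "submodule Q R (self_module R)" using Q by (simp add: ideal_iff_submodule primeideal.axioms)
  define J where "J = (\<lambda>z. Q <+>\<^bsub>R\<^esub> cyclic R (self_module R) z)"
  have J: "submodule (J z) R (self_module R)" if "z \<in> carrier R" for z
    using self.adjoin_submodule[OF Q', of z] that by (simp add: J_def)
  have mem: "r \<in> J z \<longleftrightarrow> (\<exists>b\<in>Q. \<exists>s\<in>carrier R. r = b \<oplus> s \<otimes> z)" for r z
    using self.mem_adjoin[of r Q z] by (simp add: J_def)
  have Qc: "b \<in> carrier R" if "b \<in> Q" for b using self.sub_car[OF Q'] that by auto
  have yQ: "?y \<notin> Q"
  proof (induction n)
    case 0
    show ?case using ideal.one_imp_carrier[OF primeideal.axioms(1)[OF Q]] primeideal.I_notcarr[OF Q] by auto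
  next
    case (Suc n)
    then show ?case using primeideal.I_prime[OF Q, of "x [^] n" x] x by auto
  qed
  have sub: "J (?y \<otimes> x) \<subseteq> J ?y"
  proof
    fix r assume "r \<in> J (?y \<otimes> x)"
    then obtain b s where bs: "b \<in> Q" "s \<in> carrier R" "r = b \<oplus> s \<otimes> (?y \<otimes> x)" using mem by blast
    then have "r = b \<oplus> (s \<otimes> x) \<otimes> ?y" using x y by (simp add: R.m_ac)
    then show "r \<in> J ?y" using mem bs x by blast
  qed
  have ups: "Q \<subseteq> J z" "z \<in> J z" if "z \<in> carrier R" for z
    using self.sum_upper1[OF Q' self.cyclic_submodule[of z]] self.sum_upper2[OF Q' self.cyclic_submodule[of z]]
      self.cyclic_self[of z] that by (auto simp: J_def)
  have Jyx: "submodule (J (?y \<otimes> x)) R (self_module R)" and Jy: "submodule (J ?y) R (self_module R)"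
    and Jx: "submodule (J x) R (self_module R)"
    using J x y by auto
  have sum: "J (?y \<otimes> x) <+>\<^bsub>R\<^esub> (\<lambda>m. m \<otimes> ?y) ` carrier R = J ?y"
  proof
    have "(\<lambda>m. m \<otimes> ?y) ` carrier R \<subseteq> J ?y"
      using ups(2)[OF y] self.sub_smult[OF Jy] by auto
    then show "J (?y \<otimes> x) <+>\<^bsub>R\<^esub> (\<lambda>m. m \<otimes> ?y) ` carrier R \<subseteq> J ?y"
      using self.sum_least[OF Jy sub] by simp
    have "Q <+>\<^bsub>R\<^esub> cyclic R (self_module R) ?y \<subseteq> J (?y \<otimes> x) <+>\<^bsub>R\<^esub> (\<lambda>m. m \<otimes> ?y) ` carrier R"
      using self.sum_mono[OF ups(1), of "?y \<otimes> x" "cyclic R (self_module R) ?y" "(\<lambda>m. m \<otimes> ?y) ` carrier R"] x y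
      by (simp add: cyclic_def)
    then show "J ?y \<subseteq> J (?y \<otimes> x) <+>\<^bsub>R\<^esub> (\<lambda>m. m \<otimes> ?y) ` carrier R" by (simp add: J_def)
  qed
  have "len R (self_module R) S (J (?y \<otimes> x)) (J (?y \<otimes> x) <+>\<^bsub>self_module R\<^esub> (\<lambda>m. m \<otimes> ?y) ` carrier R)
    = len R (self_module R) S (J x) (carrier R)"
  proof (rule \<mu>.len_image_eq[OF Jx _ _ _ Jyx])
    show "submodule (carrier R) R (self_module R)" using self.carrier_is_submodule by simp
    show "J x \<subseteq> carrier R" using self.sub_car[OF Jx] by auto
    show "(\<lambda>m. m \<otimes> ?y) ` J x \<subseteq> J (?y \<otimes> x)"
    proof clarify
      fix r assume "r \<in> J x"
      then obtain b s where bs: "b \<in> Q" "s \<in> carrier R" "r = b \<oplus> s \<otimes> x" using mem by blast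
      then have "r \<otimes> ?y = b \<otimes> ?y \<oplus> s \<otimes> x \<otimes> ?y" using x y Qc by (simp add: R.l_distr)
      moreover have "s \<otimes> x \<otimes> ?y = s \<otimes> (?y \<otimes> x)" using bs(2) x y by (simp add: R.m_ac)
      moreover have "b \<otimes> ?y \<in> Q" using bs y ideal.I_r_closed[OF primeideal.axioms(1)[OF Q]] by blast
      ultimately have "\<exists>b\<in>Q. \<exists>s\<in>carrier R. r \<otimes> ?y = b \<oplus> s \<otimes> (?y \<otimes> x)" using bs(2) by auto
      then show "r \<otimes> ?y \<in> J (?y \<otimes> x)" using mem bs by blast
    qed
    fix r assume r: "r \<in> carrier R" "r \<otimes> ?y \<in> J (?y \<otimes> x)"
    then obtain b s where bs: "b \<in> Q" "s \<in> carrier R" "r \<otimes> ?y = b \<oplus> s \<otimes> (?y \<otimes> x)" using mem by blast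
    have "s \<otimes> x \<otimes> ?y = s \<otimes> (?y \<otimes> x)" using bs(2) x y by (simp add: R.m_ac)
    moreover have "(r \<ominus> s \<otimes> x) \<otimes> ?y = r \<otimes> ?y \<ominus> s \<otimes> x \<otimes> ?y"
      using r bs(2) x y by (simp add: a_minus_def R.l_distr R.l_minus)
    ultimately have "(r \<ominus> s \<otimes> x) \<otimes> ?y = r \<otimes> ?y \<ominus> s \<otimes> (?y \<otimes> x)" by simp
    also have "\<dots> = b" using bs x y Qc by (simp add: a_minus_def R.a_assoc R.r_neg)
    finally have "(r \<ominus> s \<otimes> x) \<otimes> ?y \<in> Q" using bs by simp
    then have "r \<ominus> s \<otimes> x \<in> Q" using primeideal.I_prime[OF Q, of "r \<ominus> s \<otimes> x" ?y] yQ r bs x y by auto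
    moreover have "r = (r \<ominus> s \<otimes> x) \<oplus> s \<otimes> x" using r bs x by (simp add: a_minus_def R.a_assoc R.l_neg)
    ultimately show "r \<in> J x" using mem bs by blast
  qed
  then have "len R (self_module R) S (J (?y \<otimes> x)) (J ?y) = len R (self_module R) S (J x) (carrier R)"
    using sum by simp
  moreover have "len R (self_module R) S (J (?y \<otimes> x)) (carrier R)
      = len R (self_module R) S (J (?y \<otimes> x)) (J ?y) + len R (self_module R) S (J ?y) (carrier R)"
    using self.len_add[OF Jyx Jy _ sub] self.carrier_is_submodule self.sub_car[OF Jy] by auto
  ultimately show ?case using Suc.IH by (simp add: J_def distrib_right of_nat_Suc)
qed

end

section \<open>The Frobenius module\<close>

lemma (in cring) binomial:
  assumes "a \<in> carrier R" "b \<in> carrier R"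
  shows "(a \<oplus> b) [^] n = (\<Oplus>k\<in>{..n}. add_pow R (n choose k) (a [^] k \<otimes> b [^] (n - k)))"
proof (induction n)
  case 0
  then show ?case using assms by simp
next
  case (Suc n)
  define t where "t = (\<lambda>k. a [^] k \<otimes> b [^] (Suc n - k))"
  have t: "t k \<in> carrier R" for k using assms by (simp add: t_def)
  let ?f = "\<lambda>k. add_pow R (n choose k) (a [^] k \<otimes> b [^] (n - k))"
  have f: "?f \<in> {..n} \<rightarrow> carrier R" using assms by auto
  have "(\<Oplus>k\<in>{..n}. ?f k) \<otimes> a = (\<Oplus>k\<in>{..n}. ?f k \<otimes> a)"
    using f assms by (intro finsum_ldistr) auto
  also have "\<dots> = (\<Oplus>k\<in>{..n}. add_pow R (n choose k) (t (Suc k)))"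
  proof (intro finsum_cong')
    fix k
    have "(a [^] k \<otimes> b [^] (n - k)) \<otimes> a = t (Suc k)" using assms by (simp add: t_def m_ac)
    then show "?f k \<otimes> a = add_pow R (n choose k) (t (Suc k))" using assms by (subst add_pow_ldistr) auto
  qed (use t in auto)
  finally have A: "(\<Oplus>k\<in>{..n}. ?f k) \<otimes> a = (\<Oplus>k\<in>{..n}. add_pow R (n choose k) (t (Suc k)))" .
  have "(\<Oplus>k\<in>{..n}. ?f k) \<otimes> b = (\<Oplus>k\<in>{..n}. ?f k \<otimes> b)"
    using f assms by (intro finsum_ldistr) auto
  also have "\<dots> = (\<Oplus>k\<in>{..n}. add_pow R (n choose k) (t k))"
  proof (intro finsum_cong')
    fix k assume "k \<in> {..n}"
    then have "(a [^] k \<otimes> b [^] (n - k)) \<otimes> b = t k" using assms by (simp add: t_def m_assoc Suc_diff_le)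
    then show "?f k \<otimes> b = add_pow R (n choose k) (t k)" using assms by (subst add_pow_ldistr) auto
  qed (use t in auto)
  \<comment> \<open>The sum is prolonged by its vanishing top term, so that after a shift of the
    index both sums run over the same range and Pascal's rule applies termwise.\<close>
  also have "\<dots> = (\<Oplus>k\<in>{..Suc n}. add_pow R (n choose k) (t k))"
    using t by (subst finsum_Suc) (auto simp: binomial_eq_0)
  also have "\<dots> = (\<Oplus>k\<in>{..n}. add_pow R (n choose Suc k) (t (Suc k))) \<oplus> t 0"
    using t by (subst finsum_Suc2) auto
  finally have B: "(\<Oplus>k\<in>{..n}. ?f k) \<otimes> b = (\<Oplus>k\<in>{..n}. add_pow R (n choose Suc k) (t (Suc k))) \<oplus> t 0" .
  have "(a \<oplus> b) [^] Suc n = (\<Oplus>k\<in>{..n}. ?f k) \<otimes> a \<oplus> (\<Oplus>k\<in>{..n}. ?f k) \<otimes> b"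
    using Suc.IH f assms by (simp add: r_distr)
  also have "\<dots> = ((\<Oplus>k\<in>{..n}. add_pow R (n choose k) (t (Suc k))) \<oplus> (\<Oplus>k\<in>{..n}. add_pow R (n choose Suc k) (t (Suc k)))) \<oplus> t 0"
    unfolding A B using t by (simp add: a_assoc)
  also have "\<dots> = (\<Oplus>k\<in>{..n}. add_pow R (n choose k) (t (Suc k)) \<oplus> add_pow R (n choose Suc k) (t (Suc k))) \<oplus> t 0"
    using t by (subst finsum_addf) auto
  also have "\<dots> = (\<Oplus>k\<in>{..n}. add_pow R (Suc n choose Suc k) (t (Suc k))) \<oplus> add_pow R (Suc n choose 0) (t 0)"
    using t by (simp add: add.nat_pow_mult)
  also have "\<dots> = (\<Oplus>k\<in>{..Suc n}. add_pow R (Suc n choose k) (t k))"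
    using t by (subst finsum_Suc2) auto
  finally show ?case by (simp add: t_def)
qed

lemma (in ideal) pow_closed: "a \<in> I \<Longrightarrow> n > 0 \<Longrightarrow> a [^] (n::nat) \<in> I"
  by (cases n) (auto simp: I_l_closed)

lemma (in primeideal) pow_mem_iff: "a \<in> carrier R \<Longrightarrow> n > 0 \<Longrightarrow> a [^] (n::nat) \<in> I \<longleftrightarrow> a \<in> I"
proof
  assume a: "a \<in> carrier R" "n > 0" "a [^] n \<in> I"
  show "a \<in> I"
    using a(2,3)
  proof (induction n)
    case (Suc n)
    then show ?case using I_prime[of "a [^] n" a] a(1) by (cases n) auto
  qed simp
qed (auto intro: pow_closed)

locale char_p = cring R for R (structure) +
  fixes p :: nat
  assumes p: "Factorial_Ring.prime p" and char: "ring_char R = p"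
begin

lemma p_gt_0: "p > 0" using p by (simp add: prime_gt_0_nat)

lemma p_one: "add_pow R p \<one> = \<zero>"
proof -
  \<comment> \<open>A positive characteristic excludes the default value \<open>0\<close> of
    \<open>ring_char\<close>.\<close>
  have "\<exists>n>0. add_pow R (n::nat) \<one> = \<zero>" using char p_gt_0 by (auto simp: ring_char_def split: if_splits)
  then have "(LEAST n. n > 0 \<and> add_pow R (n::nat) \<one> = \<zero>) = p" using char by (auto simp: ring_char_def)
  then show ?thesis using LeastI_ex[of "\<lambda>n. n > 0 \<and> add_pow R (n::nat) \<one> = \<zero>"] \<open>\<exists>n>0. _\<close> by auto
qed

lemma p_mult: "x \<in> carrier R \<Longrightarrow> p dvd n \<Longrightarrow> add_pow R n x = \<zero>"
proof -
  assume x: "x \<in> carrier R" and "p dvd n"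
  then obtain k where n: "n = p * k" by auto
  have "add_pow R p x = add_pow R p \<one> \<otimes> x" using x by (simp add: add_pow_ldistr)
  then have "add_pow R p x = \<zero>" using x p_one by simp
  then show "add_pow R n x = \<zero>" using x by (simp add: n add.nat_pow_pow[symmetric])
qed

lemma frob_add:
  assumes "a \<in> carrier R" "b \<in> carrier R"
  shows "(a \<oplus> b) [^] p = a [^] p \<oplus> b [^] p"
proof -
  obtain j where j: "p = Suc (Suc j)"
    using prime_ge_2_nat[OF p] by (metis add_2_eq_Suc le_add_diff_inverse)
  define g where "g = (\<lambda>k. add_pow R (p choose k) (a [^] k \<otimes> b [^] (p - k)))"
  have g: "g k \<in> carrier R" for k using assms by (simp add: g_def)
  have "g (Suc k) = \<zero>" if "Suc k < p" for k
    unfolding g_def using that p assms by (intro p_mult dvd_choose_prime) auto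
  then have "(\<Oplus>k\<in>{..j}. g (Suc k)) = \<zero>"
    using j by (intro add.finprod_one_eqI) auto
  then have "(\<Oplus>k\<in>{..p}. g k) = g p \<oplus> g 0"
    using g finsum_Suc2[of g "Suc j"] finsum_Suc[of "\<lambda>k. g (Suc k)" j] unfolding j by simp
  then show ?thesis using binomial[OF assms, of p] assms by (simp add: g_def)
qed

lemma frob_add_iter:
  assumes "a \<in> carrier R" "b \<in> carrier R"
  shows "(a \<oplus> b) [^] (p ^ e) = a [^] (p ^ e) \<oplus> b [^] (p ^ e)"
proof (induction e)
  case (Suc e)
  have "x [^] (p ^ Suc e) = (x [^] (p ^ e)) [^] p" if "x \<in> carrier R" for x
    using that by (simp add: nat_pow_pow mult.commute)
  then show ?case using Suc assms by (simp add: frob_add)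
qed (use assms in simp)

abbreviation F where "F \<equiv> frobenius_module p R"

lemma F_simps [simp]:
  "carrier F = carrier R" "ring.add F = ring.add R" "ring.zero F = ring.zero R"
  "smult F r x = r [^] p \<otimes> x"
  by (simp_all add: frobenius_module_def self_module_def)

lemma set_add_F [simp]: "A <+>\<^bsub>F\<^esub> B = A <+>\<^bsub>R\<^esub> B"
  by (auto simp: set_add_iff)

lemma module_F: "module R F"
proof (rule moduleI)
  show "abelian_group F" by (rule abelian_groupI_same_add[OF is_abelian_group]) auto
qed (auto simp: is_cring frob_add nat_pow_distrib l_distr r_distr m_assoc)

lemma smodI:
  assumes "module R M" "primeideal P R"
  shows "smod R M (carrier R - P)"
proof -
  interpret primeideal P R by fact
  have "\<one> \<notin> P" using one_imp_carrier I_notcarr by auto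
  then show ?thesis using assms(1) I_prime by (auto simp: smod_def smod_axioms_def)
qed

lemma ideal_F_submodule: "ideal I R \<Longrightarrow> submodule I R F"
proof -
  assume "ideal I R"
  then interpret I: ideal I R .
  interpret module R F by (rule module_F)
  show ?thesis
  proof (rule submoduleI)
    fix a assume "a \<in> I"
    have "\<ominus>\<^bsub>F\<^esub> a = \<ominus> a" by (simp add: a_inv_def m_inv_def)
    then show "\<ominus>\<^bsub>F\<^esub> a \<in> I" using \<open>a \<in> I\<close> by simp
  qed (auto simp: I.I_l_closed)
qed

lemma len_F_meets_S:
  assumes "smod R F S" "ideal I R" "I \<inter> S \<noteq> {}"
  shows "len R F S I (carrier R) = 0"
proof -
  interpret smod R F S by fact
  obtain s where s: "s \<in> I" "s \<in> S" using assms by auto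
  have "s [^] p \<in> I" using s ideal.pow_closed[OF assms(2)] p_gt_0 by auto
  then have "carrier R \<subseteq> sat R F S I"
    using s ideal.I_r_closed[OF assms(2)] by (auto simp: sat_def)
  then show ?thesis using ideal_F_submodule[OF assms(2)] by (intro len_eq_0)
qed

text \<open>This is \<open>[k(P) : k(P)\<^sup>p]\<close>, read off as the length of \<open>F/P\<close> localised at \<open>P\<close>.\<close>

definition rk :: "'a set \<Rightarrow> nat" where
  "rk P = the_enat (len R F (carrier R - P) P (carrier R))"

end

section \<open>Residue field degrees of an F-finite ring\<close>

locale F_finite_ring = char_p + noetherian_ring R +
  assumes F_fin: "F_finite R"
begin

lemma noeth: "noetherian_ring R" ..

lemma F_fin_gen: "fin_gen_module R F" using F_fin char by (simp add: F_finite_def)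

text \<open>The list is obtained with \<open>S = {\<one>}\<close>, hence independently of any
  localisation. An \<open>a \<in> I\<close> acts on \<open>F\<close> by \<open>a^p\<close>, which
  lies in \<open>I\<close>; so \<open>I\<close> kills \<open>F/I\<close> and is contained in all
  primes of the list.\<close>

lemma F_filt:
  assumes "ideal I R"
  obtains Qs where "pfilt R F I (carrier R) Qs"
    "\<And>Q. Q \<in> set Qs \<Longrightarrow> primeideal Q R" "\<And>Q. Q \<in> set Qs \<Longrightarrow> I \<subseteq> Q"
proof -
  interpret smod R F "{\<one>}" using module_F by (auto simp: smod_def smod_axioms_def)
  obtain Qs where Qs: "pfilt R F I (carrier R) Qs"
    using pfilt_fin_gen_exists[OF noeth F_fin_gen ideal_F_submodule[OF assms]] by auto
  have pw: "a [^] p \<in> I" if "a \<in> I" for a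
    using that ideal.pow_closed[OF assms] p_gt_0 by auto
  have "I \<subseteq> Q" if "Q \<in> set Qs" for Q
    by (rule pfilt_contains[OF Qs that])
       (use assms pw in \<open>auto intro: ideal.I_r_closed ideal.Icarr\<close>)
  with Qs pfilt_prime[OF Qs] that show ?thesis by blast
qed

text \<open>All primes of the list contain \<open>P\<close>, so after localising at \<open>P\<close>
  only the occurrences of \<open>P\<close> itself survive.\<close>

lemma rk_count:
  assumes P: "primeideal P R" and Qs: "pfilt R F P (carrier R) Qs"
    "\<And>Q. Q \<in> set Qs \<Longrightarrow> P \<subseteq> Q"
  shows "len R F (carrier R - P) P (carrier R) = enat (count_list Qs P)" "rk P = count_list Qs P"
proof -
  interpret smod R F "carrier R - P" using module_F P by (rule smodI)
  show "len R F (carrier R - P) P (carrier R) = enat (count_list Qs P)"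
    by (rule pfilt_len_count[OF Qs(1) P refl]) (use Qs(2) in auto)
  then show "rk P = count_list Qs P" by (simp add: rk_def)
qed

lemma len_rk: "primeideal P R \<Longrightarrow> len R F (carrier R - P) P (carrier R) = enat (rk P)"
  by (metis F_filt rk_count primeideal.axioms(1))

lemma rk_pos: assumes P: "primeideal P R" shows "rk P \<ge> 1"
proof -
  interpret smod R F "carrier R - P" using module_F P by (rule smodI)
  interpret P: primeideal P R by fact
  have "\<not> carrier F \<subseteq> sat R F (carrier R - P) P"
  proof
    assume "carrier F \<subseteq> sat R F (carrier R - P) P"
    then have "\<one> \<in> sat R F (carrier R - P) P" by auto
    then obtain s where s: "s \<in> carrier R" "s \<notin> P" "s [^] p \<in> P" by (auto simp: sat_def)
    then show False using P.pow_mem_iff p_gt_0 by auto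
  qed
  then have "1 \<le> len R F (carrier R - P) P (carrier F)"
    using ideal_F_submodule[OF P.is_ideal] P.a_subset carrier_is_submodule by (intro len_pos) auto
  then show ?thesis using len_rk[OF P] by (simp add: one_enat_def)
qed

text \<open>One prime filtration of \<open>F\<close> is fixed and reduced modulo \<open>P\<close>.
  Each factor \<open>R/Q\<close> then contributes at most the length of \<open>R / (Q + P)\<close>
  at \<open>P\<close>, a quotient of \<open>k(P)\<close>; so the number of factors bounds
  \<open>rk\<close> at every prime.\<close>

lemma rk_bounded: "\<exists>N. \<forall>P. primeideal P R \<longrightarrow> rk P \<le> N"
proof -
  obtain Qs where Qs: "pfilt R F {\<zero>} (carrier R) Qs" "\<And>Q. Q \<in> set Qs \<Longrightarrow> primeideal Q R"
    using F_filt[OF zeroideal] by metis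
  have "rk P \<le> length Qs" if P: "primeideal P R" for P
  proof -
    interpret smod R F "carrier R - P" using module_F P by (rule smodI)
    interpret self: smod R "self_module R" "carrier R - P" by (rule smod_self)
    interpret P: primeideal P R by fact
    note PF = ideal_F_submodule[OF P.is_ideal]
    note PS = P.is_ideal[folded ideal_iff_submodule]
    have sm: "a \<odot>\<^bsub>F\<^esub> x \<in> P" if "a \<in> P" "x \<in> carrier F" for a x
      using that P.pow_closed p_gt_0 P.I_r_closed by auto
    have "len R F (carrier R - P) ({\<zero>} <+>\<^bsub>F\<^esub> P) (carrier R <+>\<^bsub>F\<^esub> P)
       \<le> (\<Sum>Q\<leftarrow>Qs. len R (self_module R) (carrier R - P) (Q <+> P) (carrier R))"
      by (rule pfilt_len_sum_le[OF Qs(1) PF P.is_ideal sm])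
    also have "\<dots> \<le> (\<Sum>Q\<leftarrow>Qs. 1)"
    proof (rule sum_list_mono)
      fix Q assume "Q \<in> set Qs"
      then have Q: "submodule Q R (self_module R)" using Qs(2) by (simp add: ideal_iff_submodule primeideal.axioms)
      have "len R (self_module R) (carrier R - P) (Q <+>\<^bsub>self_module R\<^esub> P) (carrier (self_module R))
          \<le> len R (self_module R) (carrier R - P) P (carrier (self_module R))"
        using self.sub_sum[OF Q PS] self.sum_upper2[OF Q PS] PS self.carrier_is_submodule
        by (intro self.len_mono) (auto dest: self.sub_car)
      then show "len R (self_module R) (carrier R - P) (Q <+> P) (carrier R) \<le> 1"
        using len_prime[OF P refl] by simp
    qed
    also have "\<dots> = enat (length Qs)" by (induction Qs) (auto simp: one_enat_def zero_enat_def)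
    also have "{\<zero>} <+>\<^bsub>F\<^esub> P = P"
      using sum_absorb[OF ideal_F_submodule[OF zeroideal] PF] by auto
    also have "carrier R <+>\<^bsub>F\<^esub> P = carrier R"
      using sum_absorb[OF PF carrier_is_submodule] sum_comm[OF PF carrier_is_submodule] P.a_subset by auto
    finally show ?thesis using len_rk[OF P] by simp
  qed
  then show ?thesis by blast
qed

text \<open>A filtration by ideals is also one by submodules of \<open>F\<close>. Multiplication by
  \<open>y\<close> is linear on \<open>F\<close> and identifies the factor belonging to
  \<open>Q\<close> with \<open>F/Q\<close> instead of \<open>R/Q\<close>. At \<open>P\<close> this
  has length \<open>rk P\<close> if \<open>Q = P\<close>, and \<open>0\<close> otherwise.\<close>

lemma len_F_pfilt:
  assumes P: "primeideal P R"
    and "pfilt R (self_module R) I J Qs" "\<And>Q. Q \<in> set Qs \<Longrightarrow> Q \<subseteq> P \<Longrightarrow> Q = P"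
  shows "len R F (carrier R - P) I J = enat (rk P * count_list Qs P)"
  using assms(2,3)
proof (induction)
  case (Nil A)
  interpret smod R F "carrier R - P" using module_F P by (rule smodI)
  have A: "submodule A R F" using Nil ideal_iff_submodule ideal_F_submodule by auto
  then show ?case using len_eq_0[OF A sat_increasing[OF A]] by (simp add: zero_enat_def)
next
  case (Cons A B Qs y)
  interpret smod R F "carrier R - P" using module_F P by (rule smodI)
  interpret self: smod R "self_module R" "carrier R - P" by (rule smod_self)
  have y: "y \<in> carrier R" using Cons.hyps by simp
  interpret \<phi>: smod_hom R F F "carrier R - P" "\<lambda>x. x \<otimes> y"
    using y by unfold_locales (auto simp: lin_maps_def l_distr m_assoc)
  let ?Q = "colon R (self_module R) B y" and ?C = "B <+>\<^bsub>self_module R\<^esub> cyclic R (self_module R) y"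
  note sub = self.pfilt_submodule[OF Cons.hyps(1)]
  have C: "submodule ?C R (self_module R)" using sub y by (intro self.adjoin_submodule) auto
  note subF = sub(1,2)[unfolded ideal_iff_submodule, THEN ideal_F_submodule]
  have CF: "submodule ?C R F" using C[unfolded ideal_iff_submodule, THEN ideal_F_submodule] .
  have BC: "B \<subseteq> ?C" using sub y by (intro self.sum_upper1 self.cyclic_submodule) auto
  have Q: "ideal ?Q R" using Cons.hyps(3) by (simp add: primeideal.axioms)
  have "len R F (carrier R - P) B (B <+>\<^bsub>F\<^esub> (\<lambda>x. x \<otimes> y) ` carrier R) = len R F (carrier R - P) ?Q (carrier R)"
    by (rule \<phi>.len_image_eq[OF ideal_F_submodule[OF Q] ideal_F_submodule[OF oneideal] _ _ subF(2)])
       (auto simp: colon_def)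
  then have eq: "len R F (carrier R - P) B ?C = len R F (carrier R - P) ?Q (carrier R)"
    by (simp add: cyclic_def)
  have "len R F (carrier R - P) ?Q (carrier R) = enat (if ?Q = P then rk P else 0)"
  proof (cases "?Q = P")
    case True then show ?thesis using len_rk[OF P] by simp
  next
    case False
    then have "?Q \<inter> (carrier R - P) \<noteq> {}" using Cons.prems[of ?Q] ideal.Icarr[OF Q] by auto
    then show ?thesis using len_F_meets_S[OF smod_axioms Q] False by (simp add: zero_enat_def)
  qed
  moreover have "len R F (carrier R - P) A ?C = len R F (carrier R - P) A B + len R F (carrier R - P) B ?C"
    by (rule len_add[OF subF CF sub(3) BC])
  ultimately show ?case using eq Cons.IH Cons.prems by (auto simp: algebra_simps)
qed

text \<open>Both lengths count the occurrences of \<open>P\<close> in one and the same filtration of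
  \<open>R/I\<close>, with weight \<open>rk P\<close> in \<open>F\<close> and weight
  \<open>1\<close> in \<open>R\<close>.\<close>

lemma len_F_isolated:
  assumes P: "primeideal P R" and I: "ideal I R" "isolated_at R P I"
  shows "len R F (carrier R - P) I (carrier R) = enat (rk P) * len R (self_module R) (carrier R - P) I (carrier R)"
proof -
  interpret smod R F "carrier R - P" using module_F P by (rule smodI)
  interpret self: smod R "self_module R" "carrier R - P" by (rule smod_self)
  obtain Qs where Qs: "pfilt R (self_module R) I (carrier R) Qs"
    using pfilt_ideal_exists[OF noeth I(1) oneideal] ideal.Icarr[OF I(1)] by auto
  note iso = pfilt_isolated[OF Qs I]
  show ?thesis using self.pfilt_len_count[OF Qs P refl iso] len_F_pfilt[OF P Qs iso] by simp
qed

text \<open>The length of \<open>F / (Q + xF)\<close> at \<open>P\<close> is computed twice. Let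
  \<open>l\<close> be the length of \<open>R / (Q + (x))\<close> at \<open>P\<close>. The prime
  filtration of \<open>F/Q\<close> gives \<open>rk Q * l\<close>. But \<open>x\<close> acts on
  \<open>F\<close> as \<open>x^p\<close>, so \<open>Q + xF\<close> is the ideal
  \<open>Q + (x^p)\<close>, whose colength is \<open>p * l\<close> in \<open>R\<close> and therefore
  \<open>rk P * (p * l)\<close> in \<open>F\<close>. Finally \<open>l \<ge> 1\<close> because
  \<open>x \<in> P\<close>.\<close>

lemma rk_adjacent:
  assumes Q: "primeideal Q R" and P: "primeideal P R" and QP: "Q \<subset> P"
    and adj: "\<And>Q'. primeideal Q' R \<Longrightarrow> Q \<subset> Q' \<Longrightarrow> \<not> Q' \<subset> P"
  shows "rk Q = p * rk P"
proof -
  interpret smod R F "carrier R - P" using module_F P by (rule smodI)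
  interpret self: smod R "self_module R" "carrier R - P" by (rule smod_self)
  interpret P: primeideal P R by fact
  interpret Q: primeideal Q R by fact
  obtain x where x: "x \<in> P" "x \<notin> Q" using QP by auto
  have xR: "x \<in> carrier R" using x by simp
  define J where "J = (\<lambda>z. Q <+>\<^bsub>R\<^esub> cyclic R (self_module R) z)"
  note QS = Q.is_ideal[folded ideal_iff_submodule] and PS = P.is_ideal[folded ideal_iff_submodule]
  have J: "submodule (J z) R (self_module R)" "Q \<subseteq> J z" "z \<in> J z" if "z \<in> carrier R" for z
    using self.adjoin_submodule[OF QS, of z] self.sum_upper1[OF QS self.cyclic_submodule[of z]]
      self.sum_upper2[OF QS self.cyclic_submodule[of z]] self.cyclic_self[of z] that
    by (auto simp: J_def)
  have xp: "x [^] p \<notin> Q" using Q.pow_mem_iff[OF xR] x p_gt_0 by auto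
  \<comment> \<open>With no prime strictly between \<open>Q\<close> and \<open>P\<close>, any
    \<open>z\<close> outside \<open>Q\<close> makes \<open>Q + (z)\<close> isolated at
    \<open>P\<close>.\<close>
  have iso: "isolated_at R P (J z)" if z: "z \<in> carrier R" "z \<notin> Q" for z
    unfolding isolated_at_def
  proof (intro allI impI)
    fix Q' assume Q': "primeideal Q' R" "J z \<subseteq> Q'" "Q' \<subseteq> P"
    then have "Q \<subset> Q'" using J(2,3)[OF z(1)] z(2) by auto
    then show "Q' = P" using adj[OF Q'(1)] Q'(3) by auto
  qed
  have JI: "ideal (J z) R" if "z \<in> carrier R" for z using J(1)[OF that] by (simp add: ideal_iff_submodule)
  obtain l where l: "len R (self_module R) (carrier R - P) (J x) (carrier R) = enat l"
    using len_isolated_finite[OF noeth P refl JI[OF xR] iso[OF xR x(2)]] .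
  have "J x \<subseteq> P"
    using self.sum_least[OF PS _ self.cyclic_least[OF PS x(1)]] QP unfolding J_def by auto
  then have "1 \<le> enat l"
    using self.len_mono[OF PS self.carrier_is_submodule J(1)[OF xR] self.carrier_is_submodule]
      P.a_subset l self.len_prime[OF P refl] by simp
  then have l1: "l \<ge> 1" by (simp add: one_enat_def)
  obtain Qs where Qs: "pfilt R F Q (carrier R) Qs" "\<And>Q'. Q' \<in> set Qs \<Longrightarrow> primeideal Q' R"
    "\<And>Q'. Q' \<in> set Qs \<Longrightarrow> Q \<subseteq> Q'"
    using F_filt[OF Q.is_ideal] by metis
  have "len R F (carrier R - P) (Q <+>\<^bsub>F\<^esub> (\<lambda>m. x \<odot>\<^bsub>F\<^esub> m) ` carrier R) (carrier R) = enat (count_list Qs Q * l)"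
  proof (rule len_scale_quotient[OF P refl Q xR x(2) _ _ l[unfolded J_def] Qs(1)])
    show "Q' = Q \<or> (Q' \<subseteq> P \<longrightarrow> Q' = P)" if "Q' \<in> set Qs" for Q'
      using Qs(2,3)[OF that] adj[of Q'] by auto
    show "m \<in> Q" if "m \<in> carrier F" "x \<odot>\<^bsub>F\<^esub> m \<in> Q" for m
      using that Q.I_prime[of "x [^] p" m] xp xR by auto
  qed
  moreover have "(\<lambda>m. x \<odot>\<^bsub>F\<^esub> m) ` carrier R = cyclic R (self_module R) (x [^] p)"
    using xR by (auto simp: cyclic_def m_comm image_iff)
  ultimately have "len R F (carrier R - P) (J (x [^] p)) (carrier R) = enat (rk Q * l)"
    using rk_count(2)[OF Q Qs(1,3)] by (simp add: J_def)
  moreover have "len R F (carrier R - P) (J (x [^] p)) (carrier R) = enat (rk P) * (of_nat p * enat l)"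
    using len_F_isolated[OF P JI iso, of "x [^] p"] xR xp self.len_power_quotient[OF Q xR x(2), of p] l
    by (simp add: J_def)
  ultimately have "rk Q * l = rk P * (p * l)" by (auto simp: of_nat_eq_enat)
  then show ?thesis using l1 by (auto simp: mult.commute)
qed

end

section \<open>Uniform bounds\<close>

definition prime_chain :: "('a, 'r) ring_scheme \<Rightarrow> nat \<Rightarrow> (nat \<Rightarrow> 'a set) \<Rightarrow> bool" where
  "prime_chain R n f \<longleftrightarrow> (\<forall>i\<le>n. primeideal (f i) R) \<and> (\<forall>i<n. f i \<subset> f (Suc i))"

context F_finite_ring
begin

lemma rk_prime_chain_ex:
  assumes Q: "primeideal Q R" and "primeideal P R" "Q \<subseteq> P"
  shows "\<exists>n f. prime_chain R n f \<and> f 0 = Q \<and> f n = P \<and> rk Q = p ^ n * rk P"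
proof -
  obtain N where N: "\<And>P. primeideal P R \<Longrightarrow> rk P \<le> N" using rk_bounded by blast
  show ?thesis
    using assms(2,3)
  proof (induction "N - rk P" arbitrary: P rule: less_induct)
    case less
    show ?case
    proof (cases "Q = P")
      case True
      then show ?thesis using less
        by (intro exI[of _ 0] exI[of _ "\<lambda>_. P"]) (auto simp: prime_chain_def)
    next
      case False
      \<comment> \<open>Only the ascending chain condition is at hand. It supplies a prime directly
        below \<open>P\<close>, while the descent ends because \<open>N - rk P\<close>
        decreases.\<close>
      define \<Q> where "\<Q> = {Q'. primeideal Q' R \<and> Q \<subseteq> Q' \<and> Q' \<subset> P}"
      have "Q \<in> \<Q>" using False less Q by (auto simp: \<Q>_def)
      then obtain Q' where Q': "Q' \<in> \<Q>"
        and max: "\<And>J. (J, Q') \<in> {(I, J). ideal I R \<and> ideal J R \<and> J \<subset> I} \<Longrightarrow> J \<notin> \<Q>"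
        by (erule wfE_min[OF ideal_wf[OF noeth]])
      have pr: "primeideal Q' R" "Q \<subseteq> Q'" "Q' \<subset> P" using Q' by (auto simp: \<Q>_def)
      have "\<not> J \<subset> P" if "primeideal J R" "Q' \<subset> J" for J
        using max[of J] that pr by (auto simp: \<Q>_def primeideal.axioms)
      then have rk: "rk Q' = p * rk P" using rk_adjacent[OF pr(1) less.prems(1) pr(3)] by blast
      have "2 * rk P \<le> p * rk P" using prime_ge_2_nat[OF p] by simp
      then have "rk P < rk Q'" using rk rk_pos[OF less.prems(1)] by linarith
      then have "N - rk Q' < N - rk P" using N[OF pr(1)] by linarith
      then obtain n f where f: "prime_chain R n f" "f 0 = Q" "f n = Q'" "rk Q = p ^ n * rk Q'"
        using less.hyps pr by blast
      then have "prime_chain R (Suc n) (f(Suc n := P))"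
        using pr less.prems by (auto simp: prime_chain_def le_Suc_eq less_Suc_eq)
      then show ?thesis using f rk by (intro exI[of _ "Suc n"] exI[of _ "f(Suc n := P)"]) auto
    qed
  qed
qed

text \<open>The chain need not be saturated: each of its links is refined to a chain of length
  \<open>m \<ge> 1\<close>, which costs a factor \<open>p ^ m \<ge> p\<close>.\<close>

lemma rk_prime_chain_le: "prime_chain R n f \<Longrightarrow> p ^ n * rk (f n) \<le> rk (f 0)"
proof (induction n)
  case (Suc n)
  then have c: "prime_chain R n f" "primeideal (f (Suc n)) R" "primeideal (f n) R" "f n \<subset> f (Suc n)"
    by (auto simp: prime_chain_def)
  then obtain m g where g: "prime_chain R m g" "g 0 = f n" "g m = f (Suc n)" "rk (f n) = p ^ m * rk (f (Suc n))"
    using rk_prime_chain_ex by blast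
  then have "m \<noteq> 0" using c by (metis psubset_eq)
  then have "p * rk (f (Suc n)) \<le> rk (f n)"
    using g(4) p_gt_0 by (cases m) auto
  then have "p ^ n * (p * rk (f (Suc n))) \<le> p ^ n * rk (f n)" by simp
  also have "\<dots> \<le> rk (f 0)" using Suc c by simp
  finally show ?case by (simp add: algebra_simps)
qed simp

lemma prime_chain_bounded: "\<exists>N. \<forall>n f. prime_chain R n f \<longrightarrow> n \<le> N"
proof -
  obtain N where N: "\<And>P. primeideal P R \<Longrightarrow> rk P \<le> N" using rk_bounded by blast
  have "n \<le> N" if c: "prime_chain R n f" for n f
  proof -
    have "primeideal (f 0) R" "primeideal (f n) R" using c by (auto simp: prime_chain_def)
    then have "p ^ n \<le> N" using rk_prime_chain_le[OF c] rk_pos[of "f n"] N[of "f 0"]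
      by (metis le_trans mult.right_neutral mult_le_mono2)
    moreover have "n < p ^ n" using prime_gt_1_nat[OF p] by (intro power_gt_expt) simp
    ultimately show ?thesis by simp
  qed
  then show ?thesis by blast
qed

section \<open>Frobenius powers and Hilbert-Kunz functions\<close>

lemma frobenius_power_ideal: "I \<subseteq> carrier R \<Longrightarrow> ideal (frobenius_power R I q) R"
  unfolding frobenius_power_def by (intro genideal_ideal) auto

lemma frobenius_power_mem: "I \<subseteq> carrier R \<Longrightarrow> x \<in> I \<Longrightarrow> x [^] q \<in> frobenius_power R I q"
  unfolding frobenius_power_def using genideal_self'[of "\<one>"] genideal_self[of "(\<lambda>x. x [^] q) ` I"] by auto

lemma frobenius_power_least:
  "ideal J R \<Longrightarrow> (\<And>x. x \<in> I \<Longrightarrow> x [^] q \<in> J) \<Longrightarrow> frobenius_power R I q \<subseteq> J"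
  unfolding frobenius_power_def by (intro genideal_minimal) auto

lemma frobenius_power_subset: "ideal I R \<Longrightarrow> q > 0 \<Longrightarrow> frobenius_power R I q \<subseteq> I"
  by (rule frobenius_power_least) (auto intro: ideal.pow_closed)

text \<open>The Hilbert--Kunz function of \<open>(R/Q)\<^sub>P\<close>.\<close>

definition hk :: "'a set \<Rightarrow> 'a set \<Rightarrow> nat \<Rightarrow> enat" where
  "hk Q P e = len R (self_module R) (carrier R - P) (Q <+>\<^bsub>R\<^esub> frobenius_power R P (p ^ e)) (carrier R)"

lemma sum_frobenius_power_ideal:
  assumes "ideal Q R" "primeideal P R"
  shows "ideal (Q <+>\<^bsub>R\<^esub> frobenius_power R P q) R"
  by (rule add_ideals[OF assms(1) frobenius_power_ideal])
     (use assms(2) in \<open>auto dest: ideal.Icarr[OF primeideal.axioms(1)]\<close>)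

lemma ideals_subset_sum:
  assumes "ideal I R" "ideal J R" shows "I \<subseteq> I <+>\<^bsub>R\<^esub> J" "J \<subseteq> I <+>\<^bsub>R\<^esub> J"
proof -
  interpret smod R "self_module R" "{\<one>}" using module_self_module by (auto simp: smod_def smod_axioms_def)
  show "I \<subseteq> I <+>\<^bsub>R\<^esub> J" "J \<subseteq> I <+>\<^bsub>R\<^esub> J"
    using sum_upper1[of I J] sum_upper2[of I J] assms by (auto simp: ideal_iff_submodule)
qed

lemma isolated_frobenius_power:
  assumes "ideal Q R" and P: "primeideal P R"
  shows "isolated_at R P (Q <+>\<^bsub>R\<^esub> frobenius_power R P (p ^ e))"
  unfolding isolated_at_def
proof (intro allI impI)
  interpret P: primeideal P R by fact
  fix Q' assume Q': "primeideal Q' R" "Q <+>\<^bsub>R\<^esub> frobenius_power R P (p ^ e) \<subseteq> Q'" "Q' \<subseteq> P"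
  have "P \<subseteq> Q'"
  proof
    fix x assume x: "x \<in> P"
    then have "x [^] (p ^ e) \<in> Q'"
      using Q'(2) ideals_subset_sum(2)[OF assms(1) frobenius_power_ideal[OF P.a_subset]]
        frobenius_power_mem[OF P.a_subset x] by blast
    then show "x \<in> Q'" using primeideal.pow_mem_iff[OF Q'(1), of x "p ^ e"] x p_gt_0 by auto
  qed
  then show "Q' = P" using Q' by auto
qed

lemma hk_finite:
  assumes "ideal Q R" "primeideal P R"
  shows "\<exists>n. hk Q P e = enat n"
proof -
  interpret smod R F "carrier R - P" using module_F assms(2) by (rule smodI)
  show ?thesis unfolding hk_def
    by (rule len_isolated_finite[OF noeth assms(2) refl sum_frobenius_power_ideal[OF assms]
          isolated_frobenius_power[OF assms]]) blast
qed

lemma hk_eq_0: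
  assumes "ideal Q R" "primeideal P R" "\<not> Q \<subseteq> P"
  shows "hk Q P e = 0"
proof -
  interpret smod R F "carrier R - P" using module_F assms(2) by (rule smodI)
  interpret P: primeideal P R by fact
  show ?thesis unfolding hk_def
    using assms(3) ideals_subset_sum(1)[OF assms(1) frobenius_power_ideal[OF P.a_subset]] ideal.Icarr[OF assms(1)]
    by (intro len_ideal_meets_S sum_frobenius_power_ideal[OF assms(1,2)]) blast
qed

lemma sum_eq_right:
  assumes "ideal I R" "ideal J R" "I \<subseteq> J" shows "I <+>\<^bsub>R\<^esub> J = J" "J <+>\<^bsub>R\<^esub> I = J"
proof -
  interpret smod R "self_module R" "{\<one>}" using module_self_module by (auto simp: smod_def smod_axioms_def)
  show "I <+>\<^bsub>R\<^esub> J = J" "J <+>\<^bsub>R\<^esub> I = J"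
    using sum_absorb[of I J] sum_comm[of I J] assms by (auto simp: ideal_iff_submodule)
qed

lemma hk_self: assumes P: "primeideal P R" shows "hk P P e = 1"
proof -
  interpret smod R F "carrier R - P" using module_F P by (rule smodI)
  interpret P: primeideal P R by fact
  show ?thesis unfolding hk_def
    using sum_eq_right(2)[OF frobenius_power_ideal[OF P.a_subset] P.is_ideal frobenius_power_subset[OF P.is_ideal]]
      len_prime[OF P refl] p_gt_0 by simp
qed

lemma hk_0:
  assumes Q: "ideal Q R" and P: "primeideal P R" and QP: "Q \<subseteq> P"
  shows "hk Q P 0 = 1"
proof -
  interpret smod R F "carrier R - P" using module_F P by (rule smodI)
  interpret P: primeideal P R by fact
  have "P \<subseteq> frobenius_power R P 1" using frobenius_power_mem[OF P.a_subset, of _ 1] by auto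
  then have "frobenius_power R P 1 = P" using frobenius_power_subset[OF P.is_ideal, of 1] by auto
  then show ?thesis unfolding hk_def using sum_eq_right(1)[OF Q P.is_ideal QP] len_prime[OF P refl] by simp
qed

text \<open>The length of \<open>F / (Q + K)\<close> at \<open>P\<close>, where \<open>K\<close> is
  the next Frobenius power of \<open>P\<close>, is seen in two ways. As the colength of an ideal it
  is \<open>rk P\<close> times the Hilbert-Kunz value. As a quotient of the filtered module
  \<open>F/Q\<close> it is at most the sum on the right, since the preceding Frobenius power
  \<open>?q\<close> maps \<open>F\<close> into \<open>K\<close>.\<close>

lemma hk_Suc_le:
  assumes Q: "primeideal Q R" and P: "primeideal P R" and Qs: "pfilt R F Q (carrier R) Qs"
  shows "enat (rk P) * hk Q P (Suc e) \<le> (\<Sum>Q'\<leftarrow>Qs. hk Q' P e)"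
proof -
  interpret smod R F "carrier R - P" using module_F P by (rule smodI)
  interpret P: primeideal P R by fact
  have QI: "ideal Q R" using Q by (simp add: primeideal.axioms)
  let ?K = "frobenius_power R P (p ^ Suc e)" and ?q = "frobenius_power R P (p ^ e)"
  have K: "ideal ?K R" "ideal ?q R" using P.a_subset by (auto intro: frobenius_power_ideal)
  \<comment> \<open>The elements whose \<open>p\<close>-th power lies in \<open>?K\<close> form an
    ideal, the preimage of \<open>?K\<close> under the linear map from \<open>R\<close> to
    \<open>F\<close> sending \<open>1\<close> to \<open>1\<close>. So it is enough to test the
    generators of \<open>?q\<close>.\<close>
  have "?q \<subseteq> {a \<in> carrier R. a [^] p \<in> ?K}"
  proof (rule frobenius_power_least)
    show "ideal {a \<in> carrier R. a [^] p \<in> ?K} R"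
    proof -
      interpret F: smod_hom R "self_module R" F "carrier R - P" "\<lambda>r. r \<odot>\<^bsub>F\<^esub> \<one>"
        by (rule smod_hom_mult) simp
      have "submodule {r \<in> carrier R. r [^] p \<otimes> \<one> \<in> ?K} R (self_module R)"
        using F.preimage_submodule[OF F.M.carrier_is_submodule ideal_F_submodule[OF K(1)]] by simp
      moreover have "{r \<in> carrier R. r [^] p \<otimes> \<one> \<in> ?K} = {a \<in> carrier R. a [^] p \<in> ?K}" by auto
      ultimately show ?thesis by (simp add: ideal_iff_submodule)
    qed
    fix x assume x: "x \<in> P"
    then have "(x [^] (p ^ e)) [^] p = x [^] (p ^ Suc e)" by (simp add: nat_pow_pow mult.commute)
    then show "x [^] (p ^ e) \<in> {a \<in> carrier R. a [^] p \<in> ?K}"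
      using frobenius_power_mem[OF P.a_subset x, of "p ^ Suc e"] x by auto
  qed
  then have sm: "a \<odot>\<^bsub>F\<^esub> x \<in> ?K" if "a \<in> ?q" "x \<in> carrier F" for a x
    using that ideal.I_r_closed[OF K(1)] by auto
  have "len R F (carrier R - P) (Q <+>\<^bsub>F\<^esub> ?K) (carrier R <+>\<^bsub>F\<^esub> ?K)
     \<le> (\<Sum>Q'\<leftarrow>Qs. len R (self_module R) (carrier R - P) (Q' <+>\<^bsub>R\<^esub> ?q) (carrier R))"
    by (rule pfilt_len_sum_le[OF Qs ideal_F_submodule[OF K(1)] K(2) sm])
  moreover have "carrier R <+>\<^bsub>F\<^esub> ?K = carrier R"
    using sum_eq_right(2)[OF K(1) oneideal] ideal.Icarr[OF K(1)] by auto
  moreover have "len R F (carrier R - P) (Q <+>\<^bsub>R\<^esub> ?K) (carrier R) = enat (rk P) * hk Q P (Suc e)"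
    unfolding hk_def
    by (rule len_F_isolated[OF P sum_frobenius_power_ideal[OF QI P] isolated_frobenius_power[OF QI P]])
  ultimately show ?thesis by (simp add: hk_def)
qed

lemma recursion_bound:
  fixes f :: "nat \<Rightarrow> real"
  assumes "f 0 \<le> 1" "C \<ge> 0" "h \<ge> 1"
    and rec: "\<And>e. f (Suc e) \<le> real p ^ h * f e + C * (real p ^ e) ^ (h - 1)"
  shows "f e \<le> (1 + 2 * C) * (real p ^ e) ^ h"
proof -
  obtain k where h: "h = Suc k" using assms(3) by (cases h) auto
  have p2: "real p \<ge> 2" using prime_ge_2_nat[OF p] by simp
  \<comment> \<open>the subtracted term absorbs the error \<open>C q\<^bsup>h-1\<^esup>\<close> of the recursion\<close>
  have "f e \<le> (1 + 2 * C) * (real p ^ e) ^ h - 2 * C * (real p ^ e) ^ k"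
  proof (induction e)
    case 0
    \<comment> \<open>For \<open>q = 1\<close> the bound is exactly \<open>1\<close>; this forces
      the leading coefficient \<open>1 + 2 * C\<close>.\<close>
    then show ?case using assms by simp
  next
    case (Suc e)
    let ?q = "real p ^ e"
    \<comment> \<open>The induction closes once \<open>C \<le> 2 * C * (p ^ h - p ^ k)\<close>; this
      follows from \<open>2 * p ^ k \<le> p ^ h\<close> and \<open>1 \<le> p ^ k\<close>.\<close>
    have a: "2 * real p ^ k \<le> real p ^ h" using mult_right_mono[OF p2, of "real p ^ k"] by (simp add: h)
    have b: "1 \<le> real p ^ k" using p2 by (intro one_le_power) simp
    have "f (Suc e) \<le> real p ^ h * ((1 + 2 * C) * ?q ^ h - 2 * C * ?q ^ k) + C * ?q ^ k"
      using rec[of e] mult_left_mono[OF Suc, of "real p ^ h"] h by simp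
    also have "\<dots> = (1 + 2 * C) * (real p * ?q) ^ h - C * ?q ^ k * (2 * real p ^ h - 1)"
      by (simp add: power_mult_distrib algebra_simps)
    also have "\<dots> \<le> (1 + 2 * C) * (real p * ?q) ^ h - C * ?q ^ k * (2 * real p ^ k)"
      using a b assms(2) by (intro diff_left_mono mult_left_mono) auto
    also have "\<dots> = (1 + 2 * C) * (real p ^ Suc e) ^ h - 2 * C * (real p ^ Suc e) ^ k"
      by (simp add: power_mult_distrib algebra_simps)
    finally show ?case .
  qed
  also have "\<dots> \<le> (1 + 2 * C) * (real p ^ e) ^ h" using assms(2) by simp
  finally show ?thesis .
qed

definition hkr :: "'a set \<Rightarrow> 'a set \<Rightarrow> nat \<Rightarrow> real" where
  "hkr Q P e = real (the_enat (hk Q P e))"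

lemma hk_hkr: "ideal Q R \<Longrightarrow> primeideal P R \<Longrightarrow> \<exists>n. hk Q P e = enat n \<and> hkr Q P e = real n"
  using hk_finite[of Q P e] by (auto simp: hkr_def)

lemma sum_list_hk:
  assumes "\<And>Q. Q \<in> set Qs \<Longrightarrow> ideal Q R" "primeideal P R"
  shows "\<exists>n. (\<Sum>Q\<leftarrow>Qs. hk Q P e) = enat n \<and> (\<Sum>Q\<leftarrow>Qs. hkr Q P e) = real n"
  using assms(1)
proof (induction Qs)
  case (Cons Q Qs)
  then obtain n where "(\<Sum>Q\<leftarrow>Qs. hk Q P e) = enat n" "(\<Sum>Q\<leftarrow>Qs. hkr Q P e) = real n" by auto
  moreover obtain m where "hk Q P e = enat m" "hkr Q P e = real m"
    using hk_hkr[OF _ assms(2)] Cons.prems by (metis list.set_intros(1))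
  ultimately show ?case by simp
qed (simp add: zero_enat_def)

lemma sum_list_split_count:
  fixes g :: "'x \<Rightarrow> real"
  shows "(\<Sum>x\<leftarrow>xs. g x) = real (count_list xs a) * g a + (\<Sum>x\<leftarrow>filter (\<lambda>x. x \<noteq> a) xs. g x)"
  by (induction xs) (auto simp: algebra_simps)

text \<open>The exponent is specified by \<open>rk Q = p ^ h * rk P\<close> and not as a height:
  this equation determines \<open>h\<close>, and exponents add up along
  \<open>Q \<subseteq> Q' \<subseteq> P\<close> without any comparison of saturated chains. The list
  \<open>Qs\<close> depends on \<open>Q\<close> alone, which makes the constant independent of
  \<open>P\<close>.\<close>

theorem hk_uniform_bound:
  assumes "primeideal Q R"
  shows "\<exists>C\<ge>0. \<forall>P e h. primeideal P R \<longrightarrow> Q \<subseteq> P \<longrightarrow> rk Q = p ^ h * rk P \<longrightarrow>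
    hkr Q P e \<le> C * (real p ^ e) ^ h"
  using assms
proof (induction Q rule: wf_induct_rule[OF ideal_wf[OF noeth]])
  case (1 Q)
  have QI: "ideal Q R" using 1 by (simp add: primeideal.axioms)
  obtain Qs where Qs: "pfilt R F Q (carrier R) Qs" "\<And>Q'. Q' \<in> set Qs \<Longrightarrow> primeideal Q' R"
    "\<And>Q'. Q' \<in> set Qs \<Longrightarrow> Q \<subseteq> Q'"
    using F_filt[OF QI] by metis
  have QsI: "\<And>Q'. Q' \<in> set Qs \<Longrightarrow> ideal Q' R" using Qs(2) by (simp add: primeideal.axioms)
  have "\<forall>Q'\<in>set (filter (\<lambda>Q'. Q' \<noteq> Q) Qs). \<exists>C\<ge>0. \<forall>P e h. primeideal P R \<longrightarrow> Q' \<subseteq> P \<longrightarrow> rk Q' = p ^ h * rk P \<longrightarrow>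
    hkr Q' P e \<le> C * (real p ^ e) ^ h"
  proof
    fix Q' assume "Q' \<in> set (filter (\<lambda>Q'. Q' \<noteq> Q) Qs)"
    then have "primeideal Q' R" "Q \<subset> Q'" using Qs by auto
    then show "\<exists>C\<ge>0. \<forall>P e h. primeideal P R \<longrightarrow> Q' \<subseteq> P \<longrightarrow> rk Q' = p ^ h * rk P \<longrightarrow>
        hkr Q' P e \<le> C * (real p ^ e) ^ h"
      using 1(1)[of Q'] QI by (auto simp: primeideal.axioms)
  qed
  then obtain c where c: "\<And>Q'. Q' \<in> set (filter (\<lambda>Q'. Q' \<noteq> Q) Qs) \<Longrightarrow> c Q' \<ge> 0 \<and>
     (\<forall>P e h. primeideal P R \<longrightarrow> Q' \<subseteq> P \<longrightarrow> rk Q' = p ^ h * rk P \<longrightarrow> hkr Q' P e \<le> c Q' * (real p ^ e) ^ h)"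
    by metis
  define C where "C = (\<Sum>Q'\<leftarrow>filter (\<lambda>Q'. Q' \<noteq> Q) Qs. c Q')"
  have C0: "C \<ge> 0" unfolding C_def using c by (intro sum_list_nonneg) auto
  have "hkr Q P e \<le> (1 + 2 * C) * (real p ^ e) ^ h"
    if P: "primeideal P R" and QP: "Q \<subseteq> P" and h: "rk Q = p ^ h * rk P" for P e h
  proof (cases "Q = P")
    case True
    then have "p ^ h = 1" using h rk_pos[OF P] by auto
    then have "h = 0" using one_less_power[OF prime_gt_1_nat[OF p], of h] by (metis less_irrefl neq0_conv)
    then show ?thesis using True hk_self[OF P] C0 by (simp add: hkr_def one_enat_def)
  next
    case False
    \<comment> \<open>A connecting chain of length \<open>0\<close> would give \<open>Q = P\<close>.
      Hence \<open>h \<ge> 1\<close>, and the truncated difference \<open>h - 1\<close> is a true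
      one.\<close>
    obtain n f where nf: "prime_chain R n f" "f 0 = Q" "f n = P" "rk Q = p ^ n * rk P"
      using rk_prime_chain_ex[OF 1(2) P QP] by blast
    then have "n \<noteq> 0" using False by (metis)
    moreover have "n = h" using nf(4) h rk_pos[OF P] prime_gt_1_nat[OF p] by (auto simp: power_inject_exp)
    ultimately have h1: "h \<ge> 1" by simp
    show ?thesis
    proof (rule recursion_bound[OF _ C0 h1])
      show "hkr Q P 0 \<le> 1" using hk_0[OF QI P QP] by (simp add: hkr_def one_enat_def)
      fix e
      obtain n where n: "(\<Sum>Q\<leftarrow>Qs. hk Q P e) = enat n" "(\<Sum>Q\<leftarrow>Qs. hkr Q P e) = real n"
        using sum_list_hk[OF QsI P] by blast
      obtain m where m: "hk Q P (Suc e) = enat m" "hkr Q P (Suc e) = real m" using hk_hkr[OF QI P] by blast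
      have "enat (rk P) * hk Q P (Suc e) \<le> (\<Sum>Q'\<leftarrow>Qs. hk Q' P e)" using hk_Suc_le[OF 1(2) P Qs(1)] .
      then have "rk P * m \<le> n" using n m by simp
      then have "real (rk P) * hkr Q P (Suc e) \<le> (\<Sum>Q\<leftarrow>Qs. hkr Q P e)"
        using n m by (metis of_nat_le_iff of_nat_mult)
      \<comment> \<open>The occurrences of \<open>Q\<close> in the list number \<open>rk Q\<close>,
        which is \<open>p ^ h * rk P\<close>; they form the main term of the recursion.\<close>
      also have "\<dots> = real (rk Q) * hkr Q P e + (\<Sum>Q'\<leftarrow>filter (\<lambda>Q'. Q' \<noteq> Q) Qs. hkr Q' P e)"
        using sum_list_split_count[of "\<lambda>Q. hkr Q P e" Qs Q] rk_count(2)[OF 1(2) Qs(1,3)] by simp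
      also have "(\<Sum>Q'\<leftarrow>filter (\<lambda>Q'. Q' \<noteq> Q) Qs. hkr Q' P e)
          \<le> (\<Sum>Q'\<leftarrow>filter (\<lambda>Q'. Q' \<noteq> Q) Qs. c Q' * (real p ^ e) ^ (h - 1))"
      proof (rule sum_list_mono)
        fix Q' assume Q': "Q' \<in> set (filter (\<lambda>Q'. Q' \<noteq> Q) Qs)"
        then have Q'': "primeideal Q' R" "Q \<subset> Q'" using Qs by auto
        have q1: "real p ^ e \<ge> 1" using p_gt_0 by (intro one_le_power) simp
        show "hkr Q' P e \<le> c Q' * (real p ^ e) ^ (h - 1)"
        proof (cases "Q' \<subseteq> P")
          case False
          then have "hkr Q' P e = 0" using hk_eq_0[OF _ P] Q'' by (simp add: hkr_def primeideal.axioms zero_enat_def)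
          then show ?thesis using c[OF Q'] by simp
        next
          case True
          obtain j g where j: "prime_chain R j g" "g 0 = Q'" "g j = P" "rk Q' = p ^ j * rk P"
            using rk_prime_chain_ex[OF Q''(1) P True] by blast
          obtain i g' where i: "prime_chain R i g'" "g' 0 = Q" "g' i = Q'" "rk Q = p ^ i * rk Q'"
            using rk_prime_chain_ex[OF 1(2) Q''(1)] Q'' by blast
          have "i \<noteq> 0" using i Q'' by (metis psubset_eq)
          \<comment> \<open>The ranks along \<open>Q \<subset> Q' \<subseteq> P\<close> multiply, so
            the exponent \<open>j\<close> of \<open>Q'\<close> falls short of \<open>h\<close> by
            \<open>i \<ge> 1\<close>.\<close>
          have "p ^ h * rk P = p ^ (i + j) * rk P" using h i(4) j(4) by (metis mult.assoc power_add)
          then have "h = i + j" using rk_pos[OF P] prime_gt_1_nat[OF p] by (auto simp: power_inject_exp)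
          then have "j \<le> h - 1" using \<open>i \<noteq> 0\<close> by simp
          then have "(real p ^ e) ^ j \<le> (real p ^ e) ^ (h - 1)" using q1 by (intro power_increasing)
          moreover have "hkr Q' P e \<le> c Q' * (real p ^ e) ^ j" using c[OF Q'] P True j(4) by blast
          ultimately show ?thesis using c[OF Q'] by (meson mult_left_mono order_trans)
        qed
      qed
      also have "\<dots> = C * (real p ^ e) ^ (h - 1)" by (simp add: C_def sum_list_mult_const)
      finally have "real (rk P) * hkr Q P (Suc e)
          \<le> real (rk P) * (real p ^ h * hkr Q P e) + C * (real p ^ e) ^ (h - 1)"
        using h by (simp add: algebra_simps)
      \<comment> \<open>The error term is enlarged by the factor \<open>rk P \<ge> 1\<close>, so
        that \<open>rk P\<close> can be divided out and leaves a constant free of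
        \<open>P\<close>.\<close>
      also have "\<dots> \<le> real (rk P) * (real p ^ h * hkr Q P e) + real (rk P) * (C * (real p ^ e) ^ (h - 1))"
        using mult_right_mono[of 1 "real (rk P)" "C * (real p ^ e) ^ (h - 1)"] rk_pos[OF P] C0 by simp
      also have "\<dots> = real (rk P) * (real p ^ h * hkr Q P e + C * (real p ^ e) ^ (h - 1))"
        by (simp add: algebra_simps)
      finally show "hkr Q P (Suc e) \<le> real p ^ h * hkr Q P e + C * (real p ^ e) ^ (h - 1)"
        using rk_pos[OF P] by simp
    qed
  qed
  then show ?case using C0 by (intro exI[of _ "1 + 2 * C"]) auto
qed

end

section \<open>Products of Frobenius powers with a module\<close>

lemma (in smod) submodule_span_submodule:
  assumes "A \<subseteq> carrier M" shows "submodule (submodule_span R M A) R M"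
  unfolding submodule_span_def
proof (rule submodI)
  show "\<Inter> {N. submodule N R M \<and> A \<subseteq> N} \<subseteq> carrier M" using assms carrier_is_submodule by blast
qed (auto intro: sub_zero sub_add sub_smult)

lemma submodule_span_least: "submodule N R M \<Longrightarrow> A \<subseteq> N \<Longrightarrow> submodule_span R M A \<subseteq> N"
  unfolding submodule_span_def by blast

lemma submodule_span_superset: "A \<subseteq> submodule_span R M A"
  unfolding submodule_span_def by blast

lemma ideal_times_module_mem:
  "a \<in> I \<Longrightarrow> x \<in> carrier M \<Longrightarrow> a \<odot>\<^bsub>M\<^esub> x \<in> ideal_times_module R I M"
  unfolding ideal_times_module_def
  by (rule subsetD[OF submodule_span_superset], rule CollectI, intro exI conjI, rule refl)

definition frob_times ::
    "('a, 'r) ring_scheme \<Rightarrow> ('a, 'm, 'k) module_scheme \<Rightarrow> nat \<Rightarrow> 'a set \<Rightarrow> 'm set" where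
  "frob_times R M q I = ideal_times_module R (frobenius_power R I q) M"

context F_finite_ring
begin

context
  fixes M :: "('a, 'm, 'k) module_scheme" and S
  assumes smod: "smod R M S"
begin

interpretation smod R M S by (rule smod)

lemma frob_times_submodule: assumes "I \<subseteq> carrier R" shows "submodule (frob_times R M q I) R M"
  unfolding frob_times_def ideal_times_module_def
  using ideal.Icarr[OF frobenius_power_ideal[OF assms]] by (intro submodule_span_submodule) auto

lemma frob_times_mem:
  assumes "I \<subseteq> carrier R" "x \<in> I" "m \<in> carrier M"
  shows "(x [^] q) \<odot>\<^bsub>M\<^esub> m \<in> frob_times R M q I"
  unfolding frob_times_def by (intro ideal_times_module_mem frobenius_power_mem assms)

text \<open>The ring elements that map all of \<open>M\<close> into \<open>N\<close> form an ideal,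
  so testing \<open>q\<close>-th powers of elements of \<open>I\<close> is enough.\<close>

lemma frob_times_least:
  assumes N: "submodule N R M" and "I \<subseteq> carrier R"
    and mem: "\<And>x m. x \<in> I \<Longrightarrow> m \<in> carrier M \<Longrightarrow> (x [^] q) \<odot>\<^bsub>M\<^esub> m \<in> N"
  shows "frob_times R M q I \<subseteq> N"
  unfolding frob_times_def ideal_times_module_def
proof (rule submodule_span_least[OF N])
  have "ideal {a \<in> carrier R. \<forall>m\<in>carrier M. a \<odot>\<^bsub>M\<^esub> m \<in> N} R"
    unfolding ideal_iff_submodule[symmetric]
  proof -
    interpret self: smod R "self_module R" S by (rule smod_self)
    show "submodule {a \<in> carrier R. \<forall>m\<in>carrier M. a \<odot>\<^bsub>M\<^esub> m \<in> N} R (self_module R)"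
      by (rule self.submodI)
         (simp_all add: subset_iff smult_l_distr smult_assoc1 sub_zero[OF N] sub_add[OF N] sub_smult[OF N])
  qed
  then have "frobenius_power R I q \<subseteq> {a \<in> carrier R. \<forall>m\<in>carrier M. a \<odot>\<^bsub>M\<^esub> m \<in> N}"
    using assms(2) mem by (intro frobenius_power_least) auto
  then show "{a \<odot>\<^bsub>M\<^esub> x |a x. a \<in> frobenius_power R I q \<and> x \<in> carrier M} \<subseteq> N" by auto
qed

lemma frob_times_mono:
  assumes "I \<subseteq> J" "J \<subseteq> carrier R" shows "frob_times R M q I \<subseteq> frob_times R M q J"
  using assms frob_times_mem[OF assms(2)] by (intro frob_times_least frob_times_submodule) auto

end

text \<open>Let \<open>C = B + R y\<close> be a step with prime \<open>Q\<close>. Additivity of the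
  Frobenius map gives \<open>C^[q] M \<subseteq> B^[q] M + y^q M\<close>, and multiplication by
  \<open>y^q\<close> carries \<open>Q^[q] M\<close> into \<open>B^[q] M\<close>. So the factor is
  bounded by the length of \<open>M / Q^[q] M\<close>, which vanishes at \<open>P\<close> unless
  \<open>Q = P\<close>. The length of \<open>M / P^[q] M\<close> is thus counted once per residue
  field.\<close>

lemma len_frob_times_le:
  assumes M: "module R M" and P: "primeideal P R"
    and "pfilt R (self_module R) A B Qs" "\<And>Q. Q \<in> set Qs \<Longrightarrow> Q \<subseteq> P \<Longrightarrow> Q = P"
  shows "len R M (carrier R - P) (frob_times R M (p ^ e) A) (frob_times R M (p ^ e) B)
    \<le> enat (count_list Qs P) * len R M (carrier R - P) (frob_times R M (p ^ e) P) (carrier M)"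
  using assms(3,4)
proof (induction)
  case (Nil A)
  note smod = smodI[OF M P]
  interpret smod R M "carrier R - P" by (rule smod)
  have "A \<subseteq> carrier R" using Nil(1) ideal.Icarr[of A R] by (auto simp: ideal_iff_submodule)
  note T = frob_times_submodule[OF smod this]
  show ?case using len_eq_0[OF T sat_increasing[OF T]] by simp
next
  case (Cons A B Qs y)
  note smod = smodI[OF M P]
  interpret smod R M "carrier R - P" by (rule smod)
  interpret self: smod R "self_module R" "carrier R - P" by (rule smod_self)
  have y: "y \<in> carrier R" using Cons.hyps by simp
  let ?q = "p ^ e"
  let ?T = "frob_times R M ?q" and ?l = "len R M (carrier R - P)"
  interpret \<phi>: smod_hom R M M "carrier R - P" "\<lambda>m. (y [^] ?q) \<odot>\<^bsub>M\<^esub> m"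
    using y by (intro smod_hom_scale) simp
  let ?Q = "colon R (self_module R) B y" and ?C = "B <+>\<^bsub>self_module R\<^esub> cyclic R (self_module R) y"
  note sub = self.pfilt_submodule[OF Cons.hyps(1)]
  have C: "submodule ?C R (self_module R)" using sub y by (intro self.adjoin_submodule) auto
  have BC: "B \<subseteq> ?C" using sub y by (intro self.sum_upper1 self.cyclic_submodule) auto
  have car: "A \<subseteq> carrier R" "B \<subseteq> carrier R" "?C \<subseteq> carrier R" "?Q \<subseteq> carrier R" "P \<subseteq> carrier R"
    using self.sub_car[OF sub(1)] self.sub_car[OF sub(2)] self.sub_car[OF C]
      ideal.Icarr[OF primeideal.axioms(1)[OF P]] by (auto simp: colon_def)
  note T = frob_times_submodule[OF smod car(1)] frob_times_submodule[OF smod car(2)]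
    frob_times_submodule[OF smod car(3)] frob_times_submodule[OF smod car(4)] frob_times_submodule[OF smod car(5)]
  have QTB: "(\<lambda>m. (y [^] ?q) \<odot>\<^bsub>M\<^esub> m) ` ?T ?Q \<subseteq> ?T B"
  proof -
    have "?T ?Q \<subseteq> {m \<in> carrier M. (y [^] ?q) \<odot>\<^bsub>M\<^esub> m \<in> ?T B}"
    proof (rule frob_times_least[OF smod \<phi>.preimage_submodule[OF carrier_is_submodule T(2)] car(4)])
      fix x m assume x: "x \<in> ?Q" "m \<in> carrier M"
      then have xr: "x \<in> carrier R" "x \<otimes> y \<in> B" by (auto simp: colon_def)
      have "(y [^] ?q) \<odot>\<^bsub>M\<^esub> ((x [^] ?q) \<odot>\<^bsub>M\<^esub> m) = ((x \<otimes> y) [^] ?q) \<odot>\<^bsub>M\<^esub> m"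
        using xr x y by (simp add: smult_assoc1[symmetric] nat_pow_distrib m_comm)
      also have "\<dots> \<in> ?T B" using frob_times_mem[OF smod car(2)] xr x by blast
      finally show "(x [^] ?q) \<odot>\<^bsub>M\<^esub> m \<in> {m \<in> carrier M. (y [^] ?q) \<odot>\<^bsub>M\<^esub> m \<in> ?T B}" using x xr by simp
    qed
    then show ?thesis by auto
  qed
  have "?l (?T B) (?T ?C) \<le> ?l (?T B) (?T B <+>\<^bsub>M\<^esub> (\<lambda>m. (y [^] ?q) \<odot>\<^bsub>M\<^esub> m) ` carrier M)"
  proof (rule len_mono[OF T(2,3) T(2)])
    have im: "submodule ((\<lambda>m. (y [^] ?q) \<odot>\<^bsub>M\<^esub> m) ` carrier M) R M"
      by (rule \<phi>.image_submodule[OF carrier_is_submodule])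
    show sm: "submodule (?T B <+>\<^bsub>M\<^esub> (\<lambda>m. (y [^] ?q) \<odot>\<^bsub>M\<^esub> m) ` carrier M) R M"
      by (rule sub_sum[OF T(2) im])
    show "?T B \<subseteq> ?T ?C" using frob_times_mono[OF smod BC car(3)] .
    show "?T ?C \<subseteq> ?T B <+>\<^bsub>M\<^esub> (\<lambda>m. (y [^] ?q) \<odot>\<^bsub>M\<^esub> m) ` carrier M"
    proof (rule frob_times_least[OF smod sm car(3)])
      fix x m assume x: "x \<in> ?C" and m: "m \<in> carrier M"
      then obtain b r where br: "b \<in> B" "r \<in> carrier R" "x = b \<oplus> r \<otimes> y"
        unfolding self.mem_adjoin by auto
      have b: "b \<in> carrier R" using br car by auto
      have "(x [^] ?q) \<odot>\<^bsub>M\<^esub> m = (b [^] ?q) \<odot>\<^bsub>M\<^esub> m \<oplus>\<^bsub>M\<^esub> (y [^] ?q) \<odot>\<^bsub>M\<^esub> ((r [^] ?q) \<odot>\<^bsub>M\<^esub> m)"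
        using br b y m by (simp add: frob_add_iter nat_pow_distrib smult_l_distr smult_assoc1[symmetric] m_comm)
      moreover have "(b [^] ?q) \<odot>\<^bsub>M\<^esub> m \<in> ?T B" using frob_times_mem[OF smod car(2) br(1) m] .
      moreover have "(r [^] ?q) \<odot>\<^bsub>M\<^esub> m \<in> carrier M" using br m by simp
      ultimately show "(x [^] ?q) \<odot>\<^bsub>M\<^esub> m \<in> ?T B <+>\<^bsub>M\<^esub> (\<lambda>m. (y [^] ?q) \<odot>\<^bsub>M\<^esub> m) ` carrier M"
        unfolding set_add_iff by blast
    qed
  qed auto
  also have "\<dots> \<le> ?l (?T ?Q) (carrier M)"
    using sub_car[OF T(4)] by (intro \<phi>.len_image_le[OF T(4) carrier_is_submodule _ QTB]) auto
  also have "\<dots> \<le> enat (if ?Q = P then 1 else 0) * ?l (?T P) (carrier M)"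
  proof (cases "?Q = P")
    case True
    then show ?thesis by (simp only: if_True refl one_enat_def[symmetric] mult_1 order_refl)
  next
    case False
    then have "\<not> ?Q \<subseteq> P" using Cons.prems by auto
    then obtain s where s: "s \<in> ?Q" "s \<notin> P" by auto
    have "s [^] ?q \<in> carrier R - P"
      using s car(4) primeideal.pow_mem_iff[OF P, of s ?q] p_gt_0 by auto
    then have "carrier M \<subseteq> sat R M (carrier R - P) (?T ?Q)"
      using frob_times_mem[OF smod car(4) s(1), of _ ?q] by (auto simp: sat_def)
    then show ?thesis using len_eq_0[OF T(4)] by simp
  qed
  finally have step: "?l (?T B) (?T ?C) \<le> enat (if ?Q = P then 1 else 0) * ?l (?T P) (carrier M)" .
  have "?l (?T A) (?T ?C) = ?l (?T A) (?T B) + ?l (?T B) (?T ?C)"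
    by (rule len_add[OF T(1-3) frob_times_mono[OF smod sub(3) car(2)] frob_times_mono[OF smod BC car(3)]])
  also have "\<dots> \<le> enat (count_list Qs P) * ?l (?T P) (carrier M) + enat (if ?Q = P then 1 else 0) * ?l (?T P) (carrier M)"
    using Cons.IH Cons.prems step by (intro add_mono) auto
  also have "\<dots> = enat (count_list (?Q # Qs) P) * ?l (?T P) (carrier M)"
    by (simp add: distrib_right[symmetric])
  finally show ?case .
qed

text \<open>The contraction to \<open>R\<close> of the annihilator of \<open>M\<^sub>P\<close>.\<close>

definition loc_ann :: "('a, 'm, 'k) module_scheme \<Rightarrow> 'a set \<Rightarrow> 'a set" where
  "loc_ann M P = {a \<in> carrier R. \<forall>m\<in>carrier M. \<exists>t\<in>carrier R - P. t \<odot>\<^bsub>M\<^esub> (a \<odot>\<^bsub>M\<^esub> m) = \<zero>\<^bsub>M\<^esub>}"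

text \<open>If \<open>t a\<close> kills \<open>y\<close> then \<open>t a\<close> lies in the colon
  ideal \<open>Q\<close>, and \<open>t\<close>, being outside \<open>P\<close>, is outside
  \<open>Q\<close>. Consequently every prime of the filtration below \<open>P\<close> starts a chain
  that counts towards the dimension of the localised module.\<close>

lemma pfilt_loc_ann:
  assumes "module R M" "pfilt R M {\<zero>\<^bsub>M\<^esub>} B Qs" "Q \<in> set Qs" "Q \<subseteq> P"
  shows "loc_ann M P \<subseteq> Q"
proof -
  interpret module R M by fact
  interpret smod R M "{\<one>}" by (auto simp: smod_def smod_axioms_def assms(1))
  have "A = {\<zero>\<^bsub>M\<^esub>} \<Longrightarrow> loc_ann M P \<subseteq> Q" if "pfilt R M A B Qs" "Q \<in> set Qs" for A
    using that
  proof (induction)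
    case (Cons A B Qs y)
    show ?case
    proof (cases "Q = colon R M B y")
      case True
      show ?thesis
      proof
        fix a assume "a \<in> loc_ann M P"
        then obtain t where t: "a \<in> carrier R" "t \<in> carrier R" "t \<notin> P" "t \<odot>\<^bsub>M\<^esub> (a \<odot>\<^bsub>M\<^esub> y) = \<zero>\<^bsub>M\<^esub>"
          using Cons.hyps(2) by (auto simp: loc_ann_def)
        have "\<zero>\<^bsub>M\<^esub> \<in> B" using pfilt_submodule[OF Cons.hyps(1)] Cons.prems by auto
        then have "t \<otimes> a \<in> Q" using t Cons.hyps(2) True by (simp add: colon_def smult_assoc1)
        then show "a \<in> Q"
          using primeideal.I_prime[OF Cons.hyps(3)[folded True] t(2,1)] t assms(4) by auto
      qed
    qed (use Cons in auto)
  qed auto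
  then show ?thesis using assms by blast
qed

text \<open>The dimension is replaced by any bound \<open>d\<close> on prime chains of
  \<open>R\<close> that start above \<open>loc_ann M P\<close> and end at \<open>P\<close>. This
  keeps the statement free of fractions; \<open>module_dim\<close> is compared with such chains
  separately.\<close>

theorem uniform_bound:
  assumes M: "module R M" and fg: "fin_gen_module R M"
  shows "\<exists>C\<ge>0. \<forall>P e d. primeideal P R \<longrightarrow>
     (\<forall>n f. prime_chain R n f \<longrightarrow> loc_ann M P \<subseteq> f 0 \<longrightarrow> f n = P \<longrightarrow> n \<le> d) \<longrightarrow>
     (\<exists>k. len R M (carrier R - P) (frob_times R M (p ^ e) P) (carrier M) = enat k \<and>
       real k \<le> C * (real p ^ e) ^ d)"
proof -
  interpret module R M by fact
  have smod1: "smod R M {\<one>}" by (auto simp: smod_def smod_axioms_def M)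
  interpret one: smod R M "{\<one>}" by (rule smod1)
  have zero: "submodule {\<zero>\<^bsub>M\<^esub>} R M" by (rule one.submodI) auto
  obtain Qs where Qs: "pfilt R M {\<zero>\<^bsub>M\<^esub>} (carrier M) Qs"
    using one.pfilt_fin_gen_exists[OF noeth fg zero] by blast
  have prime: "\<And>Q. Q \<in> set Qs \<Longrightarrow> primeideal Q R" using one.pfilt_prime[OF Qs] by blast
  then have QI: "\<And>Q. Q \<in> set Qs \<Longrightarrow> ideal Q R" by (simp add: primeideal.axioms)
  obtain c where c: "\<And>Q. Q \<in> set Qs \<Longrightarrow> c Q \<ge> 0 \<and> (\<forall>P e h. primeideal P R \<longrightarrow> Q \<subseteq> P \<longrightarrow>
      rk Q = p ^ h * rk P \<longrightarrow> hkr Q P e \<le> c Q * (real p ^ e) ^ h)"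
    using hk_uniform_bound[OF prime] by metis
  define C where "C = (\<Sum>Q\<leftarrow>Qs. c Q)"
  have C0: "C \<ge> 0" unfolding C_def using c by (intro sum_list_nonneg) auto
  have "\<exists>k. len R M (carrier R - P) (frob_times R M (p ^ e) P) (carrier M) = enat k \<and>
       real k \<le> C * (real p ^ e) ^ d"
    if P: "primeideal P R"
      and d: "\<forall>n f. prime_chain R n f \<longrightarrow> loc_ann M P \<subseteq> f 0 \<longrightarrow> f n = P \<longrightarrow> n \<le> d" for P e d
  proof -
    note smod = smodI[OF M P]
    interpret smod R M "carrier R - P" by (rule smod)
    interpret P: primeideal P R by fact
    let ?q = "p ^ e"
    let ?K = "frob_times R M ?q P"
    have K: "submodule ?K R M" by (rule frob_times_submodule[OF smod P.a_subset])
    have sm: "a \<odot>\<^bsub>M\<^esub> x \<in> ?K" if "a \<in> frobenius_power R P ?q" "x \<in> carrier M" for a x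
      unfolding frob_times_def using that by (rule ideal_times_module_mem)
    have "len R M (carrier R - P) ({\<zero>\<^bsub>M\<^esub>} <+>\<^bsub>M\<^esub> ?K) (carrier M <+>\<^bsub>M\<^esub> ?K) \<le> (\<Sum>Q\<leftarrow>Qs. hk Q P e)"
      unfolding hk_def by (rule pfilt_len_sum_le[OF Qs K frobenius_power_ideal[OF P.a_subset] sm])
    moreover have "{\<zero>\<^bsub>M\<^esub>} <+>\<^bsub>M\<^esub> ?K = ?K" using sum_absorb[OF zero K] sub_zero[OF K] by auto
    moreover have "carrier M <+>\<^bsub>M\<^esub> ?K = carrier M"
      using sum_absorb[OF K carrier_is_submodule] sum_comm[OF K carrier_is_submodule] sub_car[OF K] by auto
    ultimately have le: "len R M (carrier R - P) ?K (carrier M) \<le> (\<Sum>Q\<leftarrow>Qs. hk Q P e)" by simp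
    obtain n where n: "(\<Sum>Q\<leftarrow>Qs. hk Q P e) = enat n" "(\<Sum>Q\<leftarrow>Qs. hkr Q P e) = real n"
      using sum_list_hk[OF QI P] by blast
    then obtain k where k: "len R M (carrier R - P) ?K (carrier M) = enat k" "k \<le> n"
      using le by (cases "len R M (carrier R - P) ?K (carrier M)") auto
    have "(\<Sum>Q\<leftarrow>Qs. hkr Q P e) \<le> (\<Sum>Q\<leftarrow>Qs. c Q * (real p ^ e) ^ d)"
    proof (rule sum_list_mono)
      fix Q assume Q: "Q \<in> set Qs"
      show "hkr Q P e \<le> c Q * (real p ^ e) ^ d"
      proof (cases "Q \<subseteq> P")
        case False
        then have "hkr Q P e = 0" using hk_eq_0[OF QI[OF Q] P] by (simp add: hkr_def zero_enat_def)
        then show ?thesis using c[OF Q] by simp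
      next
        case True
        obtain j g where j: "prime_chain R j g" "g 0 = Q" "g j = P" "rk Q = p ^ j * rk P"
          using rk_prime_chain_ex[OF prime[OF Q] P True] by blast
        \<comment> \<open>The exponent attached to \<open>Q\<close> is the length of an actual chain
          from \<open>Q\<close> to \<open>P\<close>, and \<open>Q\<close> contains
          \<open>loc_ann M P\<close>.\<close>
        have "j \<le> d" using d j pfilt_loc_ann[OF M Qs Q True] by blast
        moreover have "real p ^ e \<ge> 1" using p_gt_0 by (intro one_le_power) simp
        ultimately have "(real p ^ e) ^ j \<le> (real p ^ e) ^ d" by (intro power_increasing)
        moreover have "hkr Q P e \<le> c Q * (real p ^ e) ^ j" using c[OF Q] P True j(4) by blast
        ultimately show ?thesis using c[OF Q] by (meson mult_left_mono order_trans)
      qed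
    qed
    also have "\<dots> = C * (real p ^ e) ^ d" by (simp add: C_def sum_list_mult_const)
    finally have "real n \<le> C * (real p ^ e) ^ d" using n by simp
    then show ?thesis using k by (intro exI[of _ k]) auto
  qed
  then show ?thesis using C0 by blast
qed

end

section \<open>Length of quotient modules\<close>

context module
begin

lemma smod_one: "smod R M {\<one>}"
  by (auto simp: smod_def smod_axioms_def module_axioms)

context
  fixes N K
  assumes N: "submodule N R M" and K: "submodule K R M" and KN: "K \<subseteq> N"
begin

interpretation smod R M "{\<one>}" by (rule smod_one)

lemma abelian_subgroup_K: "abelian_subgroup K M"
  using K by (intro abelian_subgroupI3 M.abelian_group_axioms) (simp add: additive_subgroup_def submodule.axioms)

interpretation K: abelian_subgroup K M by (rule abelian_subgroup_K)

lemma N_car: "x \<in> N \<Longrightarrow> x \<in> carrier M" by (rule sub_car[OF N])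

lemma coset_eq_iff: "x \<in> carrier M \<Longrightarrow> y \<in> carrier M \<Longrightarrow> K +>\<^bsub>M\<^esub> x = K +>\<^bsub>M\<^esub> y \<longleftrightarrow> x \<ominus>\<^bsub>M\<^esub> y \<in> K"
  unfolding a_minus_def by (metis K.a_rcos_module K.a_repr_independence' K.a_rcos_self)

lemma quot_carrier: "carrier (quot_module M N K) = (\<lambda>x. K +>\<^bsub>M\<^esub> x) ` N"
  by (auto simp: quot_module_def A_RCOSETS_def' a_r_coset_def')

lemma quot_zero: "\<zero>\<^bsub>quot_module M N K\<^esub> = K +>\<^bsub>M\<^esub> \<zero>\<^bsub>M\<^esub>"
  using K.a_rcos_const[OF sub_zero[OF K]] by (simp add: quot_module_def)

lemma quot_add: "x \<in> N \<Longrightarrow> y \<in> N \<Longrightarrow>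
    (K +>\<^bsub>M\<^esub> x) \<oplus>\<^bsub>quot_module M N K\<^esub> (K +>\<^bsub>M\<^esub> y) = K +>\<^bsub>M\<^esub> (x \<oplus>\<^bsub>M\<^esub> y)"
  using K.a_rcos_sum N_car by (simp add: quot_module_def)

lemma quot_smult:
  assumes "r \<in> carrier R" "x \<in> N"
  shows "r \<odot>\<^bsub>quot_module M N K\<^esub> (K +>\<^bsub>M\<^esub> x) = K +>\<^bsub>M\<^esub> (r \<odot>\<^bsub>M\<^esub> x)"
proof -
  have "K +>\<^bsub>M\<^esub> (r \<odot>\<^bsub>M\<^esub> y) = K +>\<^bsub>M\<^esub> (r \<odot>\<^bsub>M\<^esub> x)" if "y \<in> K +>\<^bsub>M\<^esub> x" for y
  proof -
    have x: "x \<in> carrier M" using assms N_car by auto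
    then have y: "y \<in> carrier M" using that K.a_elemrcos_carrier by blast
    have "y \<ominus>\<^bsub>M\<^esub> x \<in> K" using K.a_rcos_module[OF x y] that by (simp add: a_minus_def)
    then have "r \<odot>\<^bsub>M\<^esub> (y \<ominus>\<^bsub>M\<^esub> x) \<in> K" using sub_smult[OF K assms(1)] by blast
    moreover have "r \<odot>\<^bsub>M\<^esub> (y \<ominus>\<^bsub>M\<^esub> x) = r \<odot>\<^bsub>M\<^esub> y \<ominus>\<^bsub>M\<^esub> r \<odot>\<^bsub>M\<^esub> x"
      using x y assms by (simp add: a_minus_def smult_r_distr smult_r_minus)
    ultimately show ?thesis using coset_eq_iff x y assms by simp
  qed
  moreover have "x \<in> K +>\<^bsub>M\<^esub> x" using assms N_car K.a_rcos_self by auto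
  ultimately have "(\<Union>y\<in>K +>\<^bsub>M\<^esub> x. K +>\<^bsub>M\<^esub> (r \<odot>\<^bsub>M\<^esub> y)) = K +>\<^bsub>M\<^esub> (r \<odot>\<^bsub>M\<^esub> x)"
    by (intro UN_constant_eq ballI)
  then show ?thesis by (simp add: quot_module_def)
qed

lemma quot_module_module: "module R (quot_module M N K)"
proof (rule moduleI[OF R.is_cring])
  show "abelian_group (quot_module M N K)"
  proof (rule abelian_groupI)
    fix A assume "A \<in> carrier (quot_module M N K)"
    then obtain x where x: "x \<in> N" "A = K +>\<^bsub>M\<^esub> x" by (auto simp: quot_carrier)
    then have "(K +>\<^bsub>M\<^esub> \<ominus>\<^bsub>M\<^esub> x) \<oplus>\<^bsub>quot_module M N K\<^esub> A = \<zero>\<^bsub>quot_module M N K\<^esub>"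
      using quot_add[of "\<ominus>\<^bsub>M\<^esub> x" x] sub_neg[OF N] N_car by (simp add: quot_zero M.l_neg)
    then show "\<exists>B\<in>carrier (quot_module M N K). B \<oplus>\<^bsub>quot_module M N K\<^esub> A = \<zero>\<^bsub>quot_module M N K\<^esub>"
      using sub_neg[OF N x(1)] by (auto simp: quot_carrier)
  qed (auto simp: quot_carrier quot_add quot_zero sub_add[OF N] sub_zero[OF N] N_car M.a_ac)
qed (auto simp: quot_carrier quot_add quot_smult sub_add[OF N] sub_smult[OF N] N_car smult_l_distr
    smult_r_distr smult_assoc1)

lemma sat_one: "submodule A R M \<Longrightarrow> sat R M {\<one>} A = A"
  by (auto simp: sat_def sub_car)

lemma quot_submodule_pull:
  assumes W: "submodule W R (quot_module M N K)"
  shows "submodule {x \<in> N. K +>\<^bsub>M\<^esub> x \<in> W} R M" "K \<subseteq> {x \<in> N. K +>\<^bsub>M\<^esub> x \<in> W}"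
proof -
  interpret Q: smod R "quot_module M N K" "{\<one>}" by (rule module.smod_one[OF quot_module_module])
  show "submodule {x \<in> N. K +>\<^bsub>M\<^esub> x \<in> W} R M"
    using Q.sub_zero[OF W] Q.sub_add[OF W] Q.sub_smult[OF W]
    by (intro submodI)
       (auto simp: N_car sub_zero[OF N] sub_add[OF N] sub_smult[OF N] quot_zero simp flip: quot_add quot_smult)
  show "K \<subseteq> {x \<in> N. K +>\<^bsub>M\<^esub> x \<in> W}"
    using KN Q.sub_zero[OF W] K.a_rcos_const by (auto simp: quot_module_def)
qed

lemma quot_submodule_push:
  assumes A: "submodule A R M" "A \<subseteq> N"
  shows "submodule ((\<lambda>x. K +>\<^bsub>M\<^esub> x) ` A) R (quot_module M N K)"
proof -
  interpret Q: smod R "quot_module M N K" "{\<one>}" by (rule module.smod_one[OF quot_module_module])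
  note A' = subsetD[OF A(2)]
  show ?thesis
  proof (rule Q.submodI)
    show "\<zero>\<^bsub>quot_module M N K\<^esub> \<in> (\<lambda>x. K +>\<^bsub>M\<^esub> x) ` A" using sub_zero[OF A(1)] by (auto simp: quot_zero)
  qed (use A in \<open>auto simp: quot_carrier quot_add quot_smult A' sub_add[OF A(1)] sub_smult[OF A(1)]\<close>)
qed

text \<open>For \<open>S = {\<one>}\<close> saturation does nothing, so \<open>len\<close> counts
  strict chains between \<open>K\<close> and \<open>N\<close>; these correspond to chains of
  submodules of the quotient by taking preimages and images.\<close>

lemma module_length_quot: "module_length R (quot_module M N K) = len R M {\<one>} K N"
proof (rule antisym)
  let ?q = "\<lambda>x. K +>\<^bsub>M\<^esub> x"
  interpret Q: smod R "quot_module M N K" "{\<one>}" by (rule module.smod_one[OF quot_module_module])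
  define pull where "pull = (\<lambda>W. {x \<in> N. ?q x \<in> W})"
  have "lchain R M {\<one>} K (pull (W n)) n"
    if "\<forall>i\<le>n. submodule (W i) R (quot_module M N K)" "\<forall>i<n. W i \<subset> W (Suc i)" for W n
    using that
  proof (induction n)
    case 0
    then show ?case using quot_submodule_pull[of "W 0"] K by (auto simp: pull_def intro!: lchain.base)
  next
    case (Suc n)
    then have W: "submodule (W n) R (quot_module M N K)" "submodule (W (Suc n)) R (quot_module M N K)"
      "W n \<subset> W (Suc n)" by auto
    obtain w where w: "w \<in> W (Suc n)" "w \<notin> W n" using W(3) by auto
    then obtain x where x: "x \<in> N" "w = ?q x" using Q.sub_car[OF W(2)] by (auto simp: quot_carrier)
    have "sat R M {\<one>} (pull (W n)) = pull (W n)"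
      using sat_one quot_submodule_pull(1)[OF W(1)] by (simp add: pull_def)
    moreover have "x \<in> pull (W (Suc n))" "x \<notin> pull (W n)" using w x by (auto simp: pull_def)
    moreover have "lchain R M {\<one>} K (pull (W n)) n" using Suc by auto
    moreover have "submodule (pull (W (Suc n))) R M" "pull (W n) \<subseteq> pull (W (Suc n))"
      using quot_submodule_pull(1)[OF W(2)] W(3) by (auto simp: pull_def)
    ultimately show ?case by (intro lchain.step) auto
  qed
  then have "lchain R M {\<one>} K N n"
    if "\<forall>i\<le>n. submodule (W i) R (quot_module M N K)" "\<forall>i<n. W i \<subset> W (Suc i)" for W n
    by (rule lchain_mono_right) (use that N in \<open>auto simp: pull_def\<close>)
  then show "module_length R (quot_module M N K) \<le> len R M {\<one>} K N"
    unfolding module_length_def by (intro Sup_least) (auto intro: lchain_le_len)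
  have chain: "\<exists>W. (\<forall>i\<le>n. submodule (W i) R (quot_module M N K)) \<and> (\<forall>i<n. W i \<subset> W (Suc i)) \<and> W n = ?q ` B"
    if "lchain R M {\<one>} A B n" "A = K" "B \<subseteq> N" for A B n
    using that
  proof (induction)
    case (base A B)
    then show ?case using quot_submodule_push by (intro exI[of _ "\<lambda>_. ?q ` B"]) auto
  next
    case (step A B n C)
    have "B \<subseteq> N" using step.hyps(3) step.prems(2) by blast
    then obtain W where W: "\<forall>i\<le>n. submodule (W i) R (quot_module M N K)" "\<forall>i<n. W i \<subset> W (Suc i)" "W n = ?q ` B"
      using step.IH[OF step.prems(1)] by blast
    have B: "submodule B R M" "K \<subseteq> B" using lchain_submoduleD[OF step.hyps(1)] step.prems by auto
    obtain y where y: "y \<in> C" "y \<notin> B" using step.hyps(4) sat_one[OF B(1)] by auto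
    have "?q y \<notin> ?q ` B"
    proof
      assume "?q y \<in> ?q ` B"
      then obtain b where b: "b \<in> B" "?q y = ?q b" by auto
      have car: "y \<in> carrier M" "b \<in> carrier M" using y b sub_car[OF B(1)] sub_car[OF step.hyps(2)] by auto
      then have "y \<ominus>\<^bsub>M\<^esub> b \<in> B" using coset_eq_iff b B by auto
      then have "y \<ominus>\<^bsub>M\<^esub> b \<oplus>\<^bsub>M\<^esub> b \<in> B" using b sub_add[OF B(1)] by auto
      then show False using y car by (simp add: a_minus_def M.a_assoc M.l_neg)
    qed
    then have "?q ` B \<subset> ?q ` C" using y step.hyps(3) by blast
    moreover have "submodule (?q ` C) R (quot_module M N K)"
      using quot_submodule_push step.hyps(2) step.prems by blast
    ultimately show ?case using W
      by (intro exI[of _ "W(Suc n := ?q ` C)"]) (auto simp: le_Suc_eq less_Suc_eq)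
  qed
  show "len R M {\<one>} K N \<le> module_length R (quot_module M N K)"
  proof (rule len_leI)
    fix n assume "lchain R M {\<one>} K N n"
    from chain[OF this] show "enat n \<le> module_length R (quot_module M N K)"
      unfolding module_length_def by (intro Sup_upper) auto
  qed
qed

end

end

section \<open>Fraction modules\<close>

text \<open>This evaluates the operations of \<open>fraction_module\<close>, which are unions over
  representatives, once independence of the representatives is shown.\<close>

lemma UN_eq_const:
  assumes "A \<noteq> {}" "B \<noteq> {}" "\<And>x y. x \<in> A \<Longrightarrow> y \<in> B \<Longrightarrow> g x y = c"
  shows "(\<Union>x\<in>A. \<Union>y\<in>B. g x y) = c"
  using assms by auto

context smod
begin

abbreviation "RS \<equiv> fraction_ring R S"
abbreviation "MS \<equiv> fraction_module R M S"
abbreviation "mc \<equiv> frac_class R M S"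
abbreviation "rc \<equiv> frac_class R (self_module R) S"

lemma frac_rel_iff: "((m, s), (n, t)) \<in> fraction_rel R M S \<longleftrightarrow>
    m \<in> carrier M \<and> s \<in> S \<and> n \<in> carrier M \<and> t \<in> S \<and> (\<exists>u\<in>S. (u \<otimes> t) \<odot>\<^bsub>M\<^esub> m = (u \<otimes> s) \<odot>\<^bsub>M\<^esub> n)"
  by (auto simp: fraction_rel_def smult_assoc1)

lemma smult_mult_cong:
  assumes "a \<odot>\<^bsub>M\<^esub> m = b \<odot>\<^bsub>M\<^esub> n" "a \<in> carrier R" "b \<in> carrier R" "c \<in> carrier R" "m \<in> carrier M" "n \<in> carrier M"
  shows "(c \<otimes> a) \<odot>\<^bsub>M\<^esub> m = (c \<otimes> b) \<odot>\<^bsub>M\<^esub> n"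
  using assms by (simp add: smult_assoc1)

lemma frac_equiv: "equiv (carrier M \<times> S) (fraction_rel R M S)"
proof (rule equivI)
  show "fraction_rel R M S \<subseteq> (carrier M \<times> S) \<times> (carrier M \<times> S)" by (auto simp: fraction_rel_def)
  show "refl_on (carrier M \<times> S) (fraction_rel R M S)"
    using one_S by (auto simp: refl_on_def frac_rel_iff)
  show "sym (fraction_rel R M S)" unfolding sym_def by (auto simp: frac_rel_iff) metis
  show "trans (fraction_rel R M S)"
  proof (rule transI, clarify)
    fix m s n t k r
    assume "((m, s), (n, t)) \<in> fraction_rel R M S" "((n, t), (k, r)) \<in> fraction_rel R M S"
    then obtain u v where c: "m \<in> carrier M" "n \<in> carrier M" "k \<in> carrier M" "s \<in> S" "t \<in> S" "r \<in> S"
      and u: "u \<in> S" "(u \<otimes> t) \<odot>\<^bsub>M\<^esub> m = (u \<otimes> s) \<odot>\<^bsub>M\<^esub> n"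
      and v: "v \<in> S" "(v \<otimes> r) \<odot>\<^bsub>M\<^esub> n = (v \<otimes> t) \<odot>\<^bsub>M\<^esub> k"
      by (auto simp: frac_rel_iff)
    have "((v \<otimes> r) \<otimes> (u \<otimes> t)) \<odot>\<^bsub>M\<^esub> m = ((v \<otimes> r) \<otimes> (u \<otimes> s)) \<odot>\<^bsub>M\<^esub> n"
      using c u(1) v(1) by (intro smult_mult_cong[OF u(2)]) auto
    also have "(v \<otimes> r) \<otimes> (u \<otimes> s) = (u \<otimes> s) \<otimes> (v \<otimes> r)" using c u(1) v(1) by (simp add: R.m_comm)
    also have "((u \<otimes> s) \<otimes> (v \<otimes> r)) \<odot>\<^bsub>M\<^esub> n = ((u \<otimes> s) \<otimes> (v \<otimes> t)) \<odot>\<^bsub>M\<^esub> k"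
      using c u(1) v(1) by (intro smult_mult_cong[OF v(2)]) auto
    finally have "((u \<otimes> v \<otimes> t) \<otimes> r) \<odot>\<^bsub>M\<^esub> m = ((u \<otimes> v \<otimes> t) \<otimes> s) \<odot>\<^bsub>M\<^esub> k"
      using c u(1) v(1) by (simp add: R.m_ac)
    \<comment> \<open>The middle denominator \<open>t\<close> cannot be cancelled and becomes part
      of the witness.\<close>
    moreover have "u \<otimes> v \<otimes> t \<in> S" using u(1) v(1) c mult_S by auto
    ultimately show "((m, s), (k, r)) \<in> fraction_rel R M S" using c by (auto simp: frac_rel_iff)
  qed
qed

lemma mc_eq_iff:
  assumes "m \<in> carrier M" "s \<in> S" "n \<in> carrier M" "t \<in> S"
  shows "mc m s = mc n t \<longleftrightarrow> (\<exists>u\<in>S. (u \<otimes> t) \<odot>\<^bsub>M\<^esub> m = (u \<otimes> s) \<odot>\<^bsub>M\<^esub> n)"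
  using eq_equiv_class_iff[OF frac_equiv, of "(m, s)" "(n, t)"] assms
  by (simp add: frac_class_def frac_rel_iff)

lemma mc_eqI:
  assumes "m \<in> carrier M" "s \<in> S" "n \<in> carrier M" "t \<in> S" "t \<odot>\<^bsub>M\<^esub> m = s \<odot>\<^bsub>M\<^esub> n"
  shows "mc m s = mc n t"
  using assms one_S by (auto simp: mc_eq_iff intro!: bexI[of _ \<one>])

lemma mem_mcD:
  assumes "(n, t) \<in> mc m s"
  shows "n \<in> carrier M" "t \<in> S" "\<exists>u\<in>S. (u \<otimes> t) \<odot>\<^bsub>M\<^esub> m = (u \<otimes> s) \<odot>\<^bsub>M\<^esub> n"
  using assms by (auto simp: frac_class_def frac_rel_iff)

lemma mem_mc: "m \<in> carrier M \<Longrightarrow> s \<in> S \<Longrightarrow> (m, s) \<in> mc m s"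
  using one_S by (auto simp: frac_class_def frac_rel_iff)

lemma MS_carrier: "carrier MS = {mc m s |m s. m \<in> carrier M \<and> s \<in> S}"
  by (auto simp: fraction_module_def quotient_def frac_class_def)

lemma MS_carrierI [simp]: "m \<in> carrier M \<Longrightarrow> s \<in> S \<Longrightarrow> mc m s \<in> carrier MS"
  by (auto simp: MS_carrier)

lemma MS_carrierE:
  assumes "x \<in> carrier MS"
  obtains m s where "m \<in> carrier M" "s \<in> S" "x = mc m s"
  using assms by (auto simp: MS_carrier)

lemma MS_zero: "\<zero>\<^bsub>MS\<^esub> = mc \<zero>\<^bsub>M\<^esub> \<one>"
  by (simp add: fraction_module_def)

lemma MS_add:
  assumes "m \<in> carrier M" "s \<in> S" "n \<in> carrier M" "t \<in> S"
  shows "mc m s \<oplus>\<^bsub>MS\<^esub> mc n t = mc (t \<odot>\<^bsub>M\<^esub> m \<oplus>\<^bsub>M\<^esub> s \<odot>\<^bsub>M\<^esub> n) (s \<otimes> t)"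
proof -
  have "(\<Union>x\<in>mc m s. \<Union>y\<in>mc n t. mc (snd y \<odot>\<^bsub>M\<^esub> fst x \<oplus>\<^bsub>M\<^esub> snd x \<odot>\<^bsub>M\<^esub> fst y) (snd x \<otimes> snd y))
      = mc (t \<odot>\<^bsub>M\<^esub> m \<oplus>\<^bsub>M\<^esub> s \<odot>\<^bsub>M\<^esub> n) (s \<otimes> t)"
  proof (rule UN_eq_const)
    show "mc m s \<noteq> {}" "mc n t \<noteq> {}" using mem_mc assms by blast+
    fix x y assume xy: "x \<in> mc m s" "y \<in> mc n t"
    obtain m' s' n' t' where e: "x = (m', s')" "y = (n', t')" by (cases x, cases y)
    obtain u where u: "m' \<in> carrier M" "s' \<in> S" "u \<in> S" "(u \<otimes> s') \<odot>\<^bsub>M\<^esub> m = (u \<otimes> s) \<odot>\<^bsub>M\<^esub> m'"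
      using mem_mcD[of m' s' m s] xy e by auto
    obtain v where v: "n' \<in> carrier M" "t' \<in> S" "v \<in> S" "(v \<otimes> t') \<odot>\<^bsub>M\<^esub> n = (v \<otimes> t) \<odot>\<^bsub>M\<^esub> n'"
      using mem_mcD[of n' t' n t] xy e by auto
    note car = assms u(1-3) v(1-3)
    have 1: "((v \<otimes> t \<otimes> t') \<otimes> (u \<otimes> s')) \<odot>\<^bsub>M\<^esub> m = ((v \<otimes> t \<otimes> t') \<otimes> (u \<otimes> s)) \<odot>\<^bsub>M\<^esub> m'"
      using car by (intro smult_mult_cong[OF u(4)]) auto
    have 2: "((u \<otimes> s \<otimes> s') \<otimes> (v \<otimes> t')) \<odot>\<^bsub>M\<^esub> n = ((u \<otimes> s \<otimes> s') \<otimes> (v \<otimes> t)) \<odot>\<^bsub>M\<^esub> n'"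
      using car by (intro smult_mult_cong[OF v(4)]) auto
    have "((u \<otimes> v) \<otimes> (s \<otimes> t)) \<odot>\<^bsub>M\<^esub> (t' \<odot>\<^bsub>M\<^esub> m' \<oplus>\<^bsub>M\<^esub> s' \<odot>\<^bsub>M\<^esub> n')
       = ((v \<otimes> t \<otimes> t') \<otimes> (u \<otimes> s)) \<odot>\<^bsub>M\<^esub> m' \<oplus>\<^bsub>M\<^esub> ((u \<otimes> s \<otimes> s') \<otimes> (v \<otimes> t)) \<odot>\<^bsub>M\<^esub> n'"
      using car by (simp add: smult_r_distr smult_assoc1[symmetric] R.m_ac)
    also have "\<dots> = ((v \<otimes> t \<otimes> t') \<otimes> (u \<otimes> s')) \<odot>\<^bsub>M\<^esub> m \<oplus>\<^bsub>M\<^esub> ((u \<otimes> s \<otimes> s') \<otimes> (v \<otimes> t')) \<odot>\<^bsub>M\<^esub> n"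
      unfolding 1 2 ..
    also have "\<dots> = ((u \<otimes> v) \<otimes> (s' \<otimes> t')) \<odot>\<^bsub>M\<^esub> (t \<odot>\<^bsub>M\<^esub> m \<oplus>\<^bsub>M\<^esub> s \<odot>\<^bsub>M\<^esub> n)"
      using car by (simp add: smult_r_distr smult_assoc1[symmetric] R.m_ac)
    finally have "((u \<otimes> v) \<otimes> (s \<otimes> t)) \<odot>\<^bsub>M\<^esub> (t' \<odot>\<^bsub>M\<^esub> m' \<oplus>\<^bsub>M\<^esub> s' \<odot>\<^bsub>M\<^esub> n')
       = ((u \<otimes> v) \<otimes> (s' \<otimes> t')) \<odot>\<^bsub>M\<^esub> (t \<odot>\<^bsub>M\<^esub> m \<oplus>\<^bsub>M\<^esub> s \<odot>\<^bsub>M\<^esub> n)" .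
    moreover have "u \<otimes> v \<in> S" using car mult_S by auto
    ultimately show "mc (snd y \<odot>\<^bsub>M\<^esub> fst x \<oplus>\<^bsub>M\<^esub> snd x \<odot>\<^bsub>M\<^esub> fst y) (snd x \<otimes> snd y)
        = mc (t \<odot>\<^bsub>M\<^esub> m \<oplus>\<^bsub>M\<^esub> s \<odot>\<^bsub>M\<^esub> n) (s \<otimes> t)"
      unfolding e fst_conv snd_conv using car mult_S
      by (subst mc_eq_iff) auto
  qed
  then show ?thesis by (simp add: fraction_module_def case_prod_beta)
qed

lemma MS_smult:
  assumes "r \<in> carrier R" "s \<in> S" "n \<in> carrier M" "t \<in> S"
  shows "rc r s \<odot>\<^bsub>MS\<^esub> mc n t = mc (r \<odot>\<^bsub>M\<^esub> n) (s \<otimes> t)"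
proof -
  interpret self: smod R "self_module R" S by (rule smod_self)
  have "(\<Union>x\<in>rc r s. \<Union>y\<in>mc n t. mc (fst x \<odot>\<^bsub>M\<^esub> fst y) (snd x \<otimes> snd y)) = mc (r \<odot>\<^bsub>M\<^esub> n) (s \<otimes> t)"
  proof (rule UN_eq_const)
    show "rc r s \<noteq> {}" "mc n t \<noteq> {}" using self.mem_mc[of r s] mem_mc assms by auto
    fix x y assume xy: "x \<in> rc r s" "y \<in> mc n t"
    obtain r' s' n' t' where e: "x = (r', s')" "y = (n', t')" by (cases x, cases y)
    obtain u where u: "r' \<in> carrier R" "s' \<in> S" "u \<in> S" "(u \<otimes> s') \<otimes> r = (u \<otimes> s) \<otimes> r'"
      using self.mem_mcD[of r' s' r s] xy e by auto
    obtain v where v: "n' \<in> carrier M" "t' \<in> S" "v \<in> S" "(v \<otimes> t') \<odot>\<^bsub>M\<^esub> n = (v \<otimes> t) \<odot>\<^bsub>M\<^esub> n'"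
      using mem_mcD[of n' t' n t] xy e by auto
    note car = assms u(1-3) v(1-3)
    have "((u \<otimes> v) \<otimes> (s \<otimes> t)) \<odot>\<^bsub>M\<^esub> (r' \<odot>\<^bsub>M\<^esub> n') = ((u \<otimes> s \<otimes> r') \<otimes> (v \<otimes> t)) \<odot>\<^bsub>M\<^esub> n'"
      using car by (simp add: smult_assoc1[symmetric] R.m_ac)
    also have "\<dots> = ((u \<otimes> s' \<otimes> r) \<otimes> (v \<otimes> t')) \<odot>\<^bsub>M\<^esub> n"
      using smult_mult_cong[OF v(4), of "u \<otimes> s' \<otimes> r"] u(4) car by simp
    also have "\<dots> = ((u \<otimes> v) \<otimes> (s' \<otimes> t')) \<odot>\<^bsub>M\<^esub> (r \<odot>\<^bsub>M\<^esub> n)"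
      using car by (simp add: smult_assoc1[symmetric] R.m_ac)
    finally have "((u \<otimes> v) \<otimes> (s \<otimes> t)) \<odot>\<^bsub>M\<^esub> (r' \<odot>\<^bsub>M\<^esub> n') = ((u \<otimes> v) \<otimes> (s' \<otimes> t')) \<odot>\<^bsub>M\<^esub> (r \<odot>\<^bsub>M\<^esub> n)" .
    moreover have "u \<otimes> v \<in> S" using car mult_S by auto
    ultimately show "mc (fst x \<odot>\<^bsub>M\<^esub> fst y) (snd x \<otimes> snd y) = mc (r \<odot>\<^bsub>M\<^esub> n) (s \<otimes> t)"
      unfolding e fst_conv snd_conv using car mult_S by (subst mc_eq_iff) auto
  qed
  then show ?thesis by (simp add: fraction_module_def case_prod_beta)
qed

lemma MS_abelian_group: "abelian_group MS"
proof (rule abelian_groupI)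
  fix x assume "x \<in> carrier MS"
  then obtain m s where x: "m \<in> carrier M" "s \<in> S" "x = mc m s" by (rule MS_carrierE)
  show "\<zero>\<^bsub>MS\<^esub> \<oplus>\<^bsub>MS\<^esub> x = x" using x one_S by (simp add: MS_zero MS_add)
  have "mc (\<ominus>\<^bsub>M\<^esub> m) s \<oplus>\<^bsub>MS\<^esub> x = \<zero>\<^bsub>MS\<^esub>"
    using x one_S mult_S mc_eqI[of "\<zero>\<^bsub>M\<^esub>" "s \<otimes> s" "\<zero>\<^bsub>M\<^esub>" \<one>]
    by (simp add: MS_zero MS_add smult_r_minus M.l_neg)
  then show "\<exists>y\<in>carrier MS. y \<oplus>\<^bsub>MS\<^esub> x = \<zero>\<^bsub>MS\<^esub>" using x by (intro bexI[of _ "mc (\<ominus>\<^bsub>M\<^esub> m) s"]) auto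
next
  fix x y z assume "x \<in> carrier MS" "y \<in> carrier MS" "z \<in> carrier MS"
  then obtain m s n t k r where *: "m \<in> carrier M" "s \<in> S" "x = mc m s" "n \<in> carrier M" "t \<in> S" "y = mc n t"
    "k \<in> carrier M" "r \<in> S" "z = mc k r" by (metis MS_carrierE)
  show "x \<oplus>\<^bsub>MS\<^esub> y \<oplus>\<^bsub>MS\<^esub> z = x \<oplus>\<^bsub>MS\<^esub> (y \<oplus>\<^bsub>MS\<^esub> z)"
    using * mult_S by (simp add: MS_add smult_r_distr smult_assoc1[symmetric] M.a_assoc R.m_ac)
next
  fix x y assume "x \<in> carrier MS" "y \<in> carrier MS"
  then obtain m s n t where *: "m \<in> carrier M" "s \<in> S" "x = mc m s" "n \<in> carrier M" "t \<in> S" "y = mc n t"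
    by (metis MS_carrierE)
  show "x \<oplus>\<^bsub>MS\<^esub> y \<in> carrier MS" using * mult_S by (simp add: MS_add)
  show "x \<oplus>\<^bsub>MS\<^esub> y = y \<oplus>\<^bsub>MS\<^esub> x" using * by (simp add: MS_add M.a_comm R.m_comm)
next
  show "\<zero>\<^bsub>MS\<^esub> \<in> carrier MS" using one_S by (simp add: MS_zero)
qed

text \<open>The ring of fractions borrows its operations from the fraction module of
  \<open>self_module R\<close>, so its laws are instances of those for modules.\<close>

lemma RS_simps:
  "carrier RS = carrier (fraction_module R (self_module R) S)"
  "ring.add RS = ring.add (fraction_module R (self_module R) S)"
  "ring.zero RS = ring.zero (fraction_module R (self_module R) S)"
  "monoid.mult RS = smult (fraction_module R (self_module R) S)"
  "\<one>\<^bsub>RS\<^esub> = rc \<one> \<one>"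
  by (simp_all add: fraction_ring_def Let_def)

end

context smod
begin

lemma RS_carrier: "carrier RS = {rc r s |r s. r \<in> carrier R \<and> s \<in> S}"
proof -
  interpret self: smod R "self_module R" S by (rule smod_self)
  show ?thesis using self.MS_carrier by (simp add: RS_simps)
qed

lemma RS_carrierI [simp]: "r \<in> carrier R \<Longrightarrow> s \<in> S \<Longrightarrow> rc r s \<in> carrier RS"
  by (auto simp: RS_carrier)

lemma RS_carrierE:
  assumes "x \<in> carrier RS"
  obtains r s where "r \<in> carrier R" "s \<in> S" "x = rc r s"
  using assms by (auto simp: RS_carrier)

lemma RS_add: "r \<in> carrier R \<Longrightarrow> s \<in> S \<Longrightarrow> a \<in> carrier R \<Longrightarrow> t \<in> S \<Longrightarrow>
    rc r s \<oplus>\<^bsub>RS\<^esub> rc a t = rc (t \<otimes> r \<oplus> s \<otimes> a) (s \<otimes> t)"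
  using smod.MS_add[OF smod_self, of r s a t] by (simp add: RS_simps)

lemma RS_mult: "r \<in> carrier R \<Longrightarrow> s \<in> S \<Longrightarrow> a \<in> carrier R \<Longrightarrow> t \<in> S \<Longrightarrow>
    rc r s \<otimes>\<^bsub>RS\<^esub> rc a t = rc (r \<otimes> a) (s \<otimes> t)"
  using smod.MS_smult[OF smod_self, of r s a t] by (simp add: RS_simps)

lemma RS_one: "\<one>\<^bsub>RS\<^esub> = rc \<one> \<one>"
  by (simp add: RS_simps)

lemma rc_eqI:
  assumes "r \<in> carrier R" "s \<in> S" "a \<in> carrier R" "t \<in> S" "t \<otimes> r = s \<otimes> a"
  shows "rc r s = rc a t"
  using smod.mc_eqI[OF smod_self, of r s a t] assms by simp

lemma MS_smult_l_distr:
  assumes "x \<in> carrier RS" "y \<in> carrier RS" "z \<in> carrier MS"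
  shows "(x \<oplus>\<^bsub>RS\<^esub> y) \<odot>\<^bsub>MS\<^esub> z = x \<odot>\<^bsub>MS\<^esub> z \<oplus>\<^bsub>MS\<^esub> y \<odot>\<^bsub>MS\<^esub> z"
proof -
  obtain r s where x: "r \<in> carrier R" "s \<in> S" "x = rc r s" using assms by (rule_tac RS_carrierE)
  obtain a t where y: "a \<in> carrier R" "t \<in> S" "y = rc a t" using assms by (rule_tac x=y in RS_carrierE)
  obtain m u where z: "m \<in> carrier M" "u \<in> S" "z = mc m u" using assms by (rule_tac x=z in MS_carrierE)
  note car = x(1,2) y(1,2) z(1,2)
  have "mc ((t \<otimes> r \<oplus> s \<otimes> a) \<odot>\<^bsub>M\<^esub> m) (s \<otimes> t \<otimes> u)
      = mc ((t \<otimes> u) \<odot>\<^bsub>M\<^esub> (r \<odot>\<^bsub>M\<^esub> m) \<oplus>\<^bsub>M\<^esub> (s \<otimes> u) \<odot>\<^bsub>M\<^esub> (a \<odot>\<^bsub>M\<^esub> m)) (s \<otimes> u \<otimes> (t \<otimes> u))"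
    using car mult_S
    by (intro mc_eqI) (simp_all add: smult_l_distr smult_r_distr smult_assoc1[symmetric] R.m_ac)
  then show ?thesis using x y z mult_S by (simp add: RS_add MS_add MS_smult)
qed

lemma RS_cring: "cring RS"
proof (rule cringI)
  interpret self: smod R "self_module R" S by (rule smod_self)
  show "abelian_group RS"
    by (rule abelian_groupI_same_add[OF self.MS_abelian_group]) (simp_all add: RS_simps)
  show "comm_monoid RS"
  proof (rule comm_monoidI)
    fix x y assume "x \<in> carrier RS" "y \<in> carrier RS"
    then obtain r s a t where *: "r \<in> carrier R" "s \<in> S" "x = rc r s" "a \<in> carrier R" "t \<in> S" "y = rc a t"
      by (metis RS_carrierE)
    show "x \<otimes>\<^bsub>RS\<^esub> y \<in> carrier RS" using * mult_S by (simp add: RS_mult)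
    show "x \<otimes>\<^bsub>RS\<^esub> y = y \<otimes>\<^bsub>RS\<^esub> x" using * by (simp add: RS_mult R.m_comm)
    show "\<one>\<^bsub>RS\<^esub> \<otimes>\<^bsub>RS\<^esub> x = x" using * one_S by (simp add: RS_mult RS_one)
    fix z assume "z \<in> carrier RS"
    then obtain b u where "b \<in> carrier R" "u \<in> S" "z = rc b u" by (rule RS_carrierE)
    then show "x \<otimes>\<^bsub>RS\<^esub> y \<otimes>\<^bsub>RS\<^esub> z = x \<otimes>\<^bsub>RS\<^esub> (y \<otimes>\<^bsub>RS\<^esub> z)"
      using * mult_S by (simp add: RS_mult R.m_assoc)
  qed (use one_S in \<open>simp add: RS_one\<close>)
  fix x y z assume "x \<in> carrier RS" "y \<in> carrier RS" "z \<in> carrier RS"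
  then show "(x \<oplus>\<^bsub>RS\<^esub> y) \<otimes>\<^bsub>RS\<^esub> z = x \<otimes>\<^bsub>RS\<^esub> z \<oplus>\<^bsub>RS\<^esub> y \<otimes>\<^bsub>RS\<^esub> z"
    using self.MS_smult_l_distr[of x y z] by (simp add: RS_simps)
qed

lemma MS_module: "module RS MS"
proof (rule moduleI[OF RS_cring MS_abelian_group])
  fix x y z assume xyz: "x \<in> carrier RS" "y \<in> carrier RS" "z \<in> carrier MS"
  obtain r s a t m u where *: "r \<in> carrier R" "s \<in> S" "x = rc r s" "a \<in> carrier R" "t \<in> S" "y = rc a t"
    "m \<in> carrier M" "u \<in> S" "z = mc m u" using xyz by (metis RS_carrierE MS_carrierE)
  show "(x \<otimes>\<^bsub>RS\<^esub> y) \<odot>\<^bsub>MS\<^esub> z = x \<odot>\<^bsub>MS\<^esub> (y \<odot>\<^bsub>MS\<^esub> z)"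
    using * mult_S by (simp add: RS_mult MS_smult smult_assoc1 R.m_assoc)
  show "(x \<oplus>\<^bsub>RS\<^esub> y) \<odot>\<^bsub>MS\<^esub> z = x \<odot>\<^bsub>MS\<^esub> z \<oplus>\<^bsub>MS\<^esub> y \<odot>\<^bsub>MS\<^esub> z"
    using xyz by (rule MS_smult_l_distr)
next
  fix x y z assume xyz: "x \<in> carrier RS" "y \<in> carrier MS" "z \<in> carrier MS"
  obtain r s n t m u where *: "r \<in> carrier R" "s \<in> S" "x = rc r s" "n \<in> carrier M" "t \<in> S" "y = mc n t"
    "m \<in> carrier M" "u \<in> S" "z = mc m u" using xyz by (metis RS_carrierE MS_carrierE)
  have "mc (r \<odot>\<^bsub>M\<^esub> (u \<odot>\<^bsub>M\<^esub> n \<oplus>\<^bsub>M\<^esub> t \<odot>\<^bsub>M\<^esub> m)) (s \<otimes> (t \<otimes> u))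
     = mc ((s \<otimes> u) \<odot>\<^bsub>M\<^esub> (r \<odot>\<^bsub>M\<^esub> n) \<oplus>\<^bsub>M\<^esub> (s \<otimes> t) \<odot>\<^bsub>M\<^esub> (r \<odot>\<^bsub>M\<^esub> m)) (s \<otimes> t \<otimes> (s \<otimes> u))"
    using * mult_S
    by (intro mc_eqI) (simp_all add: smult_r_distr smult_assoc1[symmetric] R.m_ac)
  then show "x \<odot>\<^bsub>MS\<^esub> (y \<oplus>\<^bsub>MS\<^esub> z) = x \<odot>\<^bsub>MS\<^esub> y \<oplus>\<^bsub>MS\<^esub> x \<odot>\<^bsub>MS\<^esub> z"
    using * mult_S by (simp add: MS_add MS_smult)
next
  fix x y assume xy: "x \<in> carrier RS" "y \<in> carrier MS"
  obtain r s n t where *: "r \<in> carrier R" "s \<in> S" "x = rc r s" "n \<in> carrier M" "t \<in> S" "y = mc n t"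
    using xy by (metis RS_carrierE MS_carrierE)
  show "x \<odot>\<^bsub>MS\<^esub> y \<in> carrier MS" using * mult_S by (simp add: MS_smult)
next
  fix y assume "y \<in> carrier MS"
  then obtain n t where "n \<in> carrier M" "t \<in> S" "y = mc n t" by (rule MS_carrierE)
  then show "\<one>\<^bsub>RS\<^esub> \<odot>\<^bsub>MS\<^esub> y = y" using one_S by (simp add: MS_smult RS_one)
qed

definition contract :: "('c \<times> 'a) set set \<Rightarrow> 'c set" where
  "contract U = {m \<in> carrier M. mc m \<one> \<in> U}"

definition extend :: "'c set \<Rightarrow> ('c \<times> 'a) set set" where
  "extend N = {mc m s |m s. m \<in> N \<and> s \<in> S}"

lemma rc_unit: "m \<in> carrier M \<Longrightarrow> s \<in> S \<Longrightarrow> rc s \<one> \<odot>\<^bsub>MS\<^esub> mc m s = mc m \<one>"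
  using one_S by (simp add: MS_smult) (intro mc_eqI; simp)

lemma rc_inverse: "m \<in> carrier M \<Longrightarrow> s \<in> S \<Longrightarrow> rc \<one> s \<odot>\<^bsub>MS\<^esub> mc m \<one> = mc m s"
  using one_S by (simp add: MS_smult)

lemma MS_submodule_mem_iff:
  assumes U: "submodule U RS MS" and "m \<in> carrier M" "s \<in> S"
  shows "mc m s \<in> U \<longleftrightarrow> m \<in> contract U"
proof -
  interpret L: module RS MS by (rule MS_module)
  interpret L: smod RS MS "{\<one>\<^bsub>RS\<^esub>}" by (rule L.smod_one)
  show ?thesis
    using L.sub_smult[OF U, of "rc s \<one>" "mc m s"] L.sub_smult[OF U, of "rc \<one> s" "mc m \<one>"]
      rc_unit[OF assms(2,3)] rc_inverse[OF assms(2,3)] assms one_S by (auto simp: contract_def)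
qed

lemma contract_submodule:
  assumes U: "submodule U RS MS" shows "submodule (contract U) R M"
proof -
  interpret L: module RS MS by (rule MS_module)
  interpret L: smod RS MS "{\<one>\<^bsub>RS\<^esub>}" by (rule L.smod_one)
  show ?thesis
  proof (rule submodI)
    show "\<zero>\<^bsub>M\<^esub> \<in> contract U" using L.sub_zero[OF U] by (simp add: contract_def MS_zero)
    fix x y assume "x \<in> contract U" "y \<in> contract U"
    then show "x \<oplus>\<^bsub>M\<^esub> y \<in> contract U"
      using L.sub_add[OF U, of "mc x \<one>" "mc y \<one>"] one_S by (auto simp: contract_def MS_add)
  next
    fix r x assume "r \<in> carrier R" "x \<in> contract U"
    then show "r \<odot>\<^bsub>M\<^esub> x \<in> contract U"
      using L.sub_smult[OF U, of "rc r \<one>" "mc x \<one>"] one_S by (auto simp: contract_def MS_smult)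
  qed (auto simp: contract_def)
qed

lemma extend_submodule:
  assumes N: "submodule N R M" shows "submodule (extend N) RS MS"
proof -
  interpret L: module RS MS by (rule MS_module)
  interpret L: smod RS MS "{\<one>\<^bsub>RS\<^esub>}" by (rule L.smod_one)
  show ?thesis
  proof (rule L.submodI)
    show "extend N \<subseteq> carrier MS" using sub_car[OF N] by (auto simp: extend_def)
    show "\<zero>\<^bsub>MS\<^esub> \<in> extend N" using sub_zero[OF N] one_S by (auto simp: extend_def MS_zero)
    fix x y assume "x \<in> extend N" "y \<in> extend N"
    then obtain m s n t where *: "m \<in> N" "s \<in> S" "x = mc m s" "n \<in> N" "t \<in> S" "y = mc n t"
      by (auto simp: extend_def)
    then have "x \<oplus>\<^bsub>MS\<^esub> y = mc (t \<odot>\<^bsub>M\<^esub> m \<oplus>\<^bsub>M\<^esub> s \<odot>\<^bsub>M\<^esub> n) (s \<otimes> t)" using sub_car[OF N] by (simp add: MS_add)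
    moreover have "t \<odot>\<^bsub>M\<^esub> m \<oplus>\<^bsub>M\<^esub> s \<odot>\<^bsub>M\<^esub> n \<in> N" "s \<otimes> t \<in> S"
      using * mult_S by (auto intro!: sub_add[OF N] sub_smult[OF N])
    ultimately show "x \<oplus>\<^bsub>MS\<^esub> y \<in> extend N" unfolding extend_def by blast
  next
    fix c x assume "c \<in> carrier RS" "x \<in> extend N"
    then obtain r s n t where *: "r \<in> carrier R" "s \<in> S" "c = rc r s" "n \<in> N" "t \<in> S" "x = mc n t"
      by (auto simp: extend_def elim: RS_carrierE)
    then have "c \<odot>\<^bsub>MS\<^esub> x = mc (r \<odot>\<^bsub>M\<^esub> n) (s \<otimes> t)" using sub_car[OF N] by (simp add: MS_smult)
    moreover have "r \<odot>\<^bsub>M\<^esub> n \<in> N" "s \<otimes> t \<in> S" using * mult_S by (auto intro!: sub_smult[OF N])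
    ultimately show "c \<odot>\<^bsub>MS\<^esub> x \<in> extend N" unfolding extend_def by blast
  qed
qed

text \<open>This ties \<open>sat\<close> to actual fractions: the steps counted by
  \<open>len\<close> are those that stay strict after extension.\<close>

lemma contract_extend:
  assumes N: "submodule N R M" shows "contract (extend N) = sat R M S N"
proof
  show "contract (extend N) \<subseteq> sat R M S N"
  proof
    fix m assume "m \<in> contract (extend N)"
    then obtain n s where *: "m \<in> carrier M" "n \<in> N" "s \<in> S" "mc m \<one> = mc n s"
      by (auto simp: contract_def extend_def)
    then obtain u where u: "u \<in> S" "(u \<otimes> s) \<odot>\<^bsub>M\<^esub> m = (u \<otimes> \<one>) \<odot>\<^bsub>M\<^esub> n"
      using mc_eq_iff one_S sub_car[OF N] by metis
    then have "(u \<otimes> s) \<odot>\<^bsub>M\<^esub> m \<in> N" using * by (auto intro: sub_smult[OF N])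
    then show "m \<in> sat R M S N" using *(1) mult_S[OF u(1) *(3)] unfolding sat_def by blast
  qed
  show "sat R M S N \<subseteq> contract (extend N)"
  proof
    fix m assume "m \<in> sat R M S N"
    then obtain s where *: "m \<in> carrier M" "s \<in> S" "s \<odot>\<^bsub>M\<^esub> m \<in> N" by (auto simp: sat_def)
    then have "mc m \<one> = mc (s \<odot>\<^bsub>M\<^esub> m) s" using one_S by (intro mc_eqI) auto
    then show "m \<in> contract (extend N)" using * by (auto simp: contract_def extend_def)
  qed
qed

text \<open>Every submodule over the ring of fractions is determined by its contraction, and that
  contraction is saturated; so a strict step contracts to one that counts.\<close>

lemma len_fraction_le:
  assumes U: "submodule U RS MS"
  shows "len RS MS {\<one>\<^bsub>RS\<^esub>} U Y \<le> len R M S (contract U) (contract Y)"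
proof (rule len_mono_chains)
  interpret L: module RS MS by (rule MS_module)
  interpret L: smod RS MS "{\<one>\<^bsub>RS\<^esub>}" by (rule L.smod_one)
  fix n assume "lchain RS MS {\<one>\<^bsub>RS\<^esub>} U Y n"
  then show "lchain R M S (contract U) (contract Y) n"
  proof (induction)
    case (base U Y)
    then show ?case using contract_submodule by (intro lchain.base) (auto simp: contract_def)
  next
    case (step U N n C)
    have N: "submodule N RS MS" using lchain_submoduleD[OF step.hyps(1)] by simp
    obtain c where c: "c \<in> C" "c \<notin> N" using step.hyps(4) L.sat_increasing[OF N] by auto
    obtain m s where m: "m \<in> carrier M" "s \<in> S" "c = mc m s"
      using L.sub_car[OF step.hyps(2) c(1)] by (rule MS_carrierE)
    have "m \<in> contract C" using c m MS_submodule_mem_iff[OF step.hyps(2)] by simp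
    moreover have "m \<notin> sat R M S (contract N)"
    proof
      assume "m \<in> sat R M S (contract N)"
      then obtain t where t: "t \<in> S" "t \<odot>\<^bsub>M\<^esub> m \<in> contract N" by (auto simp: sat_def)
      then have "mc (t \<odot>\<^bsub>M\<^esub> m) (s \<otimes> t) \<in> N" using m mult_S MS_submodule_mem_iff[OF N] by simp
      moreover have "mc (t \<odot>\<^bsub>M\<^esub> m) (s \<otimes> t) = c"
        using m t mult_S by (simp, intro mc_eqI) (auto simp: smult_assoc1[symmetric])
      ultimately show False using c by simp
    qed
    ultimately show ?case
      using step.IH contract_submodule[OF step.hyps(2)] step.hyps(3)
      by (intro lchain.step) (auto simp: contract_def)
  qed
qed

text \<open>Chains in \<open>M\<close> are extended. The bottom stays \<open>U\<close> because
  \<open>U\<close> lies in the extension of anything above its contraction, and the top is brought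
  back by \<open>extend (contract Y) \<subseteq> Y\<close>.\<close>

lemma len_fraction_ge:
  assumes U: "submodule U RS MS" and Y: "submodule Y RS MS"
  shows "len R M S (contract U) (contract Y) \<le> len RS MS {\<one>\<^bsub>RS\<^esub>} U Y"
proof (rule len_mono_chains)
  interpret L: module RS MS by (rule MS_module)
  interpret L: smod RS MS "{\<one>\<^bsub>RS\<^esub>}" by (rule L.smod_one)
  have "lchain RS MS {\<one>\<^bsub>RS\<^esub>} U (extend N) n" if "lchain R M S A N n" "A = contract U" for A N n
    using that
  proof (induction)
    case (base A N)
    have "U \<subseteq> extend N"
    proof
      fix x assume x: "x \<in> U"
      then obtain m s where m: "m \<in> carrier M" "s \<in> S" "x = mc m s" using L.sub_car[OF U] by (metis MS_carrierE)
      then have "m \<in> N" using x MS_submodule_mem_iff[OF U] base by auto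
      then show "x \<in> extend N" using m by (auto simp: extend_def)
    qed
    then show ?case using U base extend_submodule by (intro lchain.base) auto
  next
    case (step A N n C)
    have N: "submodule N R M" using lchain_submoduleD[OF step.hyps(1)] by simp
    obtain m where m: "m \<in> C" "m \<notin> sat R M S N" using step.hyps(4) by auto
    have "mc m \<one> \<in> extend C" using m one_S by (auto simp: extend_def)
    moreover have "mc m \<one> \<notin> extend N"
      using m contract_extend[OF N] sub_car[OF step.hyps(2)] by (auto simp: contract_def)
    moreover have "sat RS MS {\<one>\<^bsub>RS\<^esub>} (extend N) \<subseteq> extend N" by (auto simp: sat_def)
    moreover have "extend N \<subseteq> extend C" using step.hyps(3) by (auto simp: extend_def)
    ultimately show ?case using step extend_submodule by (intro lchain.step) auto
  qed
  moreover have "extend (contract Y) \<subseteq> Y"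
    using MS_submodule_mem_iff[OF Y] by (auto simp: extend_def contract_def)
  moreover fix n assume "lchain R M S (contract U) (contract Y) n"
  ultimately show "lchain RS MS {\<one>\<^bsub>RS\<^esub>} U Y n" using lchain_mono_right[OF _ Y] by blast
qed

end

text \<open>The ring of fractions as a module over itself and the fraction module of
  \<open>self_module R\<close> differ as records, in the fields \<open>mult\<close> and
  \<open>one\<close>. Submodules and chains do not see these fields and can be transported.\<close>

lemma submodule_cong:
  assumes "carrier M = carrier N" "ring.add M = ring.add N" "ring.zero M = ring.zero N" "smult M = smult N"
  shows "submodule H R M \<longleftrightarrow> submodule H R N"
  using assms by (simp add: submodule_def submodule_axioms_def subgroup_def m_inv_def)

lemma lchain_cong:
  assumes "lchain R M S A B n"
    and "carrier M = carrier N" "ring.add M = ring.add N" "ring.zero M = ring.zero N" "smult M = smult N"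
  shows "lchain R N S A B n"
  using assms(1)
proof (induction)
  case (base A B)
  then show ?case using submodule_cong[OF assms(2-5)] by (auto intro: lchain.base)
next
  case (step A B n C)
  have "sat R M S B = sat R N S B" using assms(2,5) by (simp add: sat_def)
  with step show ?case using submodule_cong[OF assms(2-5)] by (metis lchain.step)
qed

lemma FactRing_carrierD: "w \<in> carrier (R Quot A) \<Longrightarrow> \<exists>x\<in>carrier R. w = A +>\<^bsub>R\<^esub> x"
  by (simp add: FactRing_def A_RCOSETS_def')

context smod
begin

lemma self_RS_simps:
  "carrier (self_module RS) = carrier (fraction_module R (self_module R) S)"
  "ring.add (self_module RS) = ring.add (fraction_module R (self_module R) S)"
  "ring.zero (self_module RS) = ring.zero (fraction_module R (self_module R) S)"
  "smult (self_module RS) = smult (fraction_module R (self_module R) S)"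
  by (simp_all add: RS_simps)

lemma RS_ideal_iff: "ideal H RS \<longleftrightarrow> submodule H RS (fraction_module R (self_module R) S)"
  using smod.ideal_iff_submodule[OF module.smod_one[OF MS_module]] submodule_cong[OF self_RS_simps] by blast

lemma extension_ideal:
  assumes "ideal I R"
  shows "Idl\<^bsub>RS\<^esub> ((\<lambda>r. rc r \<one>) ` I) = smod.extend R (self_module R) S I"
proof -
  interpret self: smod R "self_module R" S by (rule smod_self)
  interpret L: cring RS by (rule RS_cring)
  have E: "ideal (self.extend I) RS"
    using self.extend_submodule[of I] assms by (simp add: RS_ideal_iff ideal_iff_submodule)
  have sub: "(\<lambda>r. rc r \<one>) ` I \<subseteq> carrier RS" using ideal.Icarr[OF assms] one_S by auto
  show ?thesis
  proof
    show "Idl\<^bsub>RS\<^esub> ((\<lambda>r. rc r \<one>) ` I) \<subseteq> self.extend I"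
      using one_S by (intro L.genideal_minimal[OF E]) (auto simp: self.extend_def)
    show "self.extend I \<subseteq> Idl\<^bsub>RS\<^esub> ((\<lambda>r. rc r \<one>) ` I)"
    proof
      fix x assume "x \<in> self.extend I"
      then obtain a s where as: "a \<in> I" "s \<in> S" "x = rc a s" by (auto simp: self.extend_def)
      have "rc a \<one> \<in> Idl\<^bsub>RS\<^esub> ((\<lambda>r. rc r \<one>) ` I)" using L.genideal_self[OF sub] as by auto
      then have "rc \<one> s \<otimes>\<^bsub>RS\<^esub> rc a \<one> \<in> Idl\<^bsub>RS\<^esub> ((\<lambda>r. rc r \<one>) ` I)"
        using ideal.I_l_closed[OF L.genideal_ideal[OF sub]] as by auto
      moreover have "rc \<one> s \<otimes>\<^bsub>RS\<^esub> rc a \<one> = x"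
        using as one_S ideal.Icarr[OF assms] by (simp add: RS_mult)
      ultimately show "x \<in> Idl\<^bsub>RS\<^esub> ((\<lambda>r. rc r \<one>) ` I)" by simp
    qed
  qed
qed

lemma extend_ideal_times_module:
  assumes B: "ideal B R"
  shows "ideal_times_module RS (smod.extend R (self_module R) S B) MS = extend (ideal_times_module R B M)"
proof
  interpret self: smod R "self_module R" S by (rule smod_self)
  interpret LM: module RS MS by (rule MS_module)
  interpret L: smod RS MS "{\<one>\<^bsub>RS\<^esub>}" by (rule LM.smod_one)
  have T: "submodule (ideal_times_module R B M) R M"
    unfolding ideal_times_module_def using ideal.Icarr[OF B] by (intro submodule_span_submodule) auto
  show "ideal_times_module RS (self.extend B) MS \<subseteq> extend (ideal_times_module R B M)"
    unfolding ideal_times_module_def[of RS]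
  proof (rule submodule_span_least[OF extend_submodule[OF T]], clarify)
    fix a x assume "a \<in> self.extend B" and x: "x \<in> carrier MS"
    then obtain b s where b: "b \<in> B" "s \<in> S" "a = rc b s" by (auto simp: self.extend_def)
    obtain m t where m: "m \<in> carrier M" "t \<in> S" "x = mc m t" using x by (rule MS_carrierE)
    have "a \<odot>\<^bsub>MS\<^esub> x = mc (b \<odot>\<^bsub>M\<^esub> m) (s \<otimes> t)" using b m ideal.Icarr[OF B] by (simp add: MS_smult)
    moreover have "b \<odot>\<^bsub>M\<^esub> m \<in> ideal_times_module R B M" using b m by (intro ideal_times_module_mem)
    ultimately show "a \<odot>\<^bsub>MS\<^esub> x \<in> extend (ideal_times_module R B M)"
      using mult_S[OF b(2) m(2)] unfolding extend_def by blast
  qed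
  have E: "ideal (self.extend B) RS"
    using self.extend_submodule[of B] B by (simp add: RS_ideal_iff ideal_iff_submodule)
  have U: "submodule (ideal_times_module RS (self.extend B) MS) RS MS"
    unfolding ideal_times_module_def using ideal.Icarr[OF E] by (intro L.submodule_span_submodule) auto
  have "ideal_times_module R B M \<subseteq> contract (ideal_times_module RS (self.extend B) MS)"
    unfolding ideal_times_module_def[of R]
  proof (rule submodule_span_least[OF contract_submodule[OF U]], clarify)
    fix b m assume b: "b \<in> B" and m: "m \<in> carrier M"
    have "rc b \<one> \<odot>\<^bsub>MS\<^esub> mc m \<one> \<in> ideal_times_module RS (self.extend B) MS"
      using b m one_S by (intro ideal_times_module_mem) (auto simp: self.extend_def)
    then show "b \<odot>\<^bsub>M\<^esub> m \<in> contract (ideal_times_module RS (self.extend B) MS)"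
      using b m one_S ideal.Icarr[OF B] by (simp add: MS_smult contract_def)
  qed
  then show "extend (ideal_times_module R B M) \<subseteq> ideal_times_module RS (self.extend B) MS"
    using MS_submodule_mem_iff[OF U] sub_car[OF T] by (auto simp: extend_def)
qed

section \<open>Annihilator and dimension of the localised module\<close>

lemma annihilator_ideal: "ideal (annihilator R M) R"
proof -
  interpret self: smod R "self_module R" S by (rule smod_self)
  have "submodule (annihilator R M) R (self_module R)"
    by (rule self.submodI) (auto simp: annihilator_def smult_l_distr smult_assoc1)
  then show ?thesis by (simp add: ideal_iff_submodule)
qed

lemma fraction_hom: "(\<lambda>r. rc r \<one>) \<in> ring_hom R RS"
  using one_S by (intro ring_hom_memI) (auto simp: RS_mult RS_add RS_one)

text \<open>The aim is finiteness, so that \<open>the_enat\<close> returns the true dimension.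
  Primes are pulled back to \<open>R\<close>; strict inclusions stay strict because every element of
  the quotient is a unit times the image of an element of \<open>R\<close>.\<close>

lemma krull_dim_quot_le:
  assumes A: "ideal A RS" and N: "\<And>n f. prime_chain R n f \<Longrightarrow> n \<le> N"
  shows "krull_dim (RS Quot A) \<le> enat N"
  unfolding krull_dim_def
proof (rule Sup_least, clarify)
  interpret L: cring RS by (rule RS_cring)
  interpret A: ideal A RS by fact
  fix n Q assume Q: "\<forall>i\<le>n. primeideal (Q i) (RS Quot A)" "\<forall>i<n. Q i \<subset> Q (Suc i)"
  define h where "h = (\<lambda>r. A +>\<^bsub>RS\<^esub> r) \<circ> (\<lambda>r. rc r \<one>)"
  interpret h: ring_hom_ring R "RS Quot A" h
    unfolding h_def
    by (rule ring_hom_ringI2[OF R.ring_axioms A.quotient_is_ring ring_hom_trans[OF fraction_hom A.rcos_ring_hom]])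
  interpret q: ring_hom_ring RS "RS Quot A" "\<lambda>r. A +>\<^bsub>RS\<^esub> r"
    by (rule A.rcos_ring_hom_ring)
  define f where "f = (\<lambda>i. {r \<in> carrier R. h r \<in> Q i})"
  have "prime_chain R n f"
    unfolding prime_chain_def
  proof (intro conjI allI impI)
    fix i assume "i \<le> n"
    then show "primeideal (f i) R" using Q(1) h.primeideal_vimage[OF R.is_cring] by (simp add: f_def)
  next
    fix i assume i: "i < n"
    then obtain w where w: "w \<in> Q (Suc i)" "w \<notin> Q i" using Q(2) by auto
    have p: "primeideal (Q i) (RS Quot A)" "primeideal (Q (Suc i)) (RS Quot A)" using Q(1) i by auto
    note I = primeideal.axioms(1)[OF p(1)] primeideal.axioms(1)[OF p(2)]
    have "w \<in> carrier (RS Quot A)" using ideal.Icarr[OF I(2) w(1)] .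
    from FactRing_carrierD[OF this] obtain x where x: "x \<in> carrier RS" "w = A +>\<^bsub>RS\<^esub> x" by (elim bexE)
    obtain a s where "a \<in> carrier R" "s \<in> S" "x = rc a s" using x(1) by (rule RS_carrierE)
    with x have as: "a \<in> carrier R" "s \<in> S" "w = A +>\<^bsub>RS\<^esub> rc a s" by auto
    \<comment> \<open>The denominator \<open>s\<close> is cleared by a unit, so membership of
      \<open>w\<close> in a prime can be read off from \<open>a\<close>.\<close>
    have "rc (s \<otimes> a) s = rc a \<one>" using as one_S by (intro rc_eqI) auto
    then have eqs: "rc s \<one> \<otimes>\<^bsub>RS\<^esub> rc a s = rc a \<one>" "rc \<one> s \<otimes>\<^bsub>RS\<^esub> rc a \<one> = rc a s"
      using as one_S by (simp_all add: RS_mult)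
    have "(A +>\<^bsub>RS\<^esub> rc s \<one>) \<otimes>\<^bsub>RS Quot A\<^esub> w = h a"
      using as one_S q.hom_mult[of "rc s \<one>" "rc a s"] by (simp add: h_def eqs)
    then have "h a \<in> Q (Suc i)"
      using ideal.I_l_closed[OF I(2) w(1), of "A +>\<^bsub>RS\<^esub> rc s \<one>"] as one_S q.hom_closed by simp
    moreover have "h a \<notin> Q i"
    proof
      assume "h a \<in> Q i"
      then have "(A +>\<^bsub>RS\<^esub> rc \<one> s) \<otimes>\<^bsub>RS Quot A\<^esub> h a \<in> Q i"
        using ideal.I_l_closed[OF I(1), of "h a" "A +>\<^bsub>RS\<^esub> rc \<one> s"] as q.hom_closed by simp
      moreover have "(A +>\<^bsub>RS\<^esub> rc \<one> s) \<otimes>\<^bsub>RS Quot A\<^esub> h a = w"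
        using as one_S q.hom_mult[of "rc \<one> s" "rc a \<one>"] by (simp add: h_def eqs)
      ultimately show False using w by simp
    qed
    moreover have "f i \<subseteq> f (Suc i)" using Q(2) i by (auto simp: f_def)
    ultimately show "f i \<subset> f (Suc i)" using as by (auto simp: f_def)
  qed
  then show "enat n \<le> enat N" using N by simp
qed

text \<open>Primes disjoint from \<open>S\<close> are recovered from their extensions, so a chain in
  \<open>R\<close> stays strict after extension, and then modulo \<open>A\<close> since
  \<open>A\<close> lies in its first term.\<close>

lemma krull_dim_quot_ge:
  assumes A: "ideal A RS" and f: "prime_chain R n f" and S: "f n \<inter> S = {}"
    and Af: "A \<subseteq> smod.extend R (self_module R) S (f 0)"
  shows "enat n \<le> krull_dim (RS Quot A)"
proof -
  interpret self: smod R "self_module R" S by (rule smod_self)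
  interpret L: cring RS by (rule RS_cring)
  interpret A: ideal A RS by fact
  interpret q: ring_hom_ring RS "RS Quot A" "\<lambda>r. A +>\<^bsub>RS\<^esub> r"
    by (rule A.rcos_ring_hom_ring)
  have prime: "primeideal (f i) R" if "i \<le> n" for i using f that by (auto simp: prime_chain_def)
  have mono: "i \<le> j \<Longrightarrow> j \<le> n \<Longrightarrow> f i \<subseteq> f j" for i j
  proof (induction j)
    case (Suc j)
    then have "f j \<subset> f (Suc j)" using f by (auto simp: prime_chain_def)
    with Suc show ?case by (cases "i = Suc j") auto
  qed simp
  define E where "E = (\<lambda>i. self.extend (f i))"
  define G where "G = (\<lambda>i. (\<lambda>x. A +>\<^bsub>RS\<^esub> x) ` E i)"
  have sm: "submodule (f i) R (self_module R)" if "i \<le> n" for i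
    using prime[OF that] by (simp add: ideal_iff_submodule primeideal.axioms)
  have E: "ideal (E i) RS" if "i \<le> n" for i
    using self.extend_submodule[OF sm[OF that]] by (simp add: RS_ideal_iff E_def)
  have memE: "rc a s \<in> E i \<longleftrightarrow> a \<in> f i" if "i \<le> n" "a \<in> carrier R" "s \<in> S" for a s i
  proof -
    have "f i \<inter> S = {}" using S mono[OF that(1) order_refl] by auto
    then have "sat R (self_module R) S (f i) = f i"
      using sat_prime[OF prime[OF that(1)]] self.sat_increasing[OF sm[OF that(1)]] by (auto simp: sat_def)
    then show ?thesis
      using self.MS_submodule_mem_iff[OF self.extend_submodule[OF sm[OF that(1)]]] that
        self.contract_extend[OF sm[OF that(1)]] by (simp add: E_def)
  qed
  have AE: "A \<subseteq> E i" if "i \<le> n" for i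
    using Af mono[of 0 i] that by (auto simp: E_def self.extend_def)
  have GI: "ideal (G i) (RS Quot A)" if "i \<le> n" for i
    unfolding G_def by (rule L.ring_ideal_imp_quot_ideal[OF A E[OF that]])
  \<comment> \<open>As \<open>A\<close> is contained in \<open>E i\<close>, membership of a coset
    does not depend on its representative.\<close>
  have memG: "A +>\<^bsub>RS\<^esub> x \<in> G i \<longleftrightarrow> x \<in> E i" if "i \<le> n" "x \<in> carrier RS" for x i
  proof -
    have "\<Union> (G i) = E i"
      using L.ideal_incl_iff[OF A E[OF that(1)]] AE[OF that(1)] by (auto simp: G_def)
    moreover have "G i \<subseteq> carrier (RS Quot A)" using ideal.Icarr[OF GI[OF that(1)]] by auto
    ultimately show ?thesis using L.canonical_proj_vimage_mem_iff[OF A _ that(2)] by metis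
  qed
  have one: "\<one>\<^bsub>RS\<^esub> \<notin> E i" if "i \<le> n" for i
    using memE[OF that, of \<one> \<one>] one_S ideal.one_imp_carrier[OF primeideal.axioms(1)[OF prime[OF that]]]
      primeideal.I_notcarr[OF prime[OF that]] by (auto simp: RS_one)
  have car: "\<exists>x\<in>carrier RS. w = A +>\<^bsub>RS\<^esub> x" if "w \<in> carrier (RS Quot A)" for w
    using that by (rule FactRing_carrierD)
  have GP: "primeideal (G i) (RS Quot A)" if i: "i \<le> n" for i
  proof (rule primeidealI[OF GI[OF i] A.quotient_is_cring[OF RS_cring]])
    have "A +>\<^bsub>RS\<^esub> \<one>\<^bsub>RS\<^esub> \<notin> G i" using memG[OF i L.one_closed] one[OF i] by blast
    moreover have "A +>\<^bsub>RS\<^esub> \<one>\<^bsub>RS\<^esub> \<in> carrier (RS Quot A)" by (rule q.hom_closed) simp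
    ultimately show "carrier (RS Quot A) \<noteq> G i" by auto
    fix v w assume "v \<in> carrier (RS Quot A)" "w \<in> carrier (RS Quot A)" and vw: "v \<otimes>\<^bsub>RS Quot A\<^esub> w \<in> G i"
    then obtain x y where "x \<in> carrier RS" "v = A +>\<^bsub>RS\<^esub> x" "y \<in> carrier RS" "w = A +>\<^bsub>RS\<^esub> y"
      using car by metis
    then obtain a s b t where *: "a \<in> carrier R" "s \<in> S" "v = A +>\<^bsub>RS\<^esub> rc a s"
      "b \<in> carrier R" "t \<in> S" "w = A +>\<^bsub>RS\<^esub> rc b t" by (metis RS_carrierE)
    have "v \<otimes>\<^bsub>RS Quot A\<^esub> w = A +>\<^bsub>RS\<^esub> rc (a \<otimes> b) (s \<otimes> t)"
      using * q.hom_mult[of "rc a s" "rc b t"] by (simp add: RS_mult)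
    then have "a \<otimes> b \<in> f i" using vw * memG[OF i] memE[OF i] mult_S by simp
    then have "a \<in> f i \<or> b \<in> f i" using primeideal.I_prime[OF prime[OF i]] * by blast
    then show "v \<in> G i \<or> w \<in> G i" using * memG[OF i] memE[OF i] by simp
  qed
  have "G i \<subset> G (Suc i)" if i: "i < n" for i
  proof -
    have ff: "f i \<subset> f (Suc i)" using f i by (auto simp: prime_chain_def)
    then obtain r where r: "r \<in> f (Suc i)" "r \<notin> f i" by auto
    have rc: "r \<in> carrier R" using self.sub_car[OF sm r(1)] i by simp
    have "A +>\<^bsub>RS\<^esub> rc r \<one> \<in> G (Suc i)" "A +>\<^bsub>RS\<^esub> rc r \<one> \<notin> G i"
      using memG memE r rc one_S i by auto
    moreover have "G i \<subseteq> G (Suc i)" using ff by (auto simp: G_def E_def self.extend_def)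
    ultimately show ?thesis by auto
  qed
  then have "\<exists>Q. (\<forall>i\<le>n. primeideal (Q i) (RS Quot A)) \<and> (\<forall>i<n. Q i \<subset> Q (Suc i))"
    using GP by blast
  then show ?thesis unfolding krull_dim_def by (intro Sup_upper) auto
qed

end

section \<open>From prime chains in \<open>R\<close> to the localised statement\<close>

context F_finite_ring
begin

text \<open>If \<open>a/s\<close> annihilates the localised module then \<open>a\<close> lies in
  \<open>loc_ann M P\<close>. So a chain of primes of \<open>R\<close> above
  \<open>loc_ann M P\<close> ending at \<open>P\<close> extends to a chain above the annihilator,
  and its length is bounded by the dimension.\<close>

lemma module_dim_bounds:
  assumes M: "module R M" and P: "primeideal P R"
  shows "\<exists>d. module_dim (loc_ring R P) (loc_module R M P) = enat d \<and>
    (\<forall>n f. prime_chain R n f \<longrightarrow> loc_ann M P \<subseteq> f 0 \<longrightarrow> f n = P \<longrightarrow> n \<le> d)"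
proof -
  interpret smod R M "carrier R - P" using M P by (rule smodI)
  interpret self: smod R "self_module R" "carrier R - P" by (rule smod_self)
  interpret LM: module RS MS by (rule MS_module)
  interpret L: smod RS MS "{\<one>\<^bsub>RS\<^esub>}" by (rule LM.smod_one)
  let ?A = "annihilator RS MS"
  note A = L.annihilator_ideal
  obtain N where "\<And>n f. prime_chain R n f \<Longrightarrow> n \<le> N" using prime_chain_bounded by blast
  then have "krull_dim (RS Quot ?A) \<le> enat N" by (rule krull_dim_quot_le[OF A])
  then obtain d where d: "krull_dim (RS Quot ?A) = enat d" by (cases "krull_dim (RS Quot ?A)") auto
  have "n \<le> d" if f: "prime_chain R n f" and ann: "loc_ann M P \<subseteq> f 0" and fn: "f n = P" for n f
  proof -
    have "?A \<subseteq> self.extend (f 0)"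
    proof
      fix x assume x: "x \<in> ?A"
      then have xc: "x \<in> carrier RS" and kill: "\<And>m. m \<in> carrier MS \<Longrightarrow> x \<odot>\<^bsub>MS\<^esub> m = \<zero>\<^bsub>MS\<^esub>"
        by (auto simp: annihilator_def)
      obtain a s where a: "a \<in> carrier R" "s \<in> carrier R - P" "x = rc a s" using xc by (rule RS_carrierE)
      have "a \<in> loc_ann M P"
        unfolding loc_ann_def
      proof (intro CollectI conjI ballI)
        fix m assume m: "m \<in> carrier M"
        have "mc (a \<odot>\<^bsub>M\<^esub> m) s = mc \<zero>\<^bsub>M\<^esub> \<one>"
          using kill[of "mc m \<one>"] a m one_S by (simp add: MS_smult MS_zero)
        then obtain u where "u \<in> carrier R - P" "(u \<otimes> \<one>) \<odot>\<^bsub>M\<^esub> (a \<odot>\<^bsub>M\<^esub> m) = (u \<otimes> s) \<odot>\<^bsub>M\<^esub> \<zero>\<^bsub>M\<^esub>"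
          using mc_eq_iff[of "a \<odot>\<^bsub>M\<^esub> m" s "\<zero>\<^bsub>M\<^esub>" \<one>] a m one_S by auto
        then show "\<exists>t\<in>carrier R - P. t \<odot>\<^bsub>M\<^esub> (a \<odot>\<^bsub>M\<^esub> m) = \<zero>\<^bsub>M\<^esub>" using a by auto
      qed (rule a(1))
      then show "x \<in> self.extend (f 0)" using ann a by (auto simp: self.extend_def)
    qed
    then have "enat n \<le> krull_dim (RS Quot ?A)" using fn by (intro krull_dim_quot_ge[OF A f]) auto
    then show "n \<le> d" using d by simp
  qed
  then show ?thesis using d by (auto simp: module_dim_def)
qed

text \<open>An inclusion of the localised ideals does not give \<open>I \<subseteq> J\<close>. Both
  are therefore replaced by their contractions \<open>I0 \<subseteq> J0\<close>, to which a
  filtration over \<open>R\<close> applies; passing to them alters the products with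
  \<open>M\<close> only within their saturations. The witness \<open>n\<close> is the number of
  residue fields at \<open>P\<close> in \<open>J0 / I0\<close>.\<close>

lemma length_fraction_bound:
  assumes M: "module R M" and P: "primeideal P R" and I: "ideal I R" and J: "ideal J R"
    and pair: "primary_pair (loc_ring R P) (loc_ideal R P P) (loc_ideal R I P) (loc_ideal R J P)"
  shows "\<exists>n. enat n \<le> module_length (loc_ring R P)
            (quot_module (self_module (loc_ring R P)) (loc_ideal R J P) (loc_ideal R I P)) \<and>
      module_length (loc_ring R P)
          (quot_module (loc_module R M P)
             (ideal_times_module (loc_ring R P) (loc_ideal R (frobenius_power R J (p ^ e)) P) (loc_module R M P))
             (ideal_times_module (loc_ring R P) (loc_ideal R (frobenius_power R I (p ^ e)) P) (loc_module R M P)))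
      \<le> enat n * len R M (carrier R - P) (frob_times R M (p ^ e) P) (carrier M)"
proof -
  note smod = smodI[OF M P]
  interpret smod R M "carrier R - P" by (rule smod)
  interpret self: smod R "self_module R" "carrier R - P" by (rule smod_self)
  interpret LM: module RS MS by (rule MS_module)
  interpret L: smod RS MS "{\<one>\<^bsub>RS\<^esub>}" by (rule LM.smod_one)
  interpret P: primeideal P R by fact
  interpret LS: module RS "self_module RS" by (rule LM.R.module_self_module)
  let ?S = "carrier R - P" and ?q = "p ^ e"
  let ?T = "frob_times R M ?q" and ?FS = "fraction_module R (self_module R) (carrier R - P)"
  have loc: "loc_ideal R B P = self.extend B" if "ideal B R" for B
    unfolding loc_ideal_def by (rule extension_ideal[OF that])
  define I0 where "I0 = self.contract (loc_ideal R I P)"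
  define J0 where "J0 = self.contract (loc_ideal R J P)"
  have IL: "ideal (loc_ideal R I P) RS" and JL: "ideal (loc_ideal R J P) RS"
    and IJ: "loc_ideal R I P \<subseteq> loc_ideal R J P" and rad: "ideal_radical RS (loc_ideal R I P) = loc_ideal R P P"
    using pair by (auto simp: primary_pair_def)
  note ILF = IL[unfolded RS_ideal_iff] and JLF = JL[unfolded RS_ideal_iff]
  have I0: "ideal I0 R" and J0: "ideal J0 R"
    using self.contract_submodule[OF ILF] self.contract_submodule[OF JLF]
    by (simp_all add: I0_def J0_def ideal_iff_submodule)
  have IJ0: "I0 \<subseteq> J0" using IJ by (auto simp: I0_def J0_def self.contract_def)
  have car: "I \<subseteq> carrier R" "J \<subseteq> carrier R" "I0 \<subseteq> carrier R" "J0 \<subseteq> carrier R"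
    using ideal.Icarr I J I0 J0 by auto
  have I0_sat: "I0 = sat R (self_module R) ?S I" and J0_sat: "J0 = sat R (self_module R) ?S J"
    using self.contract_extend I J by (simp_all add: I0_def J0_def loc ideal_iff_submodule)
  have sub: "I \<subseteq> I0" "J \<subseteq> J0"
    using self.sat_increasing I J unfolding I0_sat J0_sat by (simp_all add: ideal_iff_submodule)
  \<comment> \<open>The radical condition puts a power of each \<open>x \<in> P\<close> into the
    contraction \<open>I0\<close>, so no prime strictly below \<open>P\<close> contains
    \<open>I0\<close>.\<close>
  have iso: "isolated_at R P I0"
    unfolding isolated_at_def
  proof (intro allI impI)
    fix Q assume Q: "primeideal Q R" "I0 \<subseteq> Q" "Q \<subseteq> P"
    have "P \<subseteq> Q"
    proof
      fix x assume x: "x \<in> P"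
      then have "rc x \<one> \<in> ideal_radical RS (loc_ideal R I P)"
        unfolding rad loc[OF P.is_ideal] self.extend_def using one_S by blast
      then obtain n :: nat where n: "rc x \<one> [^]\<^bsub>RS\<^esub> n \<in> loc_ideal R I P" by (auto simp: ideal_radical_def)
      have "rc x \<one> [^]\<^bsub>RS\<^esub> n = rc (x [^] n) \<one>"
        using x one_S by (induction n) (auto simp: RS_one RS_mult)
      then have "x [^] n \<in> I0" using n x by (simp add: I0_def self.contract_def)
      then have xn: "x [^] n \<in> Q" using Q by auto
      have "n > 0"
      proof (rule ccontr)
        assume "\<not> n > 0"
        then have "\<one> \<in> Q" using xn by simp
        then show False using Q(3) one_S by auto
      qed
      then show "x \<in> Q" using primeideal.pow_mem_iff[OF Q(1)] x xn by auto
    qed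
    then show "Q = P" using Q by auto
  qed
  obtain Qs where Qs: "pfilt R (self_module R) I0 J0 Qs" using pfilt_ideal_exists[OF noeth I0 J0 IJ0] by blast
  note iso' = pfilt_isolated[OF Qs I0 iso]
  define n where "n = count_list Qs P"
  have len_n: "len R (self_module R) ?S I0 J0 = enat n"
    unfolding n_def by (rule self.pfilt_len_count[OF Qs P refl iso'])
  \<comment> \<open>The count \<open>n\<close> over \<open>R\<close> is bounded by the length on the
    right-hand side of the claim; \<open>lchain_cong\<close> then exchanges the two module
    structures on the ring of fractions.\<close>
  have "enat n \<le> len RS ?FS {\<one>\<^bsub>RS\<^esub>} (loc_ideal R I P) (loc_ideal R J P)"
    unfolding len_n[symmetric] I0_def J0_def by (rule self.len_fraction_ge[OF ILF JLF])
  also have "\<dots> \<le> len RS (self_module RS) {\<one>\<^bsub>RS\<^esub>} (loc_ideal R I P) (loc_ideal R J P)"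
    by (rule len_mono_chains) (erule lchain_cong; simp add: RS_simps)
  also have "\<dots> = module_length RS (quot_module (self_module RS) (loc_ideal R J P) (loc_ideal R I P))"
    using IL JL IJ by (intro LS.module_length_quot[symmetric]) (simp_all add: L.ideal_iff_submodule)
  finally have n_le: "enat n \<le> module_length RS (quot_module (self_module RS) (loc_ideal R J P) (loc_ideal R I P))" .
  have FP: "ideal (frobenius_power R B ?q) R" if "B \<subseteq> carrier R" for B using that by (rule frobenius_power_ideal)
  have NE: "ideal_times_module RS (loc_ideal R (frobenius_power R B ?q) P) MS = extend (?T B)" if "B \<subseteq> carrier R" for B
    unfolding loc[OF FP[OF that]] frob_times_def by (rule extend_ideal_times_module[OF FP[OF that]])
  note T = frob_times_submodule[OF smod]
  \<comment> \<open>If \<open>s x \<in> B\<close> then \<open>s^q\<close> multiplies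
    \<open>x^q m\<close> into \<open>B^[q] M\<close>, and \<open>s^q\<close> is again outside the
    prime \<open>P\<close>.\<close>
  have Tsat: "?T (sat R (self_module R) ?S B) \<subseteq> sat R M ?S (?T B)" if "B \<subseteq> carrier R" for B
  proof (rule frob_times_least[OF smod sat_submodule[OF T[OF that]]])
    show "sat R (self_module R) ?S B \<subseteq> carrier R" by (auto simp: sat_def)
    fix x m assume "x \<in> sat R (self_module R) ?S B" and m: "m \<in> carrier M"
    then obtain s where s: "x \<in> carrier R" "s \<in> ?S" "s \<otimes> x \<in> B" by (auto simp: sat_def)
    have "(s [^] ?q) \<odot>\<^bsub>M\<^esub> ((x [^] ?q) \<odot>\<^bsub>M\<^esub> m) = ((s \<otimes> x) [^] ?q) \<odot>\<^bsub>M\<^esub> m"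
      using s m by (simp add: nat_pow_distrib smult_assoc1)
    also have "\<dots> \<in> ?T B" by (rule frob_times_mem[OF smod that s(3) m])
    finally have "(s [^] ?q) \<odot>\<^bsub>M\<^esub> ((x [^] ?q) \<odot>\<^bsub>M\<^esub> m) \<in> ?T B" .
    moreover have "s [^] ?q \<in> ?S" using s primeideal.pow_mem_iff[OF P] p_gt_0 by auto
    ultimately show "(x [^] ?q) \<odot>\<^bsub>M\<^esub> m \<in> sat R M ?S (?T B)" using s m by (auto simp: sat_def)
  qed
  have TI0: "?T I0 \<subseteq> sat R M ?S (?T I)" unfolding I0_sat by (rule Tsat[OF car(1)])
  have TJ0: "?T J0 \<subseteq> sat R M ?S (?T J)" unfolding J0_sat by (rule Tsat[OF car(2)])
  have "?T I \<subseteq> ?T J0" using sub IJ0 car by (intro frob_times_mono[OF smod]) auto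
  then have "sat R M ?S (?T I) \<subseteq> sat R M ?S (sat R M ?S (?T J))" using TJ0 by (intro sat_mono) auto
  then have satIJ: "sat R M ?S (?T I) \<subseteq> sat R M ?S (?T J)" using sat_sat[OF T[OF car(2)]] by simp
  have satJ: "sat R M ?S (?T J) \<subseteq> sat R M ?S (?T J0)"
    using sub car by (intro sat_mono frob_times_mono[OF smod]) auto
  note sT = sat_submodule[OF T]
  have ext: "extend (?T I) \<subseteq> extend (?T J)"
  proof
    fix x assume "x \<in> extend (?T I)"
    then obtain m s where m: "m \<in> ?T I" "s \<in> ?S" "x = mc m s" by (auto simp: extend_def)
    then have mc: "m \<in> carrier M" using sub_car[OF T[OF car(1)]] by auto
    have "m \<in> sat R M ?S (?T J)" using m satIJ sat_increasing[OF T[OF car(1)]] by auto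
    then have "m \<in> contract (extend (?T J))" using contract_extend[OF T[OF car(2)]] by simp
    then show "x \<in> extend (?T J)"
      using MS_submodule_mem_iff[OF extend_submodule[OF T[OF car(2)]] mc m(2)] m(3) by simp
  qed
  have "module_length RS (quot_module MS (extend (?T J)) (extend (?T I)))
      = len RS MS {\<one>\<^bsub>RS\<^esub>} (extend (?T I)) (extend (?T J))"
    by (rule LM.module_length_quot[OF extend_submodule[OF T[OF car(2)]] extend_submodule[OF T[OF car(1)]] ext])
  also have "\<dots> \<le> len R M ?S (sat R M ?S (?T I)) (sat R M ?S (?T J))"
    using len_fraction_le[OF extend_submodule[OF T[OF car(1)]], where Y = "extend (?T J)"]
    by (simp add: contract_extend T car)
  \<comment> \<open>The interval is widened at both ends, to \<open>?T I0\<close> below and to the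
    saturation of \<open>?T J0\<close> above. The piece between \<open>?T J0\<close> and its
    saturation has length \<open>0\<close>, so only the filtered part from \<open>I0\<close> to
    \<open>J0\<close> remains.\<close>
  also have "\<dots> \<le> len R M ?S (?T I0) (sat R M ?S (?T J0))"
    by (rule len_mono[OF sT[OF car(1)] sT[OF car(2)] T[OF car(3)] sT[OF car(4)] TI0 satIJ satJ])
  also have "\<dots> = len R M ?S (?T I0) (?T J0) + len R M ?S (?T J0) (sat R M ?S (?T J0))"
    by (rule len_add[OF T[OF car(3)] T[OF car(4)] sT[OF car(4)] frob_times_mono[OF smod IJ0 car(4)]
          sat_increasing[OF T[OF car(4)]]])
  also have "\<dots> = len R M ?S (?T I0) (?T J0)" using len_eq_0[OF T[OF car(4)]] by simp
  also have "\<dots> \<le> enat n * len R M ?S (?T P) (carrier M)"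
    unfolding n_def by (rule len_frob_times_le[OF M P Qs iso'])
  finally show ?thesis using n_le NE[OF car(1)] NE[OF car(2)] by auto
qed

end

theorem proposition3p3:
  fixes R :: "('a, 'r) ring_scheme" and M :: "('a, 'm, 'k) module_scheme" and p :: nat
  assumes "cring R" and "noetherian_ring R"
    and "Factorial_Ring.prime p" and "ring_char R = p"
    and "F_finite R"
    and "module R M" and "fin_gen_module R M"
  shows "\<exists>C::real. C > 0 \<and>
    (\<forall>P e I J.
       primeideal P R \<longrightarrow> ideal I R \<longrightarrow> ideal J R \<longrightarrow>
       primary_pair (loc_ring R P) (loc_ideal R P P) (loc_ideal R I P) (loc_ideal R J P) \<longrightarrow>
       (let R\<^sub>P = loc_ring R P; M\<^sub>P = loc_module R M P; q = p ^ e in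
        ereal_of_enat (module_length R\<^sub>P
          (quot_module M\<^sub>P
             (ideal_times_module R\<^sub>P (loc_ideal R (frobenius_power R J q) P) M\<^sub>P)
             (ideal_times_module R\<^sub>P (loc_ideal R (frobenius_power R I q) P) M\<^sub>P)))
        \<le> ereal (C * real q ^ the_enat (module_dim R\<^sub>P M\<^sub>P)) *
          ereal_of_enat (module_length R\<^sub>P
            (quot_module (self_module R\<^sub>P) (loc_ideal R J P) (loc_ideal R I P)))))"
proof -
  interpret F_finite_ring R p
    using assms by (simp add: F_finite_ring_def F_finite_ring_axioms_def char_p_def char_p_axioms_def)
  obtain C where C: "C \<ge> 0" and bound: "\<And>P e d. primeideal P R \<Longrightarrow>
     (\<forall>n f. prime_chain R n f \<longrightarrow> loc_ann M P \<subseteq> f 0 \<longrightarrow> f n = P \<longrightarrow> n \<le> d) \<Longrightarrow>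
     \<exists>k. len R M (carrier R - P) (frob_times R M (p ^ e) P) (carrier M) = enat k \<and>
       real k \<le> C * (real p ^ e) ^ d"
    using uniform_bound[OF assms(6,7)] by metis
  show ?thesis
  \<comment> \<open>Adding \<open>1\<close> makes the constant strictly positive, since
    \<open>C\<close> may be \<open>0\<close>, for instance for an empty filtration of
    \<open>M = 0\<close>.\<close>
  proof (rule exI[of _ "C + 1"], intro conjI allI impI)
    show "C + 1 > 0" using C by simp
    fix P e I J
    assume P: "primeideal P R" and I: "ideal I R" and J: "ideal J R"
      and pair: "primary_pair (loc_ring R P) (loc_ideal R P P) (loc_ideal R I P) (loc_ideal R J P)"
    let ?L = "module_length (loc_ring R P)
            (quot_module (self_module (loc_ring R P)) (loc_ideal R J P) (loc_ideal R I P))"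
    let ?K = "module_length (loc_ring R P)
          (quot_module (loc_module R M P)
             (ideal_times_module (loc_ring R P) (loc_ideal R (frobenius_power R J (p ^ e)) P) (loc_module R M P))
             (ideal_times_module (loc_ring R P) (loc_ideal R (frobenius_power R I (p ^ e)) P) (loc_module R M P)))"
    obtain d where d: "module_dim (loc_ring R P) (loc_module R M P) = enat d"
      "\<forall>n f. prime_chain R n f \<longrightarrow> loc_ann M P \<subseteq> f 0 \<longrightarrow> f n = P \<longrightarrow> n \<le> d"
      using module_dim_bounds[OF assms(6) P] by blast
    obtain k where k: "len R M (carrier R - P) (frob_times R M (p ^ e) P) (carrier M) = enat k"
      "real k \<le> C * (real p ^ e) ^ d"
      using bound[OF P d(2)] by blast
    obtain n where n: "enat n \<le> ?L" "?K \<le> enat n * enat k"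
      using length_fraction_bound[OF assms(6) P I J pair, of e] k(1) by auto
    have q: "(real p ^ e) ^ d \<ge> 0" by simp
    have "ereal_of_enat ?K \<le> ereal_of_enat (enat (n * k))" using n(2) by (simp only: ereal_of_enat_le_iff times_enat_simps)
    also have "\<dots> = ereal (real k * real n)" by simp
    also have "\<dots> \<le> ereal ((C + 1) * (real p ^ e) ^ d * real n)"
    proof -
      have "real k \<le> (C + 1) * (real p ^ e) ^ d" using k(2) q unfolding distrib_right mult_1 by linarith
      then show ?thesis by (simp add: mult_right_mono)
    qed
    also have "\<dots> = ereal ((C + 1) * (real p ^ e) ^ d) * ereal_of_enat (enat n)" by simp
    \<comment> \<open>\<open>?L\<close> is an extended natural number, so the finite count
      \<open>n\<close> is replaced by it within \<open>ereal\<close>, where multiplication by a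
      nonnegative real is monotone.\<close>
    also have "\<dots> \<le> ereal ((C + 1) * (real p ^ e) ^ d) * ereal_of_enat ?L"
      using C by (intro ereal_mult_left_mono[OF iffD2[OF ereal_of_enat_le_iff n(1)]]) simp
    finally show "let R\<^sub>P = loc_ring R P; M\<^sub>P = loc_module R M P; q = p ^ e in
        ereal_of_enat (module_length R\<^sub>P
          (quot_module M\<^sub>P
             (ideal_times_module R\<^sub>P (loc_ideal R (frobenius_power R J q) P) M\<^sub>P)
             (ideal_times_module R\<^sub>P (loc_ideal R (frobenius_power R I q) P) M\<^sub>P)))
        \<le> ereal ((C + 1) * real q ^ the_enat (module_dim R\<^sub>P M\<^sub>P)) *
          ereal_of_enat (module_length R\<^sub>P
            (quot_module (self_module R\<^sub>P) (loc_ideal R J P) (loc_ideal R I P)))"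
      using d(1) by (simp add: Let_def)
  qed
qed

end
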